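(* Edge ideals of complete multipartite graphs have homological linear powers. That is, if $G$ is a complete multipartite graph on $[n]$ and $I=I(G)\subset S=K[x_1,\dots,x_n]$ is its edge ideal, then $\mathrm{HS}_i(I^k)$ has a linear resolution for all integers $i\ge0$ and $k\ge1$.
   Context: $K$ is a field and $S=K[x_1,\dots,x_n]$ is the standard graded polynomial ring. For a finite simple graph $G$ with vertex set $[n]=\{1,\dots,n\}$ and edge set $E(G)$, the edge ideal $I(G)\subset S$ is the ideal generated by the monomials $x_ix_j$ with $\{i,j\}\in E(G)$. For integers $a\le b$ put $[a,b]=\{c\in\mathbb{Z}:a\le c\le b\}$. A graph $G$ with $V(G)=[n]$ is complete multipartite if there is a vertex partition $V_1,\dots,V_r$ with $V_i=[t_{i-1}+1,t_i]$ for $i=1,\dots,r$, where $t_0=0$ and $t_r=n$, such that $E(G)=\{\{i,j\}: i\in V_k,\ j\in V_\ell,\ k\ne\ell\}$. For ${\bf a}=(a_1,\dots,a_n)\in\mathbb{Z}_{\ge0}^n$ put ${\bf x}^{\bf a}=x_1^{a_1}\cdots x_n^{a_n}$. The $i$th homological shift ideal of a monomial ideal $I\subset S$ is $\mathrm{HS}_i(I)=({\bf x}^{\bf a} : \mathrm{Tor}_i^S(K,I)_{\bf a}\ne0)$. A monomial ideal $I$ has homological linear powers if $\mathrm{HS}_i(I^k)$ has a linear resolution for all $i\ge0$ and all $k\ge1$. The zero ideal is regarded as having a linear resolution. *)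

theory Defs
  imports
    "HOL-Library.Poly_Mapping"
    "HOL-Algebra.Ideal_Product"
    "Jordan_Normal_Form.Matrix"
begin

section \<open>The polynomial ring in n variables\<close>

text \<open>
  An exponent vector is a finitely supported function from variable indices to exponents. The
  type of polynomials has a variable for every natural number; the ring
  \<open>K[x\<^sub>1, \<dots>, x\<^sub>n]\<close> is the subring of polynomials in which only the variables with index
  in \<open>{1..n}\<close> occur. The field \<open>K\<close> is a type of class \<open>field\<close>.
\<close>

type_synonym expo = "nat \<Rightarrow>\<^sub>0 nat"
type_synonym 'k mpoly = "expo \<Rightarrow>\<^sub>0 'k"

definition expos :: "nat \<Rightarrow> expo set" where
  "expos n = {a. Poly_Mapping.keys a \<subseteq> {1..n}}"

definition poly_ring :: "nat \<Rightarrow> 'k::field mpoly ring" where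
  "poly_ring n =
    \<lparr> carrier = {p. Poly_Mapping.keys p \<subseteq> expos n}, monoid.mult = (*), one = 1, zero = 0, add = (+) \<rparr>"

definition xpow :: "expo \<Rightarrow> 'k::field mpoly" where
  "xpow a = Poly_Mapping.single a 1"

definition var :: "nat \<Rightarrow> 'k::field mpoly" where
  "var i = xpow (Poly_Mapping.single i 1)"

definition total_degree :: "expo \<Rightarrow> nat" where
  "total_degree a = (\<Sum>i\<in>Poly_Mapping.keys a. Poly_Mapping.lookup a i)"

definition monomial_ideal :: "nat \<Rightarrow> 'k::field mpoly set \<Rightarrow> bool" where
  "monomial_ideal n I \<longleftrightarrow>
    (\<exists>A \<subseteq> expos n. I = genideal (poly_ring n) (xpow ` A))"

definition ideal_power :: "nat \<Rightarrow> 'k::field mpoly set \<Rightarrow> nat \<Rightarrow> 'k mpoly set" where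
  "ideal_power n I k = I [^]\<^bsub>ideals_set (poly_ring n)\<^esub> k"

lemma poly_ring_simps [simp]:
  "p \<in> carrier (poly_ring n) \<longleftrightarrow> Poly_Mapping.keys p \<subseteq> expos n"
  "monoid.mult (poly_ring n) = (*)" "\<one>\<^bsub>poly_ring n\<^esub> = 1"
  "\<zero>\<^bsub>poly_ring n\<^esub> = 0" "ring.add (poly_ring n) = (+)"
  by (simp_all add: poly_ring_def)

lemma zero_in_expos [simp]: "0 \<in> expos n"
  by (simp add: expos_def)

lemma plus_in_expos: "a \<in> expos n \<Longrightarrow> b \<in> expos n \<Longrightarrow> a + b \<in> expos n"
  using Poly_Mapping.keys_add[of a b] by (auto simp: expos_def)

lemma poly_ring_cring: "cring (poly_ring n :: 'k::field mpoly ring)"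
proof (rule cringI)
  show "abelian_group (poly_ring n :: 'k mpoly ring)"
  proof (rule abelian_groupI)
    fix p :: "'k mpoly" assume "p \<in> carrier (poly_ring n)"
    then show "\<exists>q\<in>carrier (poly_ring n). q \<oplus>\<^bsub>poly_ring n\<^esub> p = \<zero>\<^bsub>poly_ring n\<^esub>"
      by (intro bexI[of _ "- p"]) auto
  qed (use Poly_Mapping.keys_add in \<open>fastforce simp: algebra_simps\<close>)+
next
  show "Group.comm_monoid (poly_ring n :: 'k mpoly ring)"
  proof (rule comm_monoidI)
    fix p q :: "'k mpoly" assume "p \<in> carrier (poly_ring n)" "q \<in> carrier (poly_ring n)"
    then show "p \<otimes>\<^bsub>poly_ring n\<^esub> q \<in> carrier (poly_ring n)"
      using Poly_Mapping.keys_mult[of p q] by (fastforce intro: plus_in_expos)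
  qed (auto simp: algebra_simps)
qed (auto simp: algebra_simps)


section \<open>Graded free resolutions, Tor and homological shift ideals\<close>

text \<open>
  A sequence of finitely generated graded free modules
  \<open>F\<^sub>i = \<Oplus>\<^sub>j S(-shift i j)\<close>, where \<open>j < rk i\<close>, together with the matrices
  \<open>dmap i\<close> of maps \<open>F\<^sub>(\<^sub>i\<^sub>+\<^sub>1\<^sub>) \<rightarrow> F\<^sub>i\<close> and the row \<open>aug\<close> of a map
  \<open>F\<^sub>0 \<rightarrow> S\<close>. The degrees lie in \<open>'g\<close>. The length of the sequence is not
  bounded, but \<open>rk i\<close> may be \<open>0\<close>.
\<close>

record ('g, 'p) free_complex =
  rk :: "nat \<Rightarrow> nat"
  shift :: "nat \<Rightarrow> nat \<Rightarrow> 'g"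
  aug :: "'p vec"
  dmap :: "nat \<Rightarrow> 'p mat"

definition free_mod :: "nat \<Rightarrow> nat \<Rightarrow> 'k::field mpoly vec set" where
  "free_mod n r = {v \<in> carrier_vec r. set\<^sub>v v \<subseteq> carrier (poly_ring n)}"

text \<open>
  The grading of \<open>S\<close> is given by an additive map \<open>deg\<close> on exponent vectors: the
  identity for the multigrading, \<open>total_degree\<close> for the standard grading. The maps are
  homogeneous of degree zero, so the entry of \<open>dmap i\<close> in position \<open>(j, k)\<close> is a
  homogeneous polynomial of degree \<open>shift (i + 1) k - shift i j\<close>.
\<close>

definition graded_free_resolution ::
  "nat \<Rightarrow> (expo \<Rightarrow> 'g::comm_monoid_add) \<Rightarrow> ('g, 'k::field mpoly) free_complex \<Rightarrow> 'k mpoly set \<Rightarrow> bool"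
where
  "graded_free_resolution n deg F I \<longleftrightarrow>
    aug F \<in> free_mod n (rk F 0) \<and>
    (\<forall>k<rk F 0. \<forall>m\<in>Poly_Mapping.keys (aug F $ k). deg m = shift F 0 k) \<and>
    (\<forall>i. dmap F i \<in> carrier_mat (rk F i) (rk F (Suc i)) \<and>
         elements_mat (dmap F i) \<subseteq> carrier (poly_ring n)) \<and>
    (\<forall>i. \<forall>j<rk F i. \<forall>k<rk F (Suc i). \<forall>m\<in>Poly_Mapping.keys (dmap F i $$ (j, k)).
         deg m + shift F i j = shift F (Suc i) k) \<and>
    I = {aug F \<bullet> v | v. v \<in> free_mod n (rk F 0)} \<and>
    {v \<in> free_mod n (rk F 0). aug F \<bullet> v = 0} =
      {dmap F 0 *\<^sub>v w | w. w \<in> free_mod n (rk F 1)} \<and>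
    (\<forall>i. {v \<in> free_mod n (rk F (Suc i)). dmap F i *\<^sub>v v = 0\<^sub>v (rk F i)} =
         {dmap F (Suc i) *\<^sub>v w | w. w \<in> free_mod n (rk F (Suc (Suc i)))})"

text \<open>
  The complex \<open>K \<otimes>\<^sub>S F\<close>, where \<open>K = S/(x\<^sub>1, \<dots>, x\<^sub>n)\<close>. Its component of degree
  \<open>a\<close> in position \<open>i\<close> is the \<open>K\<close>-vector space on the basis elements of \<open>F\<^sub>i\<close>
  of degree \<open>a\<close>, and its differentials are given by the constant terms of the matrix
  entries. The augmentation is not part of the complex, so in position \<open>0\<close> every element
  is a cycle.
\<close>

definition tensorK_part :: "('g, 'k::field mpoly) free_complex \<Rightarrow> nat \<Rightarrow> 'g \<Rightarrow> 'k vec set" where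
  "tensorK_part F i a =
    {v \<in> carrier_vec (rk F i). \<forall>j<rk F i. v $ j \<noteq> 0 \<longrightarrow> shift F i j = a}"

definition tensorK_dmap :: "('g, 'k::field mpoly) free_complex \<Rightarrow> nat \<Rightarrow> 'k mat" where
  "tensorK_dmap F i = map_mat (\<lambda>p. Poly_Mapping.lookup p 0) (dmap F i)"

definition tensorK_cycles :: "('g, 'k::field mpoly) free_complex \<Rightarrow> nat \<Rightarrow> 'g \<Rightarrow> 'k vec set" where
  "tensorK_cycles F i a =
    {v \<in> tensorK_part F i a.
      case i of 0 \<Rightarrow> True | Suc j \<Rightarrow> tensorK_dmap F j *\<^sub>v v = 0\<^sub>v (rk F j)}"

definition tensorK_boundaries :: "('g, 'k::field mpoly) free_complex \<Rightarrow> nat \<Rightarrow> 'g \<Rightarrow> 'k vec set" where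
  "tensorK_boundaries F i a =
    {tensorK_dmap F i *\<^sub>v w | w. w \<in> tensorK_part F (Suc i) a}"

text \<open>
  \<open>Tor\<^sub>i(K, I)\<^sub>a \<noteq> 0\<close>, for the multigraded Tor of a monomial ideal \<open>I\<close>: the
  homology of \<open>K \<otimes>\<^sub>S F\<close> in position \<open>i\<close> and degree \<open>a\<close> is nonzero, where
  \<open>F\<close> is a multigraded free resolution of \<open>I\<close>. Such an \<open>F\<close> exists for every monomial
  ideal, and the homology does not depend on its choice.
\<close>

definition Tor_nonzero :: "nat \<Rightarrow> nat \<Rightarrow> 'k::field mpoly set \<Rightarrow> expo \<Rightarrow> bool" where
  "Tor_nonzero n i I a \<longleftrightarrow>
    (\<exists>F. graded_free_resolution n (\<lambda>m. m) F I \<and>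
         tensorK_cycles F i a \<noteq> tensorK_boundaries F i a)"

definition HS :: "nat \<Rightarrow> nat \<Rightarrow> 'k::field mpoly set \<Rightarrow> 'k mpoly set" where
  "HS n i I = genideal (poly_ring n) (xpow ` {a \<in> expos n. Tor_nonzero n i I a})"

text \<open>
  Linear resolution: for some \<open>d\<close> there is a resolution in the standard grading with
  \<open>F\<^sub>i = S(-d-i)\<^bsup>b\<^esup>\<close>, \<open>b = rk i\<close>. All entries of the differentials are then linear
  forms, so the resolution is minimal.
\<close>

definition has_linear_resolution :: "nat \<Rightarrow> 'k::field mpoly set \<Rightarrow> bool" where
  "has_linear_resolution n I \<longleftrightarrow>
    (\<exists>d F. graded_free_resolution n total_degree F I \<and>
           (\<forall>i. \<forall>j<rk F i. shift F i j = d + i))"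

text \<open>The convention for the zero ideal is a consequence of the definition.\<close>

lemma zero_has_linear_resolution: "has_linear_resolution n ({0} :: 'k::field mpoly set)"
proof -
  define F :: "(nat, 'k mpoly) free_complex" where
    "F = \<lparr> rk = (\<lambda>_. 0), shift = (\<lambda>_ _. 0), aug = 0\<^sub>v 0, dmap = (\<lambda>_. 0\<^sub>m 0 0) \<rparr>"
  have fm: "free_mod n 0 = {0\<^sub>v 0 :: 'k mpoly vec}"
    by (auto simp: free_mod_def vec_set_def)
  have z: "0\<^sub>m 0 0 *\<^sub>v vNil = (vNil :: 'k mpoly vec)"
    by (rule eq_vecI) auto
  have "graded_free_resolution n total_degree F {0}"
    unfolding graded_free_resolution_def
    by (simp add: F_def fm z elements_mat_def Collect_conv_if)
  then show ?thesis
    unfolding has_linear_resolution_def by (intro exI[of _ 0] exI[of _ F]) (simp add: F_def)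
qed

definition homological_linear_powers :: "nat \<Rightarrow> 'k::field mpoly set \<Rightarrow> bool" where
  "homological_linear_powers n I \<longleftrightarrow>
    monomial_ideal n I \<and>
    (\<forall>i. \<forall>k\<ge>1. has_linear_resolution n (HS n i (ideal_power n I k)))"


section \<open>Edge ideals of complete multipartite graphs\<close>

text \<open>A finite simple graph on the vertex set \<open>{1..n}\<close> is given by its set of edges.\<close>

definition simple_graph :: "nat \<Rightarrow> nat set set \<Rightarrow> bool" where
  "simple_graph n E \<longleftrightarrow> (\<forall>e\<in>E. e \<subseteq> {1..n} \<and> card e = 2)"

definition edge_ideal :: "nat \<Rightarrow> nat set set \<Rightarrow> 'k::field mpoly set" where
  "edge_ideal n E = genideal (poly_ring n) {var i * var j | i j. {i, j} \<in> E}"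

text \<open>
  The parts are the nonempty intervals \<open>V\<^sub>k = {t (k - 1) + 1..t k}\<close> for
  \<open>k = 1, \<dots>, r\<close>.
\<close>

definition complete_multipartite :: "nat \<Rightarrow> nat set set \<Rightarrow> bool" where
  "complete_multipartite n E \<longleftrightarrow>
    (\<exists>(r::nat) t. t 0 = 0 \<and> t r = n \<and> (\<forall>k\<in>{1..r}. t (k - 1) < t k) \<and>
      E = {{i, j} | i j k l. k \<in> {1..r} \<and> l \<in> {1..r} \<and> k \<noteq> l \<and>
             i \<in> {t (k - 1) + 1..t k} \<and> j \<in> {t (l - 1) + 1..t l}})"

end

theory Submission
  imports Defs "HOL-Library.Function_Algebras"
begin

text \<open>
  Let \<open>I\<close> be the edge ideal. An exponent belongs to a minimal generator of \<open>I\<^sup>k\<close> if and only if its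
  total degree is \<open>2k\<close> and its weight on every part is at most \<open>k\<close>: given such an exponent, one splits off
  an edge between the two heaviest parts (\<open>gens_split_edge\<close>). This set of exponents has the exchange
  property of discrete polymatroids, so in lexicographic order it has linear quotients, and iterated
  mapping cones (\<open>cone_resolution\<close>, \<open>linear_quotients_resolution\<close>) produce a multigraded free
  resolution whose generators in position \<open>i\<close> have the degrees \<open>u + e\<^sub>T\<close>. Here \<open>u\<close> is a generator,
  \<open>e\<^sub>T\<close> is the sum of the unit exponents of the variables in \<open>T\<close>, and
  \<open>T\<close> is a set of \<open>i\<close> variables by which \<open>u\<close> can be moved to a lexicographically larger generator.

  All these degrees have total degree \<open>2k + i\<close>. Hence the resolution is minimal and they are the
  degrees in which \<open>Tor\<^sub>i\<close> does not vanish, independently of the resolution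
  (\<open>exact_degree_part_acyclic\<close>, \<open>Tor_nonzero_iff\<close>). The heart of the proof is a description of this set
  without reference to \<open>u\<close> and \<open>T\<close> (\<open>shifts_decompose\<close>, \<open>multidegree_in_shifts\<close>): a degree \<open>c\<close> occurs if and
  only if its total degree is \<open>2k + i\<close>, it involves more than \<open>i\<close> variables, and every part has weight
  at most \<open>k + i\<close> and weight less than \<open>k\<close> after one unit is removed from each variable of \<open>c\<close> in it.
  From this description the exchange property of the multidegrees is verified by looking at which bounds are
  tight (\<open>exchange_property_shifts\<close>). So \<open>HS\<^sub>i(I\<^sup>k)\<close> is again generated in one degree
  by a set with the exchange property, and the same construction gives its linear resolution.

  Resolutions are handled one multidegree at a time. A homogeneous matrix over the polynomial ring is a
  matrix of scalars together with the degrees of its rows and columns, and a complex is exact if and only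
  if for each degree \<open>b\<close> the scalar matrices, restricted to the generators that divide
  \<open>b\<close>, form an exact complex of vector spaces. Lifting, homotopies and mapping cones are
  carried out in this setting, and the translation from and to matrices of polynomials is made
  once (\<open>graded_resolution_strands\<close>, \<open>strands_graded_resolution\<close>).
\<close>

abbreviation lookup where "lookup \<equiv> Poly_Mapping.lookup"
abbreviation single where "single \<equiv> Poly_Mapping.single"
abbreviation keys where "keys \<equiv> Poly_Mapping.keys"

section \<open>Linear maps between based vector spaces\<close>

text \<open>
  A vector is a function on basis elements and a linear map is given by the images of the basis
  elements, so index types stay arbitrary: disjoint sums of bases and chosen families of images
  need no enumeration. Coefficients outside the basis \<open>B\<close> are ignored.
\<close>

definition lin :: "'x set \<Rightarrow> ('x \<Rightarrow> 'y \<Rightarrow> 'k::field) \<Rightarrow> ('x \<Rightarrow> 'k) \<Rightarrow> 'y \<Rightarrow> 'k" where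
  "lin B m v = (\<lambda>y. \<Sum>x\<in>B. v x * m x y)"

definition delta :: "'x \<Rightarrow> 'x \<Rightarrow> 'k::field" where
  "delta x = (\<lambda>y. if y = x then 1 else 0)"

lemma lin_add: "lin B m (v + w) = lin B m v + lin B m w"
  by (rule ext) (simp add: lin_def algebra_simps sum.distrib)

lemma lin_diff: "lin B m (v - w) = lin B m v - lin B m w"
  by (rule ext) (simp add: lin_def algebra_simps sum_subtractf)

lemma lin_uminus: "lin B m (- v) = - lin B m v"
  by (rule ext) (simp add: lin_def sum_negf)

lemma lin_zero [simp]: "lin B m 0 = 0"
  by (rule ext) (simp add: lin_def)

lemma lin_map_zero [simp]: "lin B 0 v = 0"
  by (rule ext) (simp add: lin_def)

lemma lin_map_add: "lin B (\<lambda>x. m x + m' x) v = lin B m v + lin B m' v"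
  by (rule ext) (simp add: lin_def algebra_simps sum.distrib)

lemma lin_map_diff: "lin B (\<lambda>x. m x - m' x) v = lin B m v - lin B m' v"
  by (rule ext) (simp add: lin_def algebra_simps sum_subtractf)

lemma lin_lin: "lin B2 m2 (lin B1 m1 v) = lin B1 (\<lambda>x. lin B2 m2 (m1 x)) v"
  unfolding lin_def
  by (rule ext) (simp add: sum_distrib_left sum_distrib_right mult.assoc, subst sum.swap, rule refl)

lemma lin_delta: "finite B \<Longrightarrow> x \<in> B \<Longrightarrow> lin B m (delta x) = m x"
  by (rule ext) (simp add: lin_def delta_def if_distribR if_distrib[of "\<lambda>a. a * _"] cong: if_cong)

lemma lin_cong: "(\<And>x. x \<in> B \<Longrightarrow> v x \<noteq> 0 \<Longrightarrow> m x = m' x) \<Longrightarrow> lin B m v = lin B m' v"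
  unfolding lin_def by (intro ext sum.cong refl) (metis mult_eq_0_iff)

lemma lin_delta_right: "finite B \<Longrightarrow> (\<And>x. v x \<noteq> 0 \<Longrightarrow> x \<in> B) \<Longrightarrow> lin B delta v = v"
  by (rule ext) (auto simp add: lin_def delta_def if_distrib[of "\<lambda>a. _ * a"] cong: if_cong)

lemma lin_nonzero:
  assumes "lin B m v y \<noteq> 0"
  obtains x where "x \<in> B" "v x \<noteq> 0" "m x y \<noteq> 0"
  using assms unfolding lin_def by (metis (no_types, lifting) mult_eq_0_iff sum.neutral)

section \<open>Multigraded complexes of free modules as families of based vector spaces\<close>

text \<open>
  The degrees in which a free module generated in degree \<open>a\<close> is nonzero. Only the
  variables with index in \<open>{1..n}\<close> act, although a shift may be an arbitrary
  exponent.
\<close>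

definition multiples :: "nat \<Rightarrow> expo \<Rightarrow> expo set" where
  "multiples n a = {a + m | m. m \<in> expos n}"

lemma multiples_self [simp]: "a \<in> multiples n a"
  unfolding multiples_def by (intro CollectI exI[of _ 0]) simp

lemma multiples_trans: "b \<in> multiples n a \<Longrightarrow> multiples n b \<subseteq> multiples n a"
  unfolding multiples_def using plus_in_expos add.assoc by blast

lemma multiples_lookup: "b \<in> multiples n a \<Longrightarrow> lookup a t \<le> lookup b t"
  by (auto simp: multiples_def lookup_add)

text \<open>
  Antisymmetry turns two opposite inclusions between free modules into equality of degrees. This
  is how a composite of two maps is confined to the generators of one degree.
\<close>

lemma multiples_antisym:
  assumes "b \<in> multiples n a" "a \<in> multiples n b"
  shows "a = b"
  using multiples_lookup[OF assms(1)] multiples_lookup[OF assms(2)]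
  by (intro poly_mapping_eqI) (simp add: le_antisym)

lemma multiples_subset_iff: "multiples n b \<subseteq> multiples n a \<longleftrightarrow> b \<in> multiples n a"
  using multiples_self multiples_trans by blast

text \<open>
  A multigraded complex of free modules with homogeneous maps is determined by scalars: the
  entry in position \<open>(y, x)\<close> is \<open>c i x y\<close> times the monomial that the
  degrees dictate. Its component of degree \<open>b\<close> is spanned by the generators whose
  set \<open>act i x\<close> of degrees contains \<open>b\<close>, and the same scalars give the
  differential there. Position \<open>0\<close> holds the resolved ideal itself, whose nonzero
  degrees form a set closed under multiples but in general not a set of the form
  \<open>multiples n a\<close>; the free modules occupy the positions \<open>Suc i\<close>, with
  generators in degrees \<open>s i x\<close>. Thus the augmentation is the differential
  \<open>c 0\<close>.
\<close>

locale strand_complex =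
  fixes n :: nat
    and B :: "nat \<Rightarrow> 'x set"
    and act :: "nat \<Rightarrow> 'x \<Rightarrow> expo set"
    and s :: "nat \<Rightarrow> 'x \<Rightarrow> expo"
    and c :: "nat \<Rightarrow> 'x \<Rightarrow> 'x \<Rightarrow> 'k::field"
  assumes fin: "finite (B i)"
    and act_Suc: "x \<in> B (Suc i) \<Longrightarrow> act (Suc i) x = multiples n (s i x)"
    and act_0: "x \<in> B 0 \<Longrightarrow> b \<in> act 0 x \<Longrightarrow> multiples n b \<subseteq> act 0 x"
    and c_supp: "x \<in> B (Suc i) \<Longrightarrow> c i x y \<noteq> 0 \<Longrightarrow> y \<in> B i \<and> act (Suc i) x \<subseteq> act i y"
    and dd: "x \<in> B (Suc (Suc i)) \<Longrightarrow> lin (B (Suc i)) (c i) (c (Suc i) x) = 0"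
begin

definition chain :: "expo \<Rightarrow> nat \<Rightarrow> ('x \<Rightarrow> 'k) set" where
  "chain b i = {v. \<forall>x. v x \<noteq> 0 \<longrightarrow> x \<in> B i \<and> b \<in> act i x}"

definition cycle :: "nat \<Rightarrow> ('x \<Rightarrow> 'k) \<Rightarrow> bool" where
  "cycle i v \<longleftrightarrow> (case i of 0 \<Rightarrow> True | Suc j \<Rightarrow> lin (B i) (c j) v = 0)"

lemma cycle_simps [simp]: "cycle 0 v" "cycle (Suc j) v \<longleftrightarrow> lin (B (Suc j)) (c j) v = 0"
  by (simp_all add: cycle_def)

lemma chain_add: "v \<in> chain b i \<Longrightarrow> w \<in> chain b i \<Longrightarrow> v + w \<in> chain b i"
  unfolding chain_def by force

lemma chain_diff: "v \<in> chain b i \<Longrightarrow> w \<in> chain b i \<Longrightarrow> v - w \<in> chain b i"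
  unfolding chain_def by force

lemma chain_zero [simp]: "0 \<in> chain b i"
  unfolding chain_def by simp

lemma act_up: "x \<in> B i \<Longrightarrow> b \<in> act i x \<Longrightarrow> multiples n b \<subseteq> act i x"
  by (cases i) (auto simp: act_0 act_Suc dest: multiples_trans)

lemma s_in_act: "x \<in> B (Suc i) \<Longrightarrow> s i x \<in> act (Suc i) x"
  by (simp add: act_Suc)

lemma c_chain: "x \<in> B (Suc i) \<Longrightarrow> c i x \<in> chain (s i x) i"
  unfolding chain_def using c_supp s_in_act by blast

lemma d_chain: "v \<in> chain b (Suc i) \<Longrightarrow> lin (B (Suc i)) (c i) v \<in> chain b i"
  unfolding chain_def by (clarify, erule lin_nonzero) (use c_supp in blast)

lemma d_d:
  assumes "v \<in> chain b (Suc (Suc i))"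
  shows "lin (B (Suc i)) (c i) (lin (B (Suc (Suc i))) (c (Suc i)) v) = 0"
proof -
  have "lin (B (Suc (Suc i))) (\<lambda>x. lin (B (Suc i)) (c i) (c (Suc i) x)) v = lin (B (Suc (Suc i))) 0 v"
    by (rule lin_cong) (simp add: dd)
  then show ?thesis by (simp add: lin_lin)
qed

end

text \<open>
  The inclusion of degree sets means that \<open>m\<close> maps the part of each degree into the
  part of the same degree.
\<close>

definition degree_preserving ::
  "'x set \<Rightarrow> ('x \<Rightarrow> expo set) \<Rightarrow> 'y set \<Rightarrow> ('y \<Rightarrow> expo set) \<Rightarrow> ('x \<Rightarrow> 'y \<Rightarrow> 'k::field) \<Rightarrow> bool" where
  "degree_preserving B act B' act' m \<longleftrightarrow>
    (\<forall>x\<in>B. \<forall>y. m x y \<noteq> 0 \<longrightarrow> y \<in> B' \<and> act x \<subseteq> act' y)"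

text \<open>
  Exactness in every degree; in position \<open>0\<close>, where every element is a cycle, it
  says that the augmentation is surjective.
\<close>

locale exact_strand_complex = strand_complex +
  assumes exact: "v \<in> chain b i \<Longrightarrow> cycle i v \<Longrightarrow> \<exists>w\<in>chain b (Suc i). lin (B (Suc i)) (c i) w = v"

section \<open>Lifting maps from free complexes to exact ones\<close>

lemma lin_chain:
  fixes c :: "nat \<Rightarrow> 'x \<Rightarrow> 'x \<Rightarrow> 'k::field" and c' :: "nat \<Rightarrow> 'y \<Rightarrow> 'y \<Rightarrow> 'k"
    and m :: "'x \<Rightarrow> 'y \<Rightarrow> 'k"
  assumes "strand_complex n B act s c" "strand_complex n B' act' s' c'"
    and "degree_preserving (B i) (act i) (B' j) (act' j) m"
    and "v \<in> strand_complex.chain B act b i"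
  shows "lin (B i) m v \<in> strand_complex.chain B' act' b j"
proof -
  interpret X: strand_complex n B act s c by fact
  interpret Y: strand_complex n B' act' s' c' by fact
  show ?thesis
  unfolding Y.chain_def
  proof (intro CollectI allI impI)
    fix y assume "lin (B i) m v y \<noteq> 0"
    then obtain x where "x \<in> B i" "v x \<noteq> 0" "m x y \<noteq> 0" by (rule lin_nonzero)
    then show "y \<in> B' j \<and> b \<in> act' j y"
      using assms(3,4) unfolding degree_preserving_def X.chain_def by blast
  qed
qed

text \<open>
  A generator of a free module may be sent to any element of its degree, so a homogeneous map is
  found by choosing one preimage for each generator.
\<close>

lemma lift_cycles:
  fixes c :: "nat \<Rightarrow> 'x \<Rightarrow> 'x \<Rightarrow> 'k::field" and c' :: "nat \<Rightarrow> 'y \<Rightarrow> 'y \<Rightarrow> 'k"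
  assumes "strand_complex n B act s c" and "exact_strand_complex n B' act' s' c'"
    and z: "\<And>x. x \<in> B (Suc i) \<Longrightarrow> z x \<in> strand_complex.chain B' act' (s i x) j"
      "\<And>x. x \<in> B (Suc i) \<Longrightarrow> strand_complex.cycle B' c' j (z x)"
  shows "\<exists>m. degree_preserving (B (Suc i)) (act (Suc i)) (B' (Suc j)) (act' (Suc j)) m \<and>
    (\<forall>x\<in>B (Suc i). lin (B' (Suc j)) (c' j) (m x) = z x)"
proof -
  interpret X: strand_complex n B act s c by fact
  interpret Y: exact_strand_complex n B' act' s' c' by fact
  have "\<exists>w. w \<in> Y.chain (s i x) (Suc j) \<and> lin (B' (Suc j)) (c' j) w = z x" if "x \<in> B (Suc i)" for x
    using Y.exact[OF z(1)[OF that] z(2)[OF that]] by blast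
  then obtain m where m: "\<And>x. x \<in> B (Suc i) \<Longrightarrow> m x \<in> Y.chain (s i x) (Suc j)"
    "\<And>x. x \<in> B (Suc i) \<Longrightarrow> lin (B' (Suc j)) (c' j) (m x) = z x"
    by metis
  have "degree_preserving (B (Suc i)) (act (Suc i)) (B' (Suc j)) (act' (Suc j)) m"
    unfolding degree_preserving_def
  proof (intro ballI allI impI)
    fix x y assume x: "x \<in> B (Suc i)" and "m x y \<noteq> 0"
    then have "y \<in> B' (Suc j)" "s i x \<in> act' (Suc j) y"
      using m(1)[OF x] unfolding Y.chain_def by blast+
    then show "y \<in> B' (Suc j) \<and> act (Suc i) x \<subseteq> act' (Suc j) y"
      using Y.act_up X.act_Suc[OF x] by auto
  qed
  with m(2) show ?thesis by blast
qed

text \<open>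
  The comparison theorem. The map in position \<open>Suc i\<close> is chosen after the one in
  position \<open>i\<close>; the condition that makes the next choice possible, that images of
  boundaries are cycles, is carried along in the recursion.
\<close>

lemma chain_map_exists:
  fixes c :: "nat \<Rightarrow> 'x \<Rightarrow> 'x \<Rightarrow> 'k::field" and c' :: "nat \<Rightarrow> 'y \<Rightarrow> 'y \<Rightarrow> 'k"
  assumes "strand_complex n B act s c" and "exact_strand_complex n B' act' s' c'"
    and f: "degree_preserving (B 0) (act 0) (B' 0) (act' 0) f"
  obtains \<phi> where "\<phi> 0 = f"
    "\<And>i. degree_preserving (B i) (act i) (B' i) (act' i) (\<phi> i)"
    "\<And>i x. x \<in> B (Suc i) \<Longrightarrow> lin (B' (Suc i)) (c' i) (\<phi> (Suc i) x) = lin (B i) (\<phi> i) (c i x)"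
proof -
  interpret X: strand_complex n B act s c by fact
  interpret Y: exact_strand_complex n B' act' s' c' by fact
  define P where "P i m \<longleftrightarrow> degree_preserving (B i) (act i) (B' i) (act' i) m \<and> (i = 0 \<longrightarrow> m = f) \<and>
    (\<forall>x\<in>B (Suc i). Y.cycle i (lin (B i) m (c i x)))" for i and m :: "'x \<Rightarrow> 'y \<Rightarrow> 'k"
  define Q where "Q i m m' \<longleftrightarrow> (\<forall>x\<in>B (Suc i). lin (B' (Suc i)) (c' i) (m' x) = lin (B i) m (c i x))"
    for i and m m' :: "'x \<Rightarrow> 'y \<Rightarrow> 'k"
  have "\<exists>\<phi>. \<forall>i. P i (\<phi> i) \<and> Q i (\<phi> i) (\<phi> (Suc i))"
  proof (rule dependent_nat_choice)
    show "\<exists>m. P 0 m" unfolding P_def using f by auto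
  next
    fix m i assume P: "P i m"
    have "\<exists>m'. degree_preserving (B (Suc i)) (act (Suc i)) (B' (Suc i)) (act' (Suc i)) m' \<and>
      (\<forall>x\<in>B (Suc i). lin (B' (Suc i)) (c' i) (m' x) = lin (B i) m (c i x))"
      using P X.c_chain unfolding P_def
      by (intro lift_cycles[OF assms(1,2)] lin_chain[OF X.strand_complex_axioms Y.strand_complex_axioms]) auto
    then obtain m' where m': "degree_preserving (B (Suc i)) (act (Suc i)) (B' (Suc i)) (act' (Suc i)) m'"
      "\<And>x. x \<in> B (Suc i) \<Longrightarrow> lin (B' (Suc i)) (c' i) (m' x) = lin (B i) m (c i x)" by blast
    have "lin (B' (Suc i)) (c' i) (lin (B (Suc i)) m' (c (Suc i) x)) = 0" if x: "x \<in> B (Suc (Suc i))" for x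
    proof -
      have "lin (B' (Suc i)) (c' i) (lin (B (Suc i)) m' (c (Suc i) x)) =
          lin (B (Suc i)) (\<lambda>x. lin (B i) m (c i x)) (c (Suc i) x)"
        unfolding lin_lin by (rule lin_cong) (simp add: m'(2))
      also have "\<dots> = lin (B i) m (lin (B (Suc i)) (c i) (c (Suc i) x))" by (simp add: lin_lin)
      finally show ?thesis by (simp add: X.dd[OF x])
    qed
    then show "\<exists>m'. P (Suc i) m' \<and> Q i m m'"
      unfolding P_def Q_def using m' by auto
  qed
  then obtain \<phi> where \<phi>: "\<And>i. P i (\<phi> i)" "\<And>i. Q i (\<phi> i) (\<phi> (Suc i))" by blast
  show ?thesis
    by (rule that[of \<phi>]) (use \<phi> in \<open>auto simp: P_def Q_def\<close>)
qed

text \<open>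
  Uniqueness up to homotopy in the comparison theorem, stated for a chain map that vanishes on
  the resolved ideal. The homotopy vanishes in position \<open>0\<close> because the map does.
\<close>

lemma null_homotopy_exists:
  fixes c :: "nat \<Rightarrow> 'x \<Rightarrow> 'x \<Rightarrow> 'k::field" and c' :: "nat \<Rightarrow> 'y \<Rightarrow> 'y \<Rightarrow> 'k"
  assumes "strand_complex n B act s c" and "exact_strand_complex n B' act' s' c'"
    and \<theta>: "\<And>i. degree_preserving (B i) (act i) (B' i) (act' i) (\<theta> i)"
    "\<And>i x. x \<in> B (Suc i) \<Longrightarrow> lin (B' (Suc i)) (c' i) (\<theta> (Suc i) x) = lin (B i) (\<theta> i) (c i x)"
    and \<theta>0: "\<And>x. x \<in> B 0 \<Longrightarrow> \<theta> 0 x = 0"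
  obtains h where "h 0 = 0"
    "\<And>i. degree_preserving (B i) (act i) (B' (Suc i)) (act' (Suc i)) (h i)"
    "\<And>i x. x \<in> B (Suc i) \<Longrightarrow>
      \<theta> (Suc i) x = lin (B' (Suc (Suc i))) (c' (Suc i)) (h (Suc i) x) + lin (B i) (h i) (c i x)"
proof -
  interpret X: strand_complex n B act s c by fact
  interpret Y: exact_strand_complex n B' act' s' c' by fact
  define P where "P i m \<longleftrightarrow> degree_preserving (B i) (act i) (B' (Suc i)) (act' (Suc i)) m \<and> (i = 0 \<longrightarrow> m = 0) \<and>
    (\<forall>x\<in>B (Suc i). Y.cycle (Suc i) (\<theta> (Suc i) x - lin (B i) m (c i x)))" for i and m :: "'x \<Rightarrow> 'y \<Rightarrow> 'k"
  define Q where "Q i m m' \<longleftrightarrow>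
    (\<forall>x\<in>B (Suc i). lin (B' (Suc (Suc i))) (c' (Suc i)) (m' x) = \<theta> (Suc i) x - lin (B i) m (c i x))"
    for i and m m' :: "'x \<Rightarrow> 'y \<Rightarrow> 'k"
  have "\<exists>h. \<forall>i. P i (h i) \<and> Q i (h i) (h (Suc i))"
  proof (rule dependent_nat_choice)
    have "lin (B 0) (\<theta> 0) v = lin (B 0) 0 v" for v by (rule lin_cong) (simp add: \<theta>0)
    then show "\<exists>m. P 0 m" unfolding P_def by (intro exI[of _ 0]) (auto simp: \<theta> degree_preserving_def)
  next
    fix m i assume P: "P i m"
    have ch: "\<theta> (Suc i) x - lin (B i) m (c i x) \<in> Y.chain (s i x) (Suc i)" if x: "x \<in> B (Suc i)" for x
    proof (rule Y.chain_diff)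
      have "lin (B (Suc i)) (\<theta> (Suc i)) (delta x) \<in> Y.chain (s i x) (Suc i)"
        by (rule lin_chain[OF X.strand_complex_axioms Y.strand_complex_axioms \<theta>(1)])
          (use x in \<open>auto simp: X.chain_def delta_def X.s_in_act split: if_splits\<close>)
      then show "\<theta> (Suc i) x \<in> Y.chain (s i x) (Suc i)" by (simp add: lin_delta X.fin x)
      show "lin (B i) m (c i x) \<in> Y.chain (s i x) (Suc i)"
        using P X.c_chain[OF x] unfolding P_def
        by (intro lin_chain[OF X.strand_complex_axioms Y.strand_complex_axioms]) auto
    qed
    have "\<exists>m'. degree_preserving (B (Suc i)) (act (Suc i)) (B' (Suc (Suc i))) (act' (Suc (Suc i))) m' \<and>
      (\<forall>x\<in>B (Suc i). lin (B' (Suc (Suc i))) (c' (Suc i)) (m' x) = \<theta> (Suc i) x - lin (B i) m (c i x))"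
      using P ch unfolding P_def by (intro lift_cycles[OF assms(1,2)]) auto
    then obtain m' where m': "degree_preserving (B (Suc i)) (act (Suc i)) (B' (Suc (Suc i))) (act' (Suc (Suc i))) m'"
      "\<And>x. x \<in> B (Suc i) \<Longrightarrow> lin (B' (Suc (Suc i))) (c' (Suc i)) (m' x) = \<theta> (Suc i) x - lin (B i) m (c i x)" by blast
    have "lin (B' (Suc (Suc i))) (c' (Suc i)) (\<theta> (Suc (Suc i)) x - lin (B (Suc i)) m' (c (Suc i) x)) = 0"
      if x: "x \<in> B (Suc (Suc i))" for x
    proof -
      have "lin (B' (Suc (Suc i))) (c' (Suc i)) (lin (B (Suc i)) m' (c (Suc i) x)) =
          lin (B (Suc i)) (\<lambda>x. \<theta> (Suc i) x - lin (B i) m (c i x)) (c (Suc i) x)"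
        unfolding lin_lin by (rule lin_cong) (simp add: m'(2))
      also have "\<dots> = lin (B (Suc i)) (\<theta> (Suc i)) (c (Suc i) x) -
          lin (B i) m (lin (B (Suc i)) (c i) (c (Suc i) x))"
        by (simp only: lin_map_diff lin_lin)
      finally show ?thesis by (simp add: X.dd[OF x] lin_diff \<theta>(2)[OF x])
    qed
    then show "\<exists>m'. P (Suc i) m' \<and> Q i m m'"
      unfolding P_def Q_def using m' by auto
  qed
  then obtain h where h: "\<And>i. P i (h i)" "\<And>i. Q i (h i) (h (Suc i))" by blast
  show ?thesis
    by (rule that[of h]) (use h in \<open>auto simp: P_def Q_def\<close>)
qed

section \<open>Mapping cones and linear quotients\<close>

lemma lin_Plus:
  assumes "finite A" "finite A'"
  shows "lin (A <+> A') m v = lin A (\<lambda>x. m (Inl x)) (v \<circ> Inl) + lin A' (\<lambda>y. m (Inr y)) (v \<circ> Inr)"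
  unfolding lin_def by (rule ext) (simp add: sum.Plus assms)

lemma lin_case_sum:
  "lin A (\<lambda>x. case_sum (f x) (g x)) v = case_sum (lin A f v) (lin A g v)"
  unfolding lin_def by (rule ext) (simp split: sum.split)

text \<open>
  A resolution of the ideal whose exponents are \<open>P\<close>, remembered through its maps
  and through the set \<open>D i\<close> of degrees of its generators in homological position
  \<open>i\<close>. Multiplicities are forgotten: only whether a degree occurs matters for
  homological shift ideals.
\<close>

definition resolution_of where
  "resolution_of n P D B act s c \<longleftrightarrow>
    exact_strand_complex n B act s c \<and> (\<exists>x0. B 0 = {x0} \<and> act 0 x0 = P) \<and> (\<forall>i. s i ` B (Suc i) = D i)"

lemma case_sum_eq: "case_sum f g = v \<longleftrightarrow> f = v \<circ> Inl \<and> g = v \<circ> Inr"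
  by (auto simp: fun_eq_iff split: sum.split)

text \<open>
  Let \<open>J\<close> be the ideal of \<open>P\<close>. The cone of a lift of the inclusion of
  \<open>J \<inter> (x\<^sup>u)\<close> into \<open>J\<close> resolves
  \<open>J + (x\<^sup>u)\<close>, provided that the ideal \<open>J \<inter> (x\<^sup>u)\<close>
  in position \<open>0\<close> of its resolution is replaced by the free module generated by
  \<open>x\<^sup>u\<close>, which contributes the new generator of degree \<open>u\<close>. A
  cycle of the cone is corrected by the boundary of an element of the second summand until it
  lies in the first. The replacement does no harm to this argument: a cycle with a nonzero
  component on the new generator has degree in \<open>J\<close>, because its other component
  maps onto the negative of that element.
\<close>

lemma cone_resolution:
  fixes c :: "nat \<Rightarrow> 'x \<Rightarrow> 'x \<Rightarrow> 'k::field" and c' :: "nat \<Rightarrow> 'y \<Rightarrow> 'y \<Rightarrow> 'k"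
  assumes F: "resolution_of n P D B act s c"
    and K: "resolution_of n (P \<inter> multiples n u) D' B' act' s' c'"
  shows "\<exists>B act s (c :: nat \<Rightarrow> 'x + 'y \<Rightarrow> 'x + 'y \<Rightarrow> 'k).
    resolution_of n (P \<union> multiples n u) (\<lambda>i. D i \<union> (case i of 0 \<Rightarrow> {u} | Suc j \<Rightarrow> D' j)) B act s c"
proof -
  interpret F: exact_strand_complex n B act s c using F by (simp add: resolution_of_def)
  interpret K: exact_strand_complex n B' act' s' c' using K by (simp add: resolution_of_def)
  obtain x0 where x0: "B 0 = {x0}" "act 0 x0 = P" using F by (auto simp: resolution_of_def)
  obtain y0 where y0: "B' 0 = {y0}" "act' 0 y0 = P \<inter> multiples n u" using K by (auto simp: resolution_of_def)
  have "degree_preserving (B' 0) (act' 0) (B 0) (act 0) (\<lambda>y. delta x0 :: 'x \<Rightarrow> 'k)"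
    by (auto simp: degree_preserving_def x0 y0 delta_def split: if_splits)
  from chain_map_exists[OF K.strand_complex_axioms F.exact_strand_complex_axioms this]
  obtain \<phi> where \<phi>0: "\<phi> 0 = (\<lambda>y. delta x0)"
    and \<phi>: "\<And>i. degree_preserving (B' i) (act' i) (B i) (act i) (\<phi> i)"
      "\<And>i y. y \<in> B' (Suc i) \<Longrightarrow> lin (B (Suc i)) (c i) (\<phi> (Suc i) y) = lin (B' i) (\<phi> i) (c' i y)"
    by metis
  define C where "C i = (case i of 0 \<Rightarrow> Inl ` B 0 | Suc j \<Rightarrow> B (Suc j) <+> B' j)" for i
  define sC where "sC i z = (case z of Inl x \<Rightarrow> s i x | Inr y \<Rightarrow> (case i of 0 \<Rightarrow> u | Suc j \<Rightarrow> s' j y))" for i z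
  define actC where "actC i z = (case i of 0 \<Rightarrow> P \<union> multiples n u | Suc j \<Rightarrow> multiples n (sC j z))"
    for i and z :: "'x + 'y"
  \<comment> \<open>The new generator \<open>Inr y0\<close> has no image in the second summand; \<open>\<phi> 0\<close> sends it into the ideal.\<close>
  define dK where "dK i = (case i of 0 \<Rightarrow> 0 | Suc j \<Rightarrow> c' j)" for i
  \<comment> \<open>With this sign the two paths from \<open>Inr y\<close> to the first summand cancel, as \<open>\<phi>\<close> commutes with the differentials.\<close>
  define cC where "cC i z = (case z of Inl x \<Rightarrow> case_sum (c i x) 0 | Inr y \<Rightarrow> case_sum (\<phi> i y) (- dK i y))"
    for i and z :: "'x + 'y"
  have C_simps [simp]: "C 0 = {Inl x0}" "C (Suc j) = B (Suc j) <+> B' j" for j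
    by (simp_all add: C_def x0)
  have act_simps [simp]: "actC 0 z = P \<union> multiples n u" "actC (Suc j) z = multiples n (sC j z)" for j z
    by (simp_all add: actC_def)
  have s_simps [simp]: "sC i (Inl x) = s i x" "sC 0 (Inr y) = u" "sC (Suc j) (Inr y) = s' j y" for i j x y
    by (simp_all add: sC_def)
  have dK_simps [simp]: "dK 0 = 0" "dK (Suc j) = c' j" for j by (simp_all add: dK_def)
  have c_simps [simp]: "cC i (Inl x) = case_sum (c i x) 0"
    "cC i (Inr y) = case_sum (\<phi> i y) (- dK i y)" for i x y by (simp_all add: cC_def)
  have D: "lin (C (Suc i)) (cC i) v = case_sum (lin (B (Suc i)) (c i) (v \<circ> Inl) + lin (B' i) (\<phi> i) (v \<circ> Inr))
    (- lin (B' i) (dK i) (v \<circ> Inr))" for i and v :: "'x + 'y \<Rightarrow> 'k"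
  proof -
    have "lin (B' i) (\<lambda>y. - dK i y) (v \<circ> Inr) = - lin (B' i) (dK i) (v \<circ> Inr)"
      by (rule ext) (simp add: lin_def sum_negf)
    moreover have "lin (B (Suc i)) (\<lambda>x. 0) (v \<circ> Inl) = (0 :: 'y \<Rightarrow> 'k)"
      by (rule ext) (simp add: lin_def)
    ultimately show ?thesis
      by (simp add: lin_Plus F.fin K.fin lin_case_sum case_sum_eq) (auto simp: fun_eq_iff split: sum.split)
  qed
  have act'_sub: "y \<in> B' i \<Longrightarrow> act' i y \<subseteq> actC (Suc i) (Inr y)" for i y
    by (cases i) (auto simp: y0 K.act_Suc)
  have act'_eq: "y \<in> B' (Suc i) \<Longrightarrow> actC (Suc (Suc i)) (Inr y) = act' (Suc i) y" for i y
    by (simp add: K.act_Suc)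
  have F_eq: "x \<in> B (Suc i) \<Longrightarrow> actC (Suc i) (Inl x) = act (Suc i) x" for i x
    by (simp add: F.act_Suc)
  have act_sub: "x \<in> B i \<Longrightarrow> act i x \<subseteq> actC i (Inl x)" for i x
    by (cases i) (auto simp: x0 F.act_Suc)
  interpret C: strand_complex n C actC sC cC
  proof
    show "finite (C i)" for i by (cases i) (simp_all add: F.fin K.fin)
    show "actC (Suc i) z = multiples n (sC i z)" for z i by simp
    show "multiples n b \<subseteq> actC 0 z" if "b \<in> actC 0 z" for z b
      using that F.act_0[of x0 b] multiples_trans[of b n u] by (auto simp: x0)
    show "w \<in> C i \<and> actC (Suc i) z \<subseteq> actC i w" if z: "z \<in> C (Suc i)" and nz: "cC i z w \<noteq> 0" for z w i
    proof (cases z)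
      case (Inl x)
      with z have x: "x \<in> B (Suc i)" by auto
      from nz Inl obtain x' where w: "w = Inl x'" and "c i x x' \<noteq> 0" by (cases w) auto
      with F.c_supp[OF x, of x'] have "x' \<in> B i" "act (Suc i) x \<subseteq> act i x'" by auto
      then show ?thesis using F_eq[OF x] act_sub[of x' i] unfolding Inl w by (cases i) (auto simp: x0)
    next
      case (Inr y)
      with z have y: "y \<in> B' i" by auto
      show ?thesis
      proof (cases w)
        case w: (Inl x)
        then have "\<phi> i y x \<noteq> 0" using nz Inr by simp
        then have x: "x \<in> B i" "act' i y \<subseteq> act i x" using \<phi>(1)[of i] y by (auto simp: degree_preserving_def)
        show ?thesis
        proof (cases i)
          case 0 then show ?thesis using x by (simp add: w Inr x0)
        next
          case (Suc j)
          then show ?thesis using x y act'_eq[of y j] act_sub[of x i] F_eq[of x j] unfolding Inr w by auto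
        qed
      next
        case w: (Inr y')
        with nz Inr obtain j where i: "i = Suc j" by (cases i) auto
        with nz Inr w have "c' j y y' \<noteq> 0" by simp
        with K.c_supp y i have "y' \<in> B' j" "act' (Suc j) y \<subseteq> act' j y'" by blast+
        then show ?thesis using act'_eq[of y j] act'_sub[of y' j] y i unfolding Inr w by auto
      qed
    qed
    show "lin (C (Suc i)) (cC i) (cC (Suc i) z) = 0" if z: "z \<in> C (Suc (Suc i))" for z i
    proof (cases z)
      case (Inl x)
      with z have "x \<in> B (Suc (Suc i))" by auto
      then have "lin (C (Suc i)) (cC i) (cC (Suc i) z) = case_sum 0 0"
        unfolding D Inl by (simp add: comp_def F.dd flip: zero_fun_def)
      then show ?thesis by (auto simp: fun_eq_iff split: sum.split)
    next
      case (Inr y)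
      with z have y: "y \<in> B' (Suc i)" by auto
      have "lin (B' i) (dK i) (- c' i y) = 0"
        by (cases i) (use y K.dd in \<open>auto simp: lin_uminus\<close>)
      moreover have "cC (Suc i) z \<circ> Inl = \<phi> (Suc i) y" "cC (Suc i) z \<circ> Inr = - c' i y"
        by (auto simp: Inr)
      ultimately have "lin (C (Suc i)) (cC i) (cC (Suc i) z) = case_sum 0 0"
        unfolding D by (simp add: \<phi>(2)[OF y] lin_uminus)
      then show ?thesis by (auto simp: fun_eq_iff split: sum.split)
    qed
  qed
  interpret C: exact_strand_complex n C actC sC cC
  proof
    fix v b i assume v: "v \<in> C.chain b i" and cyc: "C.cycle i v"
    show "\<exists>w\<in>C.chain b (Suc i). lin (C (Suc i)) (cC i) w = v"
    proof (cases i)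
      case 0
      have vs: "v z \<noteq> 0 \<Longrightarrow> z = Inl x0 \<and> b \<in> P \<union> multiples n u" for z
        using v by (auto simp: C.chain_def 0)
      show ?thesis
      proof (cases "b \<in> P")
        case True
        have "v \<circ> Inl \<in> F.chain b 0" using vs x0 True unfolding F.chain_def by fastforce
        from F.exact[OF this] obtain w where w: "w \<in> F.chain b 1" "lin (B 1) (c 0) w = v \<circ> Inl" by auto
        have "case_sum w 0 \<in> C.chain b 1"
          using w(1) by (auto simp: C.chain_def F.chain_def F.act_Suc split: sum.splits)
        moreover have "lin (C (Suc 0)) (cC 0) (case_sum w 0) = v"
          unfolding D case_sum_eq using vs w by (auto simp: comp_def fun_eq_iff simp flip: zero_fun_def)
        ultimately show ?thesis using 0 by auto
      next
        case False
        define w where "w = case_sum (0 :: 'x \<Rightarrow> 'k) (\<lambda>y. if y = y0 then v (Inl x0) else 0)"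
        have "w \<in> C.chain b 1"
          using vs False by (auto simp: C.chain_def w_def y0 split: sum.splits if_splits)
        moreover have "w \<circ> Inl = 0" "w \<circ> Inr = (\<lambda>y. if y = y0 then v (Inl x0) else 0)"
          by (auto simp: w_def)
        then have "lin (C (Suc 0)) (cC 0) w = v"
          unfolding D case_sum_eq using vs by (auto simp: fun_eq_iff lin_def y0 \<phi>0 delta_def)
        ultimately show ?thesis using 0 by auto
      qed
    next
      case (Suc j)
      define x where "x = v \<circ> Inl"
      define y where "y = v \<circ> Inr"
      from cyc have "case_sum (lin (B (Suc j)) (c j) x + lin (B' j) (\<phi> j) y) (- lin (B' j) (dK j) y) = 0"
        unfolding Suc C.cycle_simps D x_def y_def .
      then have cx: "lin (B (Suc j)) (c j) x + lin (B' j) (\<phi> j) y = 0" and cy: "lin (B' j) (dK j) y = 0"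
        unfolding case_sum_eq by (auto simp: fun_eq_iff)
      have x: "x \<in> F.chain b (Suc j)"
        using v by (auto simp: F.chain_def C.chain_def x_def Suc F.act_Suc)
      have ysupp: "y t \<noteq> 0 \<Longrightarrow> t \<in> B' j \<and> b \<in> actC (Suc j) (Inr t)" for t
        using v unfolding C.chain_def y_def Suc by auto
      have y: "y \<in> K.chain b j"
      proof (cases j)
        case 0
        have "b \<in> P" if nz: "y y0 \<noteq> 0"
        proof -
          have "lin (B (Suc 0)) (c 0) x x0 + y y0 = 0"
            using cx 0 by (simp add: fun_eq_iff lin_def y0 \<phi>0 delta_def split: if_splits)
          with nz have "lin (B (Suc 0)) (c 0) x x0 \<noteq> 0" by auto
          then obtain z where "z \<in> B (Suc 0)" "x z \<noteq> 0" "c 0 z x0 \<noteq> 0" by (rule lin_nonzero)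
          then show ?thesis using x F.c_supp[of z 0 x0] x0 0 by (auto simp: F.chain_def)
        qed
        then show ?thesis using ysupp y0 unfolding K.chain_def 0 by fastforce
      next
        case (Suc k)
        then show ?thesis using ysupp act'_eq by (auto simp: K.chain_def)
      qed
      have "K.cycle j y" using cy by (cases j) auto
      from K.exact[OF y this] obtain y' where y': "y' \<in> K.chain b (Suc j)" "lin (B' (Suc j)) (c' j) y' = y" by blast
      have ch: "x + lin (B' (Suc j)) (\<phi> (Suc j)) y' \<in> F.chain b (Suc j)"
        by (intro F.chain_add x lin_chain[OF K.strand_complex_axioms F.strand_complex_axioms \<phi>(1) y'(1)])
      have "lin (B' (Suc j)) (\<lambda>t. lin (B (Suc j)) (c j) (\<phi> (Suc j) t)) y' = lin (B' j) (\<phi> j) y"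
        unfolding y'(2)[symmetric] lin_lin by (rule lin_cong) (simp add: \<phi>(2))
      then have "F.cycle (Suc j) (x + lin (B' (Suc j)) (\<phi> (Suc j)) y')"
        using cx by (simp add: lin_add lin_lin)
      from F.exact[OF ch this] obtain x' where x': "x' \<in> F.chain b (Suc (Suc j))"
        "lin (B (Suc (Suc j))) (c (Suc j)) x' = x + lin (B' (Suc j)) (\<phi> (Suc j)) y'" by blast
      have "case_sum x' (- y') \<in> C.chain b (Suc (Suc j))"
        using x'(1) y'(1) by (auto simp: C.chain_def F.chain_def K.chain_def F.act_Suc K.act_Suc split: sum.splits)
      moreover have "case_sum x' (- y') \<circ> Inl = x'" "case_sum x' (- y') \<circ> Inr = - y'" by auto
      then have "lin (C (Suc (Suc j))) (cC (Suc j)) (case_sum x' (- y')) = v"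
        unfolding D case_sum_eq by (simp add: x'(2) y'(2) lin_uminus flip: x_def y_def)
      ultimately show ?thesis using Suc by auto
    qed
  qed
  have "sC i ` C (Suc i) = D i \<union> (case i of 0 \<Rightarrow> {u} | Suc j \<Rightarrow> D' j)" for i
    using F K by (cases i) (auto simp: resolution_of_def Plus_def image_Un image_image y0)
  then have "resolution_of n (P \<union> multiples n u) (\<lambda>i. D i \<union> (case i of 0 \<Rightarrow> {u} | Suc j \<Rightarrow> D' j)) C actC sC cC"
    unfolding resolution_of_def using C.exact_strand_complex_axioms by auto
  then show ?thesis by blast
qed

text \<open>
  Transport along bijections. Iterating the cone would otherwise make the index types grow.
\<close>

lemma resolution_reindex:
  fixes c :: "nat \<Rightarrow> 'x \<Rightarrow> 'x \<Rightarrow> 'k::field"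
  assumes F: "resolution_of n P D B act s c"
  shows "\<exists>r act s (c :: nat \<Rightarrow> nat \<Rightarrow> nat \<Rightarrow> 'k). resolution_of n P D (\<lambda>i. {..<r i}) act s c"
proof -
  interpret F: exact_strand_complex n B act s c using F by (simp add: resolution_of_def)
  define r where "r i = card (B i)" for i
  have "\<exists>g. bij_betw g {..<r i} (B i)" for i
    using ex_bij_betw_nat_finite[OF F.fin, of i] by (simp add: r_def atLeast0LessThan)
  then obtain g where g: "\<And>i. bij_betw (g i) {..<r i} (B i)" by metis
  define pull where "pull i v = (\<lambda>x. if x \<in> B i then v (inv_into {..<r i} (g i) x) else 0)" for i and v :: "nat \<Rightarrow> 'k"
  define push where "push i v = (\<lambda>j. if j < r i then v (g i j) else 0)" for i and v :: "'x \<Rightarrow> 'k"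
  define c' where "c' i j = push i (c i (g (Suc i) j))" for i j
  have gB: "j < r i \<Longrightarrow> g i j \<in> B i" for i j using g bij_betwE by blast
  have inv: "j < r i \<Longrightarrow> inv_into {..<r i} (g i) (g i j) = j" for i j
    using g[of i] by (simp add: bij_betw_def inv_into_f_f)
  have push_pull: "push i (pull i v) = v" if "\<And>j. v j \<noteq> 0 \<Longrightarrow> j < r i" for i v
    using that by (auto simp: push_def pull_def fun_eq_iff gB inv)
  have push_lin: "lin {..<r (Suc i)} (c' i) (push (Suc i) w) = push i (lin (B (Suc i)) (c i) w)" for i w
  proof
    fix k
    have "(\<Sum>j<r (Suc i). w (g (Suc i) j) * c i (g (Suc i) j) y) = (\<Sum>x\<in>B (Suc i). w x * c i x y)" for y
      by (rule sum.reindex_bij_betw[OF g])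
    then show "lin {..<r (Suc i)} (c' i) (push (Suc i) w) k = push i (lin (B (Suc i)) (c i) w) k"
      by (simp add: lin_def push_def c'_def)
  qed
  have push_zero [simp]: "push i 0 = 0" for i by (auto simp: push_def fun_eq_iff)
  interpret G: strand_complex n "\<lambda>i. {..<r i}" "\<lambda>i j. act i (g i j)" "\<lambda>i j. s i (g (Suc i) j)" c'
  proof
    show "finite {..<r i}" for i by simp
    show "act (Suc i) (g (Suc i) j) = multiples n (s i (g (Suc i) j))" if "j \<in> {..<r (Suc i)}" for i j
      using that by (simp add: F.act_Suc gB)
    show "multiples n b \<subseteq> act 0 (g 0 j)" if "j \<in> {..<r 0}" "b \<in> act 0 (g 0 j)" for j b
      using that F.act_0 gB by simp
    show "k \<in> {..<r i} \<and> act (Suc i) (g (Suc i) j) \<subseteq> act i (g i k)"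
      if "j \<in> {..<r (Suc i)}" "c' i j k \<noteq> 0" for i j k
      using that F.c_supp[of "g (Suc i) j" i "g i k"] gB by (auto simp: c'_def push_def split: if_splits)
    show "lin {..<r (Suc i)} (c' i) (c' (Suc i) j) = 0" if "j \<in> {..<r (Suc (Suc i))}" for i j
      using that unfolding c'_def[of "Suc i"] by (simp add: push_lin F.dd gB)
  qed
  interpret G: exact_strand_complex n "\<lambda>i. {..<r i}" "\<lambda>i j. act i (g i j)" "\<lambda>i j. s i (g (Suc i) j)" c'
  proof
    fix v b i assume v: "v \<in> G.chain b i" and cyc: "G.cycle i v"
    have pp: "push i (pull i v) = v" using v by (intro push_pull) (auto simp: G.chain_def)
    have ch: "pull i v \<in> F.chain b i"
      using v g[of i] unfolding F.chain_def G.chain_def pull_def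
      by (auto simp: f_inv_into_f bij_betw_imp_surj_on split: if_splits)
    have "F.cycle i (pull i v)"
    proof (cases i)
      case (Suc j)
      let ?w = "lin (B i) (c j) (pull i v)"
      have "push j ?w = 0" using cyc pp push_lin[of j "pull i v"] by (simp add: Suc)
      moreover have "?w x \<noteq> 0 \<Longrightarrow> x \<in> B j" for x
        using F.d_chain[of "pull i v" b j] ch unfolding Suc F.chain_def by blast
      ultimately have "?w x = 0" for x
        using g[of j] unfolding push_def bij_betw_def fun_eq_iff by (metis imageE lessThan_iff zero_fun_apply)
      then show ?thesis by (simp add: Suc fun_eq_iff)
    qed simp
    from F.exact[OF ch this] obtain w where w: "w \<in> F.chain b (Suc i)" "lin (B (Suc i)) (c i) w = pull i v" by blast
    have "push (Suc i) w \<in> G.chain b (Suc i)" using w(1) by (auto simp: F.chain_def G.chain_def push_def)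
    then show "\<exists>w\<in>G.chain b (Suc i). lin {..<r (Suc i)} (c' i) w = v"
      using w(2) pp by (intro bexI[of _ "push (Suc i) w"]) (simp_all add: push_lin)
  qed
  obtain x0 where x0: "B 0 = {x0}" "act 0 x0 = P" using F by (auto simp: resolution_of_def)
  then have "r 0 = 1" by (simp add: r_def)
  then have "{..<r 0} = {0}" "g 0 0 = x0" using gB[of 0 0] x0 by auto
  moreover have "(\<lambda>j. s i (g (Suc i) j)) ` {..<r (Suc i)} = D i" for i
    using F g[of "Suc i"] by (auto simp: resolution_of_def bij_betw_def image_image[symmetric])
  ultimately have "resolution_of n P D (\<lambda>i. {..<r i}) (\<lambda>i j. act i (g i j)) (\<lambda>i j. s i (g (Suc i) j)) c'"
    unfolding resolution_of_def using G.exact_strand_complex_axioms x0 by auto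
  then show ?thesis by blast
qed

definition squarefree_expo :: "nat set \<Rightarrow> expo" where
  "squarefree_expo T = (\<Sum>t\<in>T. single t 1)"

lemma lookup_squarefree_expo: "finite T \<Longrightarrow> lookup (squarefree_expo T) t = (if t \<in> T then 1 else 0)"
  by (simp add: squarefree_expo_def lookup_sum lookup_single when_def)

lemma squarefree_expo_empty [simp]: "squarefree_expo {} = 0"
  by (simp add: squarefree_expo_def)

lemma squarefree_expo_insert:
  "finite T \<Longrightarrow> t \<notin> T \<Longrightarrow> squarefree_expo (insert t T) = single t 1 + squarefree_expo T"
  by (simp add: squarefree_expo_def)

lemma expos_iff: "a \<in> expos n \<longleftrightarrow> (\<forall>t. t \<notin> {1..n} \<longrightarrow> lookup a t = 0)"
  by (auto simp: expos_def in_keys_iff)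

lemma multiples_iff:
  "b \<in> multiples n a \<longleftrightarrow> (\<forall>t. lookup a t \<le> lookup b t) \<and> (\<forall>t. t \<notin> {1..n} \<longrightarrow> lookup a t = lookup b t)"
proof
  assume "b \<in> multiples n a"
  then show "(\<forall>t. lookup a t \<le> lookup b t) \<and> (\<forall>t. t \<notin> {1..n} \<longrightarrow> lookup a t = lookup b t)"
    by (auto simp: multiples_def lookup_add expos_iff)
next
  assume *: "(\<forall>t. lookup a t \<le> lookup b t) \<and> (\<forall>t. t \<notin> {1..n} \<longrightarrow> lookup a t = lookup b t)"
  then have "b = a + (b - a)" by (intro poly_mapping_eqI) (simp add: lookup_add lookup_minus)
  moreover have "b - a \<in> expos n" using * by (simp add: expos_iff lookup_minus)
  ultimately show "b \<in> multiples n a" unfolding multiples_def by blast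
qed

lemma resolution_of_empty:
  "\<exists>r act s (c :: nat \<Rightarrow> nat \<Rightarrow> nat \<Rightarrow> 'k::field). resolution_of n {} (\<lambda>i. {}) (\<lambda>i. {..<r i}) act s c"
proof -
  interpret strand_complex n "\<lambda>i. {..<(if i = 0 then 1 else 0)}" "\<lambda>i j. {}" "\<lambda>i j. 0"
    "(\<lambda>i j k. 0) :: nat \<Rightarrow> nat \<Rightarrow> nat \<Rightarrow> 'k"
    by unfold_locales auto
  have "exact_strand_complex n (\<lambda>i. {..<(if i = 0 then 1 else 0)}) (\<lambda>i j. {}) (\<lambda>i j. 0)
      ((\<lambda>i j k. 0) :: nat \<Rightarrow> nat \<Rightarrow> nat \<Rightarrow> 'k)"
    by unfold_locales (auto simp: chain_def lin_def fun_eq_iff)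
  then have "resolution_of n {} (\<lambda>i. {}) (\<lambda>i. {..<(if i = 0 then 1 else 0)}) (\<lambda>i j. {}) (\<lambda>i j. 0)
      ((\<lambda>i j k. 0) :: nat \<Rightarrow> nat \<Rightarrow> nat \<Rightarrow> 'k)"
    unfolding resolution_of_def by (auto simp: lessThan_Suc)
  then show ?thesis
    by - (rule exI[of _ "\<lambda>i. if i = 0 then 1 else 0"], rule exI[of _ "\<lambda>i j. {}"],
      rule exI[of _ "\<lambda>i j. 0"], rule exI[of _ "\<lambda>i j k. 0"])
qed

text \<open>
  The ideal of \<open>x\<^sup>u x\<^sub>t\<close>, \<open>t \<in> S\<close>, is resolved by the
  positive part of a Koszul complex. Signs are avoided: if \<open>J\<close> is this ideal for
  \<open>S\<close> and \<open>t\<close> is a new variable, then the intersection of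
  \<open>J\<close> with \<open>(x\<^sup>u x\<^sub>t)\<close> is the ideal of the same shape with
  \<open>u\<close> replaced by \<open>u\<close> plus the exponent of \<open>x\<^sub>t\<close>,
  so the cone and induction on \<open>S\<close> apply.
\<close>

lemma koszul_resolution:
  assumes "finite S" "S \<subseteq> {1..n}"
  shows "\<exists>r act s (c :: nat \<Rightarrow> nat \<Rightarrow> nat \<Rightarrow> 'k::field).
    resolution_of n (\<Union>t\<in>S. multiples n (u + single t 1))
      (\<lambda>i. {u + squarefree_expo T | T. T \<subseteq> S \<and> card T = Suc i}) (\<lambda>i. {..<r i}) act s c"
  using assms
proof (induction S arbitrary: u)
  case empty
  have "{u + squarefree_expo T | T. T \<subseteq> {} \<and> card T = Suc i} = {}" for i by auto
  then show ?case using resolution_of_empty[of n] by simp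
next
  case (insert t S)
  let ?U = "\<lambda>u. \<Union>t\<in>S. multiples n (u + single t 1)"
  let ?D = "\<lambda>S u i. {u + squarefree_expo T | T. T \<subseteq> S \<and> card T = Suc i}"
  have IH: "\<exists>r act s (c :: nat \<Rightarrow> nat \<Rightarrow> nat \<Rightarrow> 'k). resolution_of n (?U v) (?D S v) (\<lambda>i. {..<r i}) act s c" for v
    using insert by simp
  have inter: "?U u \<inter> multiples n (u + single t 1) = ?U (u + single t 1)"
  proof -
    have "multiples n (u + single t' 1) \<inter> multiples n (u + single t 1) = multiples n (u + single t 1 + single t' 1)"
      if "t' \<in> S" for t'
    proof (rule Set.set_eqI)
      fix b
      have *: "t' \<noteq> t" "t' \<in> {1..n}" "t \<in> {1..n}" using that insert.prems insert.hyps by auto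
      have 1: "(lookup (u + single t' 1) r \<le> lookup b r \<and> lookup (u + single t 1) r \<le> lookup b r) \<longleftrightarrow>
          lookup (u + single t 1 + single t' 1) r \<le> lookup b r" for r
        using *(1) by (auto simp: lookup_add lookup_single when_def)
      have 2: "lookup (u + single t' 1) r = lookup u r" "lookup (u + single t 1) r = lookup u r"
        "lookup (u + single t 1 + single t' 1) r = lookup u r" if "r \<notin> {1..n}" for r
        using that *(2,3) by (auto simp: lookup_add lookup_single when_def)
      show "b \<in> multiples n (u + single t' 1) \<inter> multiples n (u + single t 1) \<longleftrightarrow>
          b \<in> multiples n (u + single t 1 + single t' 1)"
        unfolding Int_iff multiples_iff 1[symmetric] using 2 by auto
    qed
    then show ?thesis by auto
  qed
  have deg: "?D S u i \<union> (case i of 0 \<Rightarrow> {u + single t 1} | Suc j \<Rightarrow> ?D S (u + single t 1) j) = ?D (insert t S) u i" for i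
  proof -
    have fin: "finite T" if "T \<subseteq> S" for T using that insert.hyps finite_subset by blast
    have split: "(T \<subseteq> insert t S \<and> card T = Suc i) \<longleftrightarrow> (T \<subseteq> S \<and> card T = Suc i) \<or>
        (\<exists>R. T = insert t R \<and> R \<subseteq> S \<and> card R = i)" for T
    proof -
      have card: "card (insert t R) = Suc (card R)" if "R \<subseteq> S" for R
        using that insert.hyps fin[OF that] by (subst card_insert_disjoint) auto
      show ?thesis
      proof
        assume *: "T \<subseteq> insert t S \<and> card T = Suc i"
        show "(T \<subseteq> S \<and> card T = Suc i) \<or> (\<exists>R. T = insert t R \<and> R \<subseteq> S \<and> card R = i)"
        proof (cases "t \<in> T")
          case True
          with * show ?thesis by (intro disjI2 exI[of _ "T - {t}"]) auto
        qed (use * in auto)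
      next
        assume "(T \<subseteq> S \<and> card T = Suc i) \<or> (\<exists>R. T = insert t R \<and> R \<subseteq> S \<and> card R = i)"
        then show "T \<subseteq> insert t S \<and> card T = Suc i" using card by auto
      qed
    qed
    have "?D (insert t S) u i = ?D S u i \<union> {u + squarefree_expo (insert t R) | R. R \<subseteq> S \<and> card R = i}"
      unfolding split by blast
    also have "{u + squarefree_expo (insert t R) | R. R \<subseteq> S \<and> card R = i} =
        {u + single t 1 + squarefree_expo R | R. R \<subseteq> S \<and> card R = i}"
    proof -
      have "squarefree_expo (insert t R) = single t 1 + squarefree_expo R" if "R \<subseteq> S" for R
        using that insert.hyps fin[OF that] by (intro squarefree_expo_insert) auto
      then show ?thesis by (metis (no_types, opaque_lifting) add.assoc)
    qed
    also have "\<dots> = (case i of 0 \<Rightarrow> {u + single t 1} | Suc j \<Rightarrow> ?D S (u + single t 1) j)"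
    proof (cases i)
      case 0
      have "R \<subseteq> S \<and> card R = 0 \<longleftrightarrow> R = {}" for R using fin by auto
      then show ?thesis by (simp add: 0)
    qed simp
    finally show ?thesis by simp
  qed
  from IH[of u] obtain r act s and c :: "nat \<Rightarrow> nat \<Rightarrow> nat \<Rightarrow> 'k"
    where F: "resolution_of n (?U u) (?D S u) (\<lambda>i. {..<r i}) act s c" by blast
  from IH[of "u + single t 1"] obtain r' act' s' and c' :: "nat \<Rightarrow> nat \<Rightarrow> nat \<Rightarrow> 'k"
    where K: "resolution_of n (?U u \<inter> multiples n (u + single t 1)) (?D S (u + single t 1)) (\<lambda>i. {..<r' i}) act' s' c'"
    unfolding inter by blast
  from cone_resolution[OF F K] obtain C act s and c :: "nat \<Rightarrow> nat + nat \<Rightarrow> nat + nat \<Rightarrow> 'k"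
    where "resolution_of n ((\<Union>t\<in>S. multiples n (u + single t 1)) \<union> multiples n (u + single t 1)) (?D (insert t S) u) C act s c"
    unfolding deg by (elim exE) (rule that)
  from resolution_reindex[OF this] show ?case by (simp add: Un_commute)
qed

text \<open>
  The generators are taken in decreasing lexicographic order, so those before \<open>u\<close>
  are the greater ones. The two conditions on \<open>S u\<close> say that the colon ideal of the
  earlier generators by \<open>x\<^sup>u\<close> is generated by the variables in
  \<open>S u\<close>.
\<close>

definition linear_quotients :: "nat \<Rightarrow> expo set \<Rightarrow> (expo \<Rightarrow> nat set) \<Rightarrow> bool" where
  "linear_quotients n A S \<longleftrightarrow>
    (\<forall>u\<in>A. S u \<subseteq> {1..n} \<and> (\<forall>t\<in>S u. \<exists>w\<in>A. u < w \<and> u + single t 1 \<in> multiples n w) \<and>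
      (\<forall>v\<in>A. u < v \<longrightarrow> (\<exists>t\<in>S u. lookup u t < lookup v t)))"

text \<open>
  Adding the generators one at a time, the ideal of the earlier ones meets
  \<open>(x\<^sup>u)\<close> in the ideal of all \<open>x\<^sup>u x\<^sub>t\<close> with
  \<open>t \<in> S u\<close>. Its Koszul resolution enters the cone, shifted by one position,
  which gives the subsets \<open>T\<close> of \<open>S u\<close> of size \<open>i\<close> in
  position \<open>i\<close>.
\<close>

lemma linear_quotients_resolution:
  assumes "finite A" "linear_quotients n A S"
  shows "\<exists>r act s (c :: nat \<Rightarrow> nat \<Rightarrow> nat \<Rightarrow> 'k::field).
    resolution_of n (\<Union>u\<in>A. multiples n u)
      (\<lambda>i. {u + squarefree_expo T | u T. u \<in> A \<and> T \<subseteq> S u \<and> card T = i}) (\<lambda>i. {..<r i}) act s c"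
  using assms
proof (induction A rule: finite_linorder_min_induct)
  case empty
  show ?case using resolution_of_empty[of n] by simp
next
  case (insert u A)
  let ?D = "\<lambda>A i. {u + squarefree_expo T | u T. u \<in> A \<and> T \<subseteq> S u \<and> card T = i}"
  let ?K = "\<lambda>i. {u + squarefree_expo T | T. T \<subseteq> S u \<and> card T = Suc i}"
  have lq: "S v \<subseteq> {1..n}"
      "t \<in> S v \<Longrightarrow> \<exists>w\<in>insert u A. v < w \<and> v + single t 1 \<in> multiples n w"
      "w \<in> insert u A \<Longrightarrow> v < w \<Longrightarrow> \<exists>t\<in>S v. lookup v t < lookup w t" if "v \<in> insert u A" for v w t
    using bspec[OF insert.prems[unfolded linear_quotients_def] that] by blast+
  have up: "\<exists>w\<in>A. v < w \<and> v + single t 1 \<in> multiples n w" if vt: "v \<in> insert u A" "t \<in> S v" for v t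
  proof -
    obtain w where "w \<in> insert u A" "v < w" "v + single t 1 \<in> multiples n w"
      using lq(2)[OF vt] by blast
    moreover have "w \<noteq> u" using insert.hyps vt(1) \<open>v < w\<close> by auto
    ultimately show ?thesis by blast
  qed
  have "linear_quotients n A S"
    unfolding linear_quotients_def
  proof (intro ballI conjI impI)
    fix v assume v: "v \<in> A"
    show "S v \<subseteq> {1..n}" using lq(1) v by simp
    show "\<exists>w\<in>A. v < w \<and> v + single t 1 \<in> multiples n w" if "t \<in> S v" for t
      using up[OF _ that] v by simp
    show "\<exists>t\<in>S v. lookup v t < lookup w t" if "w \<in> A" "v < w" for w
      using lq(3)[of v w] v that by simp
  qed
  have u1: "S u \<subseteq> {1..n}" using lq(1) by simp
  have u2: "\<exists>w\<in>A. u + single t 1 \<in> multiples n w" if "t \<in> S u" for t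
    using up[OF _ that] by auto
  have u3: "\<exists>t\<in>S u. lookup u t < lookup v t" if "v \<in> A" for v
    using lq(3)[of u v] insert.hyps that by simp
  from insert.IH[OF \<open>linear_quotients n A S\<close>] obtain r act s and c :: "nat \<Rightarrow> nat \<Rightarrow> nat \<Rightarrow> 'k"
    where F: "resolution_of n (\<Union>u\<in>A. multiples n u) (?D A) (\<lambda>i. {..<r i}) act s c" by blast
  have finS: "finite (S u)" using u1 finite_subset by blast
  have inter: "(\<Union>u\<in>A. multiples n u) \<inter> multiples n u = (\<Union>t\<in>S u. multiples n (u + single t 1))"
  proof (intro equalityI subsetI)
    fix b assume "b \<in> (\<Union>u\<in>A. multiples n u) \<inter> multiples n u"
    then obtain v where v: "v \<in> A" "b \<in> multiples n v" "b \<in> multiples n u" by blast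
    from u3[OF v(1)] obtain t where t: "t \<in> S u" "lookup u t < lookup v t" by blast
    have "lookup (u + single t 1) r \<le> lookup b r" for r
      using t(2) multiples_lookup[OF v(2), of r] multiples_lookup[OF v(3), of r]
      by (cases "r = t") (auto simp: lookup_add lookup_single)
    moreover have "lookup (u + single t 1) r = lookup b r" if "r \<notin> {1..n}" for r
    proof -
      have "r \<noteq> t" using that t(1) u1 by auto
      then show ?thesis using that v(3) by (simp add: multiples_iff lookup_add lookup_single)
    qed
    ultimately have "b \<in> multiples n (u + single t 1)" by (simp add: multiples_iff)
    with t show "b \<in> (\<Union>t\<in>S u. multiples n (u + single t 1))" by blast
  next
    fix b assume "b \<in> (\<Union>t\<in>S u. multiples n (u + single t 1))"
    then obtain t where t: "t \<in> S u" "b \<in> multiples n (u + single t 1)" by blast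
    then have "single t 1 \<in> expos n" using u1 by (auto simp: expos_def)
    then have "u + single t 1 \<in> multiples n u" by (auto simp: multiples_def)
    then show "b \<in> (\<Union>u\<in>A. multiples n u) \<inter> multiples n u"
      using multiples_trans[OF \<open>u + single t 1 \<in> multiples n u\<close>] u2[OF t(1)] multiples_trans t(2) by (meson IntI UN_I subsetD)
  qed
  from koszul_resolution[OF finS u1, of u] obtain r' act' s' and c' :: "nat \<Rightarrow> nat \<Rightarrow> nat \<Rightarrow> 'k"
    where K: "resolution_of n ((\<Union>u\<in>A. multiples n u) \<inter> multiples n u) ?K (\<lambda>i. {..<r' i}) act' s' c'"
    unfolding inter by blast
  have deg: "?D A i \<union> (case i of 0 \<Rightarrow> {u} | Suc j \<Rightarrow> ?K j) = ?D (insert u A) i" for i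
  proof -
    have "?D (insert u A) i = ?D A i \<union> {u + squarefree_expo T | T. T \<subseteq> S u \<and> card T = i}" by blast
    moreover have "{u + squarefree_expo T | T. T \<subseteq> S u \<and> card T = i} = (case i of 0 \<Rightarrow> {u} | Suc j \<Rightarrow> ?K j)"
    proof (cases i)
      case 0
      have "T \<subseteq> S u \<and> card T = 0 \<longleftrightarrow> T = {}" for T using finite_subset[OF _ finS, of T] by auto
      then show ?thesis by (simp add: 0)
    qed simp
    ultimately show ?thesis by simp
  qed
  from cone_resolution[OF F K] obtain C act s and c :: "nat \<Rightarrow> nat + nat \<Rightarrow> nat + nat \<Rightarrow> 'k"
    where "resolution_of n ((\<Union>u\<in>A. multiples n u) \<union> multiples n u) (?D (insert u A)) C act s c"
    unfolding deg by (elim exE) (rule that)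
  from resolution_reindex[OF this] show ?case by (simp add: Un_commute)
qed

section \<open>Tor is independent of the resolution\<close>

text \<open>
  If some resolution has no generator of degree \<open>a\<close> in position \<open>i\<close>,
  then Tor vanishes there when computed from any other one. The composite of comparison maps
  through the second resolution is homotopic to the identity. Restricted to generators of degree
  exactly \<open>a\<close> this composite is zero, since it would have to pass through a
  generator of degree \<open>a\<close>; hence the homotopy exhibits every cycle of degree
  \<open>a\<close> as a boundary.
\<close>

lemma exact_degree_part_acyclic:
  fixes c :: "nat \<Rightarrow> 'x \<Rightarrow> 'x \<Rightarrow> 'k::field" and c' :: "nat \<Rightarrow> 'y \<Rightarrow> 'y \<Rightarrow> 'k"
  assumes F: "resolution_of n P D B act s c" and G: "resolution_of n P D' B' act' s' c'"
    and a: "a \<notin> D' i"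
    and v: "\<And>x. v x \<noteq> 0 \<Longrightarrow> x \<in> B (Suc i) \<and> s i x = a"
    and cyc: "\<And>j y. i = Suc j \<Longrightarrow> y \<in> B i \<Longrightarrow> s j y = a \<Longrightarrow> lin (B (Suc i)) (c i) v y = 0"
  shows "\<exists>w. (\<forall>x. w x \<noteq> 0 \<longrightarrow> x \<in> B (Suc (Suc i)) \<and> s (Suc i) x = a) \<and>
    (\<forall>y\<in>B (Suc i). s i y = a \<longrightarrow> lin (B (Suc (Suc i))) (c (Suc i)) w y = v y)"
proof -
  interpret F: exact_strand_complex n B act s c using F by (simp add: resolution_of_def)
  interpret G: exact_strand_complex n B' act' s' c' using G by (simp add: resolution_of_def)
  obtain x0 where x0: "B 0 = {x0}" "act 0 x0 = P" using F by (auto simp: resolution_of_def)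
  obtain y0 where y0: "B' 0 = {y0}" "act' 0 y0 = P" using G by (auto simp: resolution_of_def)
  have "degree_preserving (B 0) (act 0) (B' 0) (act' 0) (\<lambda>x. delta y0 :: 'y \<Rightarrow> 'k)"
    by (auto simp: degree_preserving_def x0 y0 delta_def split: if_splits)
  from chain_map_exists[OF F.strand_complex_axioms G.exact_strand_complex_axioms this]
  obtain \<phi> where \<phi>0: "\<phi> 0 = (\<lambda>x. delta y0)"
    and \<phi>: "\<And>i. degree_preserving (B i) (act i) (B' i) (act' i) (\<phi> i)"
      "\<And>i x. x \<in> B (Suc i) \<Longrightarrow> lin (B' (Suc i)) (c' i) (\<phi> (Suc i) x) = lin (B i) (\<phi> i) (c i x)"
    by metis
  have "degree_preserving (B' 0) (act' 0) (B 0) (act 0) (\<lambda>y. delta x0 :: 'x \<Rightarrow> 'k)"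
    by (auto simp: degree_preserving_def x0 y0 delta_def split: if_splits)
  from chain_map_exists[OF G.strand_complex_axioms F.exact_strand_complex_axioms this]
  obtain \<psi> where \<psi>0: "\<psi> 0 = (\<lambda>y. delta x0)"
    and \<psi>: "\<And>i. degree_preserving (B' i) (act' i) (B i) (act i) (\<psi> i)"
      "\<And>i y. y \<in> B' (Suc i) \<Longrightarrow> lin (B (Suc i)) (c i) (\<psi> (Suc i) y) = lin (B' i) (\<psi> i) (c' i y)"
    by metis
  \<comment> \<open>The identity minus the composite; it vanishes on the ideal in position \<open>0\<close>.\<close>
  define \<theta> where "\<theta> i x = delta x - lin (B' i) (\<psi> i) (\<phi> i x)" for i and x :: 'x
  have \<phi>\<psi>: "\<exists>z\<in>B' i. y \<in> B i \<and> act i x \<subseteq> act' i z \<and> act' i z \<subseteq> act i y"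
    if "lin (B' i) (\<psi> i) (\<phi> i x) y \<noteq> 0" "x \<in> B i" for i x y
  proof -
    from that(1) obtain z where "z \<in> B' i" "\<phi> i x z \<noteq> 0" "\<psi> i z y \<noteq> 0" by (rule lin_nonzero)
    then show ?thesis using \<phi>(1)[of i] \<psi>(1)[of i] that(2) unfolding degree_preserving_def by blast
  qed
  have \<theta>1: "degree_preserving (B i) (act i) (B i) (act i) (\<theta> i)" for i
    unfolding degree_preserving_def
  proof (intro ballI allI impI)
    fix x y assume x: "x \<in> B i" and "\<theta> i x y \<noteq> 0"
    then have "x = y \<or> lin (B' i) (\<psi> i) (\<phi> i x) y \<noteq> 0"
      by (auto simp: \<theta>_def delta_def split: if_splits)
    then show "y \<in> B i \<and> act i x \<subseteq> act i y" using \<phi>\<psi>[OF _ x] x by blast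
  qed
  have \<theta>2: "lin (B (Suc i)) (c i) (\<theta> (Suc i) x) = lin (B i) (\<theta> i) (c i x)" if x: "x \<in> B (Suc i)" for i x
  proof -
    have "lin (B' (Suc i)) (\<lambda>y. lin (B (Suc i)) (c i) (\<psi> (Suc i) y)) (\<phi> (Suc i) x) =
        lin (B' i) (\<psi> i) (lin (B' (Suc i)) (c' i) (\<phi> (Suc i) x))"
      unfolding lin_lin by (rule lin_cong) (simp add: \<psi>(2))
    moreover have "lin (B i) delta (c i x) = c i x"
      using F.c_supp[OF x] by (intro lin_delta_right F.fin) auto
    ultimately show ?thesis
      unfolding \<theta>_def by (simp add: lin_diff lin_map_diff lin_delta F.fin x lin_lin[of _ _ _ "\<psi> (Suc i)"] \<phi>(2)[OF x])
        (simp add: lin_lin)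
  qed
  have \<theta>3: "\<theta> 0 x = 0" if "x \<in> B 0" for x
    using that by (auto simp: \<theta>_def x0 y0 \<phi>0 \<psi>0 lin_def delta_def fun_eq_iff)
  obtain h where h0: "h 0 = 0"
    and h: "\<And>i. degree_preserving (B i) (act i) (B (Suc i)) (act (Suc i)) (h i)"
      "\<And>i x. x \<in> B (Suc i) \<Longrightarrow>
        \<theta> (Suc i) x = lin (B (Suc (Suc i))) (c (Suc i)) (h (Suc i) x) + lin (B i) (h i) (c i x)"
    using null_homotopy_exists[OF F.strand_complex_axioms F.exact_strand_complex_axioms \<theta>1 \<theta>2 \<theta>3] by metis
  define w where "w = (\<lambda>z. if z \<in> B (Suc (Suc i)) \<and> s (Suc i) z = a then lin (B (Suc i)) (h (Suc i)) v z else 0)"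
  have "lin (B (Suc (Suc i))) (c (Suc i)) w y = v y" if y: "y \<in> B (Suc i)" "s i y = a" for y
  proof -
    have acty: "act (Suc i) y = multiples n a" using y by (simp add: F.act_Suc)
    have actx: "act (Suc i) x = multiples n a \<and> x \<in> B (Suc i)" if "v x \<noteq> 0" for x
      using v[OF that] by (simp add: F.act_Suc)
    have "lin (B (Suc i)) (\<lambda>x. lin (B' (Suc i)) (\<psi> (Suc i)) (\<phi> (Suc i) x)) v y = 0"
    proof (rule ccontr)
      assume "\<not> ?thesis"
      then obtain x where x: "x \<in> B (Suc i)" "v x \<noteq> 0" "lin (B' (Suc i)) (\<psi> (Suc i)) (\<phi> (Suc i) x) y \<noteq> 0"
        by (rule lin_nonzero)
      from \<phi>\<psi>[OF x(3,1)] obtain z where "z \<in> B' (Suc i)" "multiples n a = multiples n (s' i z)"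
        using actx[OF x(2)] acty G.act_Suc by auto
      then have "s' i z = a" using multiples_antisym multiples_self by metis
      then show False using a G \<open>z \<in> B' (Suc i)\<close> unfolding resolution_of_def by blast
    qed
    then have "lin (B (Suc i)) (\<theta> (Suc i)) v y = v y"
      unfolding \<theta>_def lin_map_diff using lin_delta_right[OF F.fin, of v "Suc i"] v by simp
    moreover have "lin (B (Suc i)) (\<theta> (Suc i)) v = lin (B (Suc (Suc i))) (c (Suc i)) (lin (B (Suc i)) (h (Suc i)) v) +
        lin (B i) (h i) (lin (B (Suc i)) (c i) v)"
      unfolding lin_lin lin_map_add[symmetric] by (rule lin_cong) (simp add: h(2))
    moreover have "lin (B i) (h i) (lin (B (Suc i)) (c i) v) y = 0"
    proof (rule ccontr)
      assume "\<not> ?thesis"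
      then obtain z where z: "z \<in> B i" "lin (B (Suc i)) (c i) v z \<noteq> 0" "h i z y \<noteq> 0" by (rule lin_nonzero)
      then obtain j where i: "i = Suc j" using h0 by (cases i) auto
      from z(2) obtain x where x: "x \<in> B (Suc i)" "v x \<noteq> 0" "c i x z \<noteq> 0" by (rule lin_nonzero)
      have "multiples n a \<subseteq> multiples n (s j z)" using F.c_supp[OF x(1,3)] actx[OF x(2)] z(1) i F.act_Suc[of z j] by auto
      moreover have "act i z \<subseteq> act (Suc i) y"
        using h(1)[of i] z(1,3) unfolding degree_preserving_def by blast
      then have "multiples n (s j z) \<subseteq> multiples n a"
        using acty F.act_Suc[of z j] z(1) i by simp
      ultimately have "s j z = a" using multiples_antisym multiples_subset_iff by blast
      with cyc[OF i z(1)] z(2) show False by simp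
    qed
    moreover have "lin (B (Suc (Suc i))) (c (Suc i)) (lin (B (Suc i)) (h (Suc i)) v) y =
        lin (B (Suc (Suc i))) (c (Suc i)) w y"
      unfolding lin_def[of "B (Suc (Suc i))"]
    proof (rule sum.cong[OF refl])
      fix z assume z: "z \<in> B (Suc (Suc i))"
      have "s (Suc i) z = a" if nz: "lin (B (Suc i)) (h (Suc i)) v z \<noteq> 0" "c (Suc i) z y \<noteq> 0"
      proof -
        from nz(1) obtain x where x: "x \<in> B (Suc i)" "v x \<noteq> 0" "h (Suc i) x z \<noteq> 0" by (rule lin_nonzero)
        have "act (Suc i) x \<subseteq> act (Suc (Suc i)) z"
          using h(1)[of "Suc i"] x(1,3) unfolding degree_preserving_def by blast
        then have "multiples n a \<subseteq> multiples n (s (Suc i) z)"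
          using actx[OF x(2)] F.act_Suc[of z "Suc i"] z by simp
        moreover have "multiples n (s (Suc i) z) \<subseteq> multiples n a"
          using F.c_supp[OF z nz(2)] acty z by (simp add: F.act_Suc)
        ultimately show ?thesis using multiples_antisym multiples_subset_iff by blast
      qed
      then show "lin (B (Suc i)) (h (Suc i)) v z * c (Suc i) z y = w z * c (Suc i) z y"
        using z by (auto simp: w_def)
    qed
    ultimately show ?thesis by simp
  qed
  moreover have "w z \<noteq> 0 \<longrightarrow> z \<in> B (Suc (Suc i)) \<and> s (Suc i) z = a" for z by (simp add: w_def)
  ultimately show ?thesis by blast
qed

section \<open>Strands of vectors of polynomials\<close>

text \<open>
  The component of degree \<open>b\<close> of an element of
  \<open>\<Oplus>\<^sub>j S(-\<sigma> j)\<close>, as a vector of scalars.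
\<close>

definition strand :: "nat \<Rightarrow> nat \<Rightarrow> (nat \<Rightarrow> expo) \<Rightarrow> expo \<Rightarrow> 'k::field mpoly vec \<Rightarrow> nat \<Rightarrow> 'k" where
  "strand n r \<sigma> b v = (\<lambda>j. if j < r \<and> b \<in> multiples n (\<sigma> j) then lookup (v $ j) (b - \<sigma> j) else 0)"

lemma multiples_diff: "b \<in> multiples n a \<Longrightarrow> a + (b - a) = b"
  by (auto simp: multiples_def)

lemma free_mod_index: "v \<in> free_mod n r \<Longrightarrow> j < r \<Longrightarrow> keys (v $ j) \<subseteq> expos n"
proof -
  assume "v \<in> free_mod n r" "j < r"
  then have "v $ j \<in> carrier (poly_ring n)"
    by (auto simp: free_mod_def vec_set_def image_subset_iff simp del: poly_ring_simps)
  then show ?thesis by simp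
qed

lemma free_modI:
  assumes "dim_vec v = r" "\<And>j. j < r \<Longrightarrow> keys (v $ j) \<subseteq> expos n"
  shows "v \<in> free_mod n r"
  unfolding free_mod_def
proof (intro CollectI conjI subsetI)
  show "v \<in> carrier_vec r" using assms(1) by (rule carrier_vecI)
  fix p assume "p \<in> set\<^sub>v v"
  then obtain j where "j < dim_vec v" "p = v $ j" unfolding vec_set_def by blast
  then show "p \<in> carrier (poly_ring n)" using assms by simp
qed

lemma free_mod_dim: "v \<in> free_mod n r \<Longrightarrow> v \<in> carrier_vec r"
  by (simp add: free_mod_def)

lemma strand_eqI:
  assumes v: "v \<in> free_mod n r" and w: "w \<in> free_mod n r"
    and eq: "\<And>b. strand n r \<sigma> b v = strand n r \<sigma> b w"
  shows "v = w"
proof (rule eq_vecI)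
  show "dim_vec v = dim_vec w" using free_mod_dim[OF v] free_mod_dim[OF w] by simp
  fix j assume "j < dim_vec w"
  then have j: "j < r" using free_mod_dim[OF w] by simp
  show "v $ j = w $ j"
  proof (rule poly_mapping_eqI)
    fix m
    show "lookup (v $ j) m = lookup (w $ j) m"
    proof (cases "m \<in> expos n")
      case True
      then have "\<sigma> j + m \<in> multiples n (\<sigma> j)" by (auto simp: multiples_def)
      then show ?thesis using fun_cong[OF eq[of "\<sigma> j + m"], of j] j by (simp add: strand_def)
    next
      case False
      then show ?thesis using free_mod_index[OF v j] free_mod_index[OF w j] by (metis in_keys_iff subsetD)
    qed
  qed
qed

lemma finite_strands:
  "finite {b. strand n r \<sigma> b v \<noteq> 0}"
proof (rule finite_subset)
  show "{b. strand n r \<sigma> b v \<noteq> 0} \<subseteq> (\<Union>j<r. (\<lambda>m. \<sigma> j + m) ` keys (v $ j))"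
  proof
    fix b assume "b \<in> {b. strand n r \<sigma> b v \<noteq> 0}"
    then obtain j where j: "strand n r \<sigma> b v j \<noteq> 0" by (auto simp: fun_eq_iff)
    then have "j < r" "b \<in> multiples n (\<sigma> j)" "b - \<sigma> j \<in> keys (v $ j)"
      by (auto simp: strand_def in_keys_iff split: if_splits)
    then show "b \<in> (\<Union>j<r. (\<lambda>m. \<sigma> j + m) ` keys (v $ j))"
      by (intro UN_I[of j] image_eqI[of _ _ "b - \<sigma> j"]) (simp_all add: multiples_diff)
  qed
qed simp

text \<open>
  Polynomials have finitely many terms, which is why only finitely many degrees may be
  prescribed.
\<close>

lemma strands_realizable:
  assumes fin: "finite {b. W b \<noteq> 0}"
    and W: "\<And>b j. W b j \<noteq> 0 \<Longrightarrow> j < r \<and> b \<in> multiples n (\<sigma> j)"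
  shows "\<exists>v\<in>free_mod n r. \<forall>b. strand n r \<sigma> b v = (W b :: nat \<Rightarrow> 'k::field)"
proof -
  define p where "p j = (\<lambda>m. if m \<in> expos n then W (\<sigma> j + m) j else 0)" for j
  have fin': "finite {m. p j m \<noteq> 0}" for j
  proof (rule finite_subset)
    show "{m. p j m \<noteq> 0} \<subseteq> (\<lambda>b. b - \<sigma> j) ` {b. W b \<noteq> 0}"
    proof
      fix m assume "m \<in> {m. p j m \<noteq> 0}"
      then have "W (\<sigma> j + m) \<noteq> 0" by (auto simp: p_def fun_eq_iff split: if_splits)
      then show "m \<in> (\<lambda>b. b - \<sigma> j) ` {b. W b \<noteq> 0}" by (intro image_eqI[of _ _ "\<sigma> j + m"]) auto
    qed
  qed (use fin in simp)
  define v where "v = vec r (\<lambda>j. Abs_poly_mapping (p j))"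
  have lv: "lookup (v $ j) = p j" if "j < r" for j using that fin' by (simp add: v_def)
  have "v \<in> free_mod n r"
    by (rule free_modI) (use lv in \<open>auto simp: v_def in_keys_iff p_def split: if_splits\<close>)
  moreover have "strand n r \<sigma> b v = W b" for b
  proof
    fix j
    show "strand n r \<sigma> b v j = W b j"
    proof (cases "j < r \<and> b \<in> multiples n (\<sigma> j)")
      case True
      then have "b - \<sigma> j \<in> expos n" by (auto simp: multiples_def)
      then show ?thesis using True lv multiples_diff[of b n "\<sigma> j"] by (simp add: strand_def p_def)
    next
      case False
      then show ?thesis using W[of b j] by (auto simp: strand_def)
    qed
  qed
  ultimately show ?thesis by blast
qed

lemma lookup_single_mult:
  fixes q :: "'k::field mpoly"
  shows "lookup (single m a * q) (m + r) = a * lookup q r"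
proof -
  have "lookup (single m a * q) (m + r) = (\<Sum>l. (a * (\<Sum>q'. lookup q q' when m + r = l + q')) when m = l)"
    by (simp only: lookup_mult lookup_single when_mult)
  also have "\<dots> = a * (\<Sum>q'. lookup q q' when m + r = m + q')"
    by (rule Sum_any_when_equal')
  also have "\<dots> = a * lookup q r" by (simp only: add_left_cancel Sum_any_when_equal')
  finally show ?thesis .
qed

lemma lookup_homogeneous_mult:
  fixes p q :: "'k::field mpoly"
  assumes p: "keys p \<subseteq> expos n" "\<And>m. m \<in> keys p \<Longrightarrow> m + t = s" and q: "keys q \<subseteq> expos n"
    and b: "b \<in> multiples n t"
  shows "lookup (p * q) (b - t) = (if b \<in> multiples n s then lookup q (b - s) else 0) * lookup p (s - t)"
proof (cases "p = 0")
  case True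
  then show ?thesis by simp
next
  case False
  then obtain m where m: "m \<in> keys p" by (metis all_not_in_conv in_keys_iff lookup_zero poly_mapping_eqI)
  then have s: "s = m + t" and pm: "p = single m (lookup p m)"
    using p(2) by (auto intro!: poly_mapping_eqI simp: lookup_single when_def in_keys_iff) (metis add_right_imp_eq)
  show ?thesis
  proof (cases "b \<in> multiples n s")
    case True
    then obtain r where r: "b = m + t + r" by (auto simp: multiples_def s)
    then have "b = (m + r) + t" "b = r + s" by (simp_all add: s add_ac)
    then have "b - t = m + r" "b - s = r" by (metis add_diff_cancel_right')+
    then show ?thesis using True lookup_single_mult[of m "lookup p m" q r] pm by (simp add: s)
  next
    case nb: False
    have "b - t \<notin> keys (p * q)"
    proof
      assume "b - t \<in> keys (p * q)"
      then obtain m' r where "b - t = m' + r" "m' \<in> keys p" "r \<in> keys q" using keys_mult by blast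
      moreover have "m' = m" using p(2)[OF \<open>m' \<in> keys p\<close>] s by simp
      ultimately have "b = m + t + r" "r \<in> expos n"
        using multiples_diff[OF b] q by (auto simp: add_ac)
      then show False using nb by (auto simp: multiples_def s)
    qed
    then show ?thesis using nb by (simp add: in_keys_iff)
  qed
qed


section \<open>Homogeneous matrices act strandwise\<close>

definition homogeneous_mat ::
  "nat \<Rightarrow> nat \<Rightarrow> nat \<Rightarrow> (nat \<Rightarrow> expo) \<Rightarrow> (nat \<Rightarrow> expo) \<Rightarrow> 'k::field mpoly mat \<Rightarrow> bool" where
  "homogeneous_mat n r q \<sigma> \<tau> M \<longleftrightarrow> M \<in> carrier_mat r q \<and> elements_mat M \<subseteq> carrier (poly_ring n) \<and>
    (\<forall>j<r. \<forall>k<q. \<forall>m\<in>keys (M $$ (j, k)). m + \<sigma> j = \<tau> k)"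

text \<open>
  Indices are swapped: the result maps a basis element of the source to its image.
\<close>

definition mat_coeffs ::
  "nat \<Rightarrow> (nat \<Rightarrow> expo) \<Rightarrow> (nat \<Rightarrow> expo) \<Rightarrow> 'k::field mpoly mat \<Rightarrow> nat \<Rightarrow> nat \<Rightarrow> 'k" where
  "mat_coeffs r \<sigma> \<tau> M k j = (if j < r then lookup (M $$ (j, k)) (\<tau> k - \<sigma> j) else 0)"

lemma homogeneous_mat_index:
  "homogeneous_mat n r q \<sigma> \<tau> M \<Longrightarrow> j < r \<Longrightarrow> k < q \<Longrightarrow> keys (M $$ (j, k)) \<subseteq> expos n"
proof -
  assume "homogeneous_mat n r q \<sigma> \<tau> M" "j < r" "k < q"
  then have "M $$ (j, k) \<in> carrier (poly_ring n)"
    unfolding homogeneous_mat_def using elements_matI by blast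
  then show ?thesis by simp
qed

lemma mat_coeffs_nonzero:
  assumes M: "homogeneous_mat n r q \<sigma> \<tau> M" and k: "k < q" and nz: "mat_coeffs r \<sigma> \<tau> M k j \<noteq> 0"
  shows "j < r" "\<tau> k - \<sigma> j \<in> keys (M $$ (j, k))" "\<tau> k \<in> multiples n (\<sigma> j)"
proof -
  show j: "j < r" and m: "\<tau> k - \<sigma> j \<in> keys (M $$ (j, k))"
    using nz by (auto simp: mat_coeffs_def in_keys_iff split: if_splits)
  have "\<tau> k = \<sigma> j + (\<tau> k - \<sigma> j)"
    using M j k m unfolding homogeneous_mat_def by (metis add.commute)
  moreover have "\<tau> k - \<sigma> j \<in> expos n" using homogeneous_mat_index[OF M j k] m by blast
  ultimately show "\<tau> k \<in> multiples n (\<sigma> j)" unfolding multiples_def by blast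
qed

lemma carrier_sum_keys:
  "(\<And>x. x \<in> A \<Longrightarrow> keys (f x) \<subseteq> expos n) \<Longrightarrow> keys (sum f A) \<subseteq> expos n"
  by (induction A rule: infinite_finite_induct) (use keys_add in fastforce)+

lemma carrier_mult_keys:
  fixes p q :: "'k::field mpoly"
  shows "keys p \<subseteq> expos n \<Longrightarrow> keys q \<subseteq> expos n \<Longrightarrow> keys (p * q) \<subseteq> expos n"
  using keys_mult[of p q] plus_in_expos by blast

lemma mult_mat_vec_index:
  "M \<in> carrier_mat r q \<Longrightarrow> v \<in> carrier_vec q \<Longrightarrow> j < r \<Longrightarrow> (M *\<^sub>v v) $ j = (\<Sum>k<q. M $$ (j, k) * v $ k)"
  by (auto simp: scalar_prod_def atLeast0LessThan intro!: sum.cong)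

lemma homogeneous_mat_free_mod:
  assumes "homogeneous_mat n r q \<sigma> \<tau> M" "v \<in> free_mod n q"
  shows "M *\<^sub>v v \<in> free_mod n r"
proof (rule free_modI)
  have M: "M \<in> carrier_mat r q" using assms(1) by (simp add: homogeneous_mat_def)
  then show "dim_vec (M *\<^sub>v v) = r" by simp
  fix j assume j: "j < r"
  show "keys ((M *\<^sub>v v) $ j) \<subseteq> expos n"
    unfolding mult_mat_vec_index[OF M free_mod_dim[OF assms(2)] j]
    by (intro carrier_sum_keys carrier_mult_keys homogeneous_mat_index[OF assms(1) j] free_mod_index[OF assms(2)]) auto
qed

text \<open>
  Each entry of a homogeneous matrix is a scalar times one monomial, so multiplication by it
  moves the coefficients of a strand without mixing degrees. This is what reduces exactness over
  the polynomial ring to exactness of all strands over the field.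
\<close>

lemma strand_mult_mat_vec:
  assumes M: "homogeneous_mat n r q \<sigma> \<tau> M" and v: "v \<in> free_mod n q"
  shows "strand n r \<sigma> b (M *\<^sub>v v) = lin {..<q} (mat_coeffs r \<sigma> \<tau> M) (strand n q \<tau> b v)"
proof
  fix j
  have Mc: "M \<in> carrier_mat r q" using M by (simp add: homogeneous_mat_def)
  show "strand n r \<sigma> b (M *\<^sub>v v) j = lin {..<q} (mat_coeffs r \<sigma> \<tau> M) (strand n q \<tau> b v) j"
  proof (cases "j < r \<and> b \<in> multiples n (\<sigma> j)")
    case True
    have "lookup (M $$ (j, k) * v $ k) (b - \<sigma> j) = strand n q \<tau> b v k * mat_coeffs r \<sigma> \<tau> M k j" if k: "k < q" for k
      using lookup_homogeneous_mult[OF homogeneous_mat_index[OF M _ k] _ free_mod_index[OF v k], of j "\<sigma> j" "\<tau> k" b]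
        True k M by (simp add: strand_def mat_coeffs_def homogeneous_mat_def)
    then show ?thesis
      using True unfolding strand_def[of n r] mult_mat_vec_index[OF Mc free_mod_dim[OF v] conjunct1[OF True]]
      by (simp add: lookup_sum lin_def)
  next
    case False
    have "lin {..<q} (mat_coeffs r \<sigma> \<tau> M) (strand n q \<tau> b v) j = 0"
    proof (rule ccontr)
      assume "\<not> ?thesis"
      then obtain k where k: "k \<in> {..<q}" "strand n q \<tau> b v k \<noteq> 0" "mat_coeffs r \<sigma> \<tau> M k j \<noteq> 0" by (rule lin_nonzero)
      then have "b \<in> multiples n (\<tau> k)" by (auto simp: strand_def split: if_splits)
      then show False
        using False mat_coeffs_nonzero[OF M _ k(3)] k(1) multiples_trans by blast
    qed
    then show ?thesis using False by (auto simp: strand_def)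
  qed
qed

lemma strand_unit_vec:
  assumes "x < r"
  shows "unit_vec r x \<in> free_mod n r" "strand n r \<sigma> (\<sigma> x) (unit_vec r x) = delta x"
proof -
  show "unit_vec r x \<in> free_mod n r" by (rule free_modI) (auto simp: unit_vec_def)
  show "strand n r \<sigma> (\<sigma> x) (unit_vec r x) = delta x"
    using assms by (auto simp: strand_def delta_def unit_vec_def fun_eq_iff)
qed

section \<open>Multigraded resolutions and exact strand complexes\<close>

text \<open>
  The augmentation becomes the differential in position \<open>0\<close>, with target
  \<open>S\<close> generated in degree \<open>0\<close>, and all other positions move up by one.
\<close>

definition aug_rk :: "(expo, 'k::field mpoly) free_complex \<Rightarrow> nat \<Rightarrow> nat" where
  "aug_rk F i = (case i of 0 \<Rightarrow> 1 | Suc j \<Rightarrow> rk F j)"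

definition aug_shift :: "(expo, 'k::field mpoly) free_complex \<Rightarrow> nat \<Rightarrow> nat \<Rightarrow> expo" where
  "aug_shift F i = (case i of 0 \<Rightarrow> (\<lambda>_. 0) | Suc j \<Rightarrow> shift F j)"

definition aug_dmap :: "(expo, 'k::field mpoly) free_complex \<Rightarrow> nat \<Rightarrow> 'k mpoly mat" where
  "aug_dmap F i = (case i of 0 \<Rightarrow> mat_of_row (aug F) | Suc j \<Rightarrow> dmap F j)"

definition aug_coeffs :: "(expo, 'k::field mpoly) free_complex \<Rightarrow> nat \<Rightarrow> nat \<Rightarrow> nat \<Rightarrow> 'k" where
  "aug_coeffs F i = mat_coeffs (aug_rk F i) (aug_shift F i) (aug_shift F (Suc i)) (aug_dmap F i)"

lemma aug_simps [simp]:
  "aug_rk F 0 = 1" "aug_rk F (Suc j) = rk F j" "aug_shift F 0 = (\<lambda>_. 0)" "aug_shift F (Suc j) = shift F j"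
  "aug_dmap F 0 = mat_of_row (aug F)" "aug_dmap F (Suc j) = dmap F j"
  by (simp_all add: aug_rk_def aug_shift_def aug_dmap_def)

definition homogeneous_complex :: "nat \<Rightarrow> (expo, 'k::field mpoly) free_complex \<Rightarrow> bool" where
  "homogeneous_complex n F \<longleftrightarrow>
    (\<forall>i. homogeneous_mat n (aug_rk F i) (aug_rk F (Suc i)) (aug_shift F i) (aug_shift F (Suc i)) (aug_dmap F i))"

lemma aug_homogeneous_mat:
  "homogeneous_mat n 1 (rk F 0) (\<lambda>_. 0) (shift F 0) (mat_of_row (aug F)) \<longleftrightarrow>
    aug F \<in> free_mod n (rk F 0) \<and> (\<forall>k<rk F 0. \<forall>m\<in>keys (aug F $ k). m = shift F 0 k)"
proof -
  have "elements_mat (mat_of_row (aug F)) = set\<^sub>v (aug F)"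
    unfolding vec_set_def elements_mat_def by (auto simp: mat_of_row_def)
  then show ?thesis
    unfolding homogeneous_mat_def free_mod_def carrier_mat_def carrier_vec_def by auto
qed

lemma aug_mult:
  assumes "aug F \<in> carrier_vec r" "v \<in> carrier_vec r"
  shows "mat_of_row (aug F) *\<^sub>v v = vec 1 (\<lambda>_. aug F \<bullet> v)"
  using assms by (intro eq_vecI) auto

text \<open>
  With the augmentation as a matrix with one row, all conditions take the same form in every
  position.
\<close>

lemma graded_free_resolution_iff:
  fixes F :: "(expo, 'k::field mpoly) free_complex"
  shows
  "graded_free_resolution n (\<lambda>m. m) F I \<longleftrightarrow> homogeneous_complex n F \<and>
    (\<lambda>p. vec 1 (\<lambda>_. p)) ` I = {aug_dmap F 0 *\<^sub>v v | v. v \<in> free_mod n (aug_rk F 1)} \<and>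
    (\<forall>i. {v \<in> free_mod n (aug_rk F (Suc i)). aug_dmap F i *\<^sub>v v = 0\<^sub>v (aug_rk F i)} =
      {aug_dmap F (Suc i) *\<^sub>v w | w. w \<in> free_mod n (aug_rk F (Suc (Suc i)))})"
proof -
  have nat_split: "(\<forall>i. Q i) \<longleftrightarrow> Q 0 \<and> (\<forall>i. Q (Suc i))" for Q :: "nat \<Rightarrow> bool"
    by (metis not0_implies_Suc)
  have hom: "homogeneous_complex n F \<longleftrightarrow>
      aug F \<in> free_mod n (rk F 0) \<and> (\<forall>k<rk F 0. \<forall>m\<in>keys (aug F $ k). m = shift F 0 k) \<and>
      (\<forall>i. dmap F i \<in> carrier_mat (rk F i) (rk F (Suc i)) \<and> elements_mat (dmap F i) \<subseteq> carrier (poly_ring n)) \<and>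
      (\<forall>i. \<forall>j<rk F i. \<forall>k<rk F (Suc i). \<forall>m\<in>keys (dmap F i $$ (j, k)). m + shift F i j = shift F (Suc i) k)"
    unfolding homogeneous_complex_def
    by (subst nat_split, unfold aug_simps aug_homogeneous_mat) (auto simp: homogeneous_mat_def)
  show ?thesis
  proof (cases "homogeneous_complex n F")
    case True
    then have aug: "aug F \<in> carrier_vec (rk F 0)" using hom free_mod_dim by blast
    have inj: "inj (\<lambda>p :: 'k mpoly. vec 1 (\<lambda>_. p))"
      by (rule inj_on_inverseI[where g = "\<lambda>v. v $ 0"]) simp
    have mult: "aug_dmap F 0 *\<^sub>v v = vec 1 (\<lambda>_. aug F \<bullet> v)" if "v \<in> free_mod n (rk F 0)" for v
      using aug_mult[OF aug free_mod_dim[OF that]] by simp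
    have "{aug_dmap F 0 *\<^sub>v v | v. v \<in> free_mod n (aug_rk F 1)} =
        (\<lambda>p. vec 1 (\<lambda>_. p)) ` {aug F \<bullet> v | v. v \<in> free_mod n (rk F 0)}"
      using mult by (auto simp: image_iff simp del: aug_simps(5)) metis+
    then have 1: "(\<lambda>p. vec 1 (\<lambda>_. p)) ` I = {aug_dmap F 0 *\<^sub>v v | v. v \<in> free_mod n (aug_rk F 1)} \<longleftrightarrow>
        I = {aug F \<bullet> v | v. v \<in> free_mod n (rk F 0)}"
      using inj_image_eq_iff[OF inj] by simp
    have "vec 1 (\<lambda>_. p) = 0\<^sub>v 1 \<longleftrightarrow> p = 0" for p :: "'k mpoly"
      using inj_eq[OF inj, of p 0] by (simp add: zero_vec_def)
    then have 2: "{v \<in> free_mod n (aug_rk F (Suc 0)). aug_dmap F 0 *\<^sub>v v = 0\<^sub>v (aug_rk F 0)} =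
        {v \<in> free_mod n (rk F 0). aug F \<bullet> v = 0}"
      using mult by (auto simp del: aug_simps(5))
    let ?Q = "\<lambda>i. {v \<in> free_mod n (aug_rk F (Suc i)). aug_dmap F i *\<^sub>v v = 0\<^sub>v (aug_rk F i)} =
      {aug_dmap F (Suc i) *\<^sub>v w | w. w \<in> free_mod n (aug_rk F (Suc (Suc i)))}"
    have 3: "(\<forall>i. ?Q i) \<longleftrightarrow>
        {v \<in> free_mod n (rk F 0). aug F \<bullet> v = 0} = {dmap F 0 *\<^sub>v w | w. w \<in> free_mod n (rk F 1)} \<and>
        (\<forall>i. {v \<in> free_mod n (rk F (Suc i)). dmap F i *\<^sub>v v = 0\<^sub>v (rk F i)} =
         {dmap F (Suc i) *\<^sub>v w | w. w \<in> free_mod n (rk F (Suc (Suc i)))})"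
      unfolding nat_split[of ?Q] 2 by (simp only: aug_simps One_nat_def)
    have regroup: "(H \<longleftrightarrow> a \<and> b \<and> c \<and> d) \<Longrightarrow> (a \<and> b \<and> c \<and> d \<and> e \<and> f) \<longleftrightarrow> (H \<and> e \<and> f)" for H a b c d e f
      by blast
    show ?thesis
      unfolding graded_free_resolution_def 1 3 by (rule regroup[OF hom])
  next
    case False
    then show ?thesis unfolding graded_free_resolution_def using hom by argo
  qed
qed

text \<open>
  The span of the monomials with exponent in \<open>P\<close>. It is an ideal if
  \<open>P\<close> is closed under multiples, and every monomial ideal has this form.
\<close>

definition mono_ideal :: "expo set \<Rightarrow> 'k::field mpoly set" where
  "mono_ideal P = {p. keys p \<subseteq> P}"

definition expo_ideal :: "nat \<Rightarrow> expo set \<Rightarrow> bool" where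
  "expo_ideal n P \<longleftrightarrow> P \<subseteq> expos n \<and> (\<forall>b\<in>P. multiples n b \<subseteq> P)"

definition augmented_act :: "nat \<Rightarrow> expo set \<Rightarrow> (nat \<Rightarrow> nat \<Rightarrow> expo) \<Rightarrow> nat \<Rightarrow> nat \<Rightarrow> expo set" where
  "augmented_act n P \<sigma> i j = (case i of 0 \<Rightarrow> P | Suc k \<Rightarrow> multiples n (\<sigma> k j))"

lemma augmented_act_simps [simp]:
  "augmented_act n P \<sigma> 0 j = P" "augmented_act n P \<sigma> (Suc k) j = multiples n (\<sigma> k j)"
  by (simp_all add: augmented_act_def)

lemma strand_augmented:
  assumes "homogeneous_complex n F" "v \<in> free_mod n (aug_rk F (Suc i))"
  shows "strand n (aug_rk F i) (aug_shift F i) b (aug_dmap F i *\<^sub>v v) =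
    lin {..<aug_rk F (Suc i)} (aug_coeffs F i) (strand n (aug_rk F (Suc i)) (aug_shift F (Suc i)) b v)"
  unfolding aug_coeffs_def
  by (rule strand_mult_mat_vec) (use assms in \<open>auto simp: homogeneous_complex_def\<close>)

lemma augmented_free_mod:
  assumes "homogeneous_complex n F" "v \<in> free_mod n (aug_rk F (Suc i))"
  shows "aug_dmap F i *\<^sub>v v \<in> free_mod n (aug_rk F i)"
  using assms homogeneous_mat_free_mod unfolding homogeneous_complex_def by blast

lemma strand_zero [simp]: "strand n r \<sigma> b (0\<^sub>v r) = 0"
  by (auto simp: strand_def fun_eq_iff)

lemma zero_free_mod [simp]: "0\<^sub>v r \<in> free_mod n r"
  by (rule free_modI) auto

text \<open>
  A cycle in one strand is a polynomial vector with a single nonzero strand. Exactness over the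
  polynomial ring provides a preimage, whose component in the same degree is the preimage that
  is sought. The column of the augmentation matrix at a generator lies in the ideal, hence so
  does its degree if the coefficient is nonzero.
\<close>

lemma graded_resolution_strands:
  fixes F :: "(expo, 'k::field mpoly) free_complex"
  assumes P: "expo_ideal n P" and F: "graded_free_resolution n (\<lambda>m. m) F (mono_ideal P)"
  shows "resolution_of n P (\<lambda>i. shift F i ` {..<rk F i}) (\<lambda>i. {..<aug_rk F i})
    (augmented_act n P (shift F)) (shift F) (aug_coeffs F)"
proof -
  let ?st = "\<lambda>i. strand n (aug_rk F i) (aug_shift F i)"
  have hom: "homogeneous_complex n F"
    and im0: "(\<lambda>p. vec 1 (\<lambda>_. p)) ` mono_ideal P = {aug_dmap F 0 *\<^sub>v v | v. v \<in> free_mod n (aug_rk F 1)}"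
    and ker: "\<And>i. {v \<in> free_mod n (aug_rk F (Suc i)). aug_dmap F i *\<^sub>v v = 0\<^sub>v (aug_rk F i)} =
      {aug_dmap F (Suc i) *\<^sub>v w | w. w \<in> free_mod n (aug_rk F (Suc (Suc i)))}"
    using F unfolding graded_free_resolution_iff by blast+
  have hm: "homogeneous_mat n (aug_rk F i) (aug_rk F (Suc i)) (aug_shift F i) (aug_shift F (Suc i)) (aug_dmap F i)" for i
    using hom by (simp add: homogeneous_complex_def)
  interpret E: strand_complex n "\<lambda>i. {..<aug_rk F i}" "augmented_act n P (shift F)" "shift F" "aug_coeffs F"
  proof
    show "multiples n b \<subseteq> augmented_act n P (shift F) 0 x" if "b \<in> augmented_act n P (shift F) 0 x" for b x
      using P that by (simp add: expo_ideal_def)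
    show "y \<in> {..<aug_rk F i} \<and> augmented_act n P (shift F) (Suc i) x \<subseteq> augmented_act n P (shift F) i y"
      if x: "x \<in> {..<aug_rk F (Suc i)}" and nz: "aug_coeffs F i x y \<noteq> 0" for x y i
    proof (cases i)
      case (Suc j)
      show ?thesis
        using mat_coeffs_nonzero[OF hm[of i], of x y] x nz multiples_trans by (auto simp: aug_coeffs_def Suc)
    next
      case 0
      have y: "y = 0" and m: "shift F 0 x \<in> keys (aug_dmap F 0 $$ (0, x))"
        using mat_coeffs_nonzero(1,2)[OF hm[of i], of x y] x nz by (auto simp: aug_coeffs_def 0)
      let ?u = "aug_dmap F 0 *\<^sub>v unit_vec (aug_rk F 1) x"
      have "?u \<in> {aug_dmap F 0 *\<^sub>v v | v. v \<in> free_mod n (aug_rk F 1)}"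
        using strand_unit_vec(1)[of x "aug_rk F 1"] x 0 by auto
      then obtain p where p: "p \<in> mono_ideal P" "?u = vec 1 (\<lambda>_. p)" unfolding im0[symmetric] by blast
      have "aug_dmap F 0 \<in> carrier_mat 1 (aug_rk F 1)" using hm[of 0] by (simp add: homogeneous_mat_def)
      then have "?u $ 0 = (\<Sum>k<aug_rk F 1. aug_dmap F 0 $$ (0, k) * unit_vec (aug_rk F 1) x $ k)"
        by (rule mult_mat_vec_index) simp_all
      also have "\<dots> = (\<Sum>k<aug_rk F 1. if k = x then aug_dmap F 0 $$ (0, k) else 0)"
        by (rule sum.cong) (auto simp: unit_vec_def)
      also have "\<dots> = aug_dmap F 0 $$ (0, x)" using x 0 by simp
      finally have "?u $ 0 = aug_dmap F 0 $$ (0, x)" .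
      then have "p = aug_dmap F 0 $$ (0, x)" unfolding p(2) by simp
      then have "shift F 0 x \<in> P" using m p(1) unfolding mono_ideal_def by blast
      then show ?thesis using P by (simp add: 0 y expo_ideal_def)
    qed
    show "lin {..<aug_rk F (Suc i)} (aug_coeffs F i) (aug_coeffs F (Suc i) x) = 0"
      if x: "x \<in> {..<aug_rk F (Suc (Suc i))}" for x i
    proof -
      let ?e = "unit_vec (aug_rk F (Suc (Suc i))) x"
      have e: "?e \<in> free_mod n (aug_rk F (Suc (Suc i)))"
        "?st (Suc (Suc i)) (aug_shift F (Suc (Suc i)) x) ?e = delta x"
        using strand_unit_vec x by blast+
      have "aug_dmap F (Suc i) *\<^sub>v ?e \<in> {v \<in> free_mod n (aug_rk F (Suc i)). aug_dmap F i *\<^sub>v v = 0\<^sub>v (aug_rk F i)}"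
        unfolding ker using e by blast
      then have u: "aug_dmap F (Suc i) *\<^sub>v ?e \<in> free_mod n (aug_rk F (Suc i))"
        "aug_dmap F i *\<^sub>v (aug_dmap F (Suc i) *\<^sub>v ?e) = 0\<^sub>v (aug_rk F i)" by blast+
      have "?st (Suc i) (aug_shift F (Suc (Suc i)) x) (aug_dmap F (Suc i) *\<^sub>v ?e) = aug_coeffs F (Suc i) x"
        unfolding strand_augmented[OF hom e(1)] e(2) by (rule lin_delta) (use x in auto)
      then show ?thesis using strand_augmented[OF hom u(1), of "aug_shift F (Suc (Suc i)) x"] u(2) by simp
    qed
  qed auto
  interpret E: exact_strand_complex n "\<lambda>i. {..<aug_rk F i}" "augmented_act n P (shift F)" "shift F" "aug_coeffs F"
  proof
    fix v b i assume v: "v \<in> E.chain b i" and cyc: "E.cycle i v"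
    have "\<exists>w\<in>free_mod n (aug_rk F (Suc i)). ?st i b (aug_dmap F i *\<^sub>v w) = v"
    proof (cases i)
      case 0
      have vs: "v j \<noteq> 0 \<Longrightarrow> j = 0 \<and> b \<in> P" for j using v by (auto simp: E.chain_def 0)
      have "single b (v 0) \<in> mono_ideal P" using vs by (auto simp: mono_ideal_def)
      then obtain w where w: "w \<in> free_mod n (aug_rk F 1)" "vec 1 (\<lambda>_. single b (v 0)) = aug_dmap F 0 *\<^sub>v w"
        using im0 by blast
      have "b \<in> P \<Longrightarrow> b \<in> multiples n 0" using P by (auto simp: expo_ideal_def multiples_def)
      then have "?st 0 b (vec 1 (\<lambda>_. single b (v 0))) = v"
        using vs by (auto simp: strand_def fun_eq_iff)
      then show ?thesis using w 0 by auto
    next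
      case (Suc j)
      define W where "W b' = (if b' = b then v else 0)" for b'
      have fin: "finite {b. W b \<noteq> 0}" by (rule finite_subset[of _ "{b}"]) (auto simp: W_def)
      have supp: "W b j' \<noteq> 0 \<Longrightarrow> j' < aug_rk F i \<and> b \<in> multiples n (aug_shift F i j')" for b j'
        using v by (auto simp: W_def E.chain_def Suc split: if_splits)
      from strands_realizable[OF fin supp] obtain u where u: "u \<in> free_mod n (aug_rk F (Suc j))"
        "\<And>b. ?st (Suc j) b u = W b" unfolding Suc by blast
      have "aug_dmap F j *\<^sub>v u = 0\<^sub>v (aug_rk F j)"
      proof (rule strand_eqI[where \<sigma> = "aug_shift F j"])
        show "aug_dmap F j *\<^sub>v u \<in> free_mod n (aug_rk F j)" by (rule augmented_free_mod[OF hom u(1)])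
        show "?st j b' (aug_dmap F j *\<^sub>v u) = ?st j b' (0\<^sub>v (aug_rk F j))" for b'
          unfolding strand_augmented[OF hom u(1)] u(2) using cyc by (simp add: W_def Suc)
      qed simp
      then have "u \<in> {aug_dmap F (Suc j) *\<^sub>v w | w. w \<in> free_mod n (aug_rk F (Suc (Suc j)))}"
        using u(1) ker[of j] by blast
      then obtain w where "w \<in> free_mod n (aug_rk F (Suc (Suc j)))" "u = aug_dmap F (Suc j) *\<^sub>v w" by blast
      then show ?thesis using u(2)[of b] unfolding Suc W_def by auto
    qed
    then obtain w where w: "w \<in> free_mod n (aug_rk F (Suc i))" "?st i b (aug_dmap F i *\<^sub>v w) = v" by blast
    have "?st (Suc i) b w \<in> E.chain b (Suc i)" by (auto simp: E.chain_def strand_def)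
    then show "\<exists>w\<in>E.chain b (Suc i). lin {..<aug_rk F (Suc i)} (aug_coeffs F i) w = v"
      using w(2) unfolding strand_augmented[OF hom w(1)] by blast
  qed
  show ?thesis
    unfolding resolution_of_def using E.exact_strand_complex_axioms by (auto simp: lessThan_Suc)
qed

text \<open>
  Preimages are chosen strand by strand, zero for zero strands; then only finitely many are
  nonzero and they are the strands of one polynomial vector.
\<close>

lemma strands_graded_resolution:
  fixes F :: "(expo, 'k::field mpoly) free_complex"
  assumes P: "expo_ideal n P" and hom: "homogeneous_complex n F"
    and E: "exact_strand_complex n (\<lambda>i. {..<aug_rk F i}) act (shift F) c" and act0: "act 0 0 = P"
    and c: "\<And>i x. x < aug_rk F (Suc i) \<Longrightarrow> c i x = aug_coeffs F i x"
  shows "graded_free_resolution n (\<lambda>m. m) F (mono_ideal P)"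
proof -
  interpret E: exact_strand_complex n "\<lambda>i. {..<aug_rk F i}" act "shift F" c by fact
  let ?st = "\<lambda>i. strand n (aug_rk F i) (aug_shift F i)"
  have lin_c: "lin {..<aug_rk F (Suc i)} (c i) v = lin {..<aug_rk F (Suc i)} (aug_coeffs F i) v" for i v
    by (rule lin_cong) (use c in auto)
  have st: "?st i b (aug_dmap F i *\<^sub>v v) = lin {..<aug_rk F (Suc i)} (c i) (?st (Suc i) b v)"
    if "v \<in> free_mod n (aug_rk F (Suc i))" for i b v
    unfolding lin_c by (rule strand_augmented[OF hom that])
  have ch: "?st (Suc i) b v \<in> E.chain b (Suc i)" for i b v
    by (auto simp: E.chain_def strand_def E.act_Suc)
  have preimage: "\<exists>w\<in>free_mod n (aug_rk F (Suc i)). aug_dmap F i *\<^sub>v w = v"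
    if v: "v \<in> free_mod n (aug_rk F i)" and vch: "\<And>b. ?st i b v \<in> E.chain b i"
      and cyc: "\<And>b. E.cycle i (?st i b v)" for v i
  proof -
    have "\<exists>W. W \<in> E.chain b (Suc i) \<and> lin {..<aug_rk F (Suc i)} (c i) W = ?st i b v \<and> (?st i b v = 0 \<longrightarrow> W = 0)" for b
    proof (cases "?st i b v = 0")
      case True
      then show ?thesis by (intro exI[of _ 0]) simp
    next
      case False
      then show ?thesis using E.exact[OF vch cyc, of b] by blast
    qed
    then obtain W where W: "\<And>b. W b \<in> E.chain b (Suc i)"
      "\<And>b. lin {..<aug_rk F (Suc i)} (c i) (W b) = ?st i b v" "\<And>b. ?st i b v = 0 \<Longrightarrow> W b = 0" by metis
    have fin: "finite {b. W b \<noteq> 0}"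
      by (rule finite_subset[OF _ finite_strands[of n "aug_rk F i" "aug_shift F i" v]]) (use W(3) in blast)
    have supp: "W b j \<noteq> 0 \<Longrightarrow> j < aug_rk F (Suc i) \<and> b \<in> multiples n (aug_shift F (Suc i) j)" for b j
      using W(1)[of b] E.act_Suc[of j i] by (auto simp: E.chain_def)
    from strands_realizable[OF fin supp] obtain w where w: "w \<in> free_mod n (aug_rk F (Suc i))"
      "\<And>b. ?st (Suc i) b w = W b" by blast
    have "aug_dmap F i *\<^sub>v w = v"
      by (rule strand_eqI[where \<sigma> = "aug_shift F i", OF augmented_free_mod[OF hom w(1)] v])
        (simp only: st[OF w(1)] w(2) W(2))
    then show ?thesis using w(1) by blast
  qed
  have im0: "(\<lambda>p. vec 1 (\<lambda>_. p)) ` mono_ideal P = {aug_dmap F 0 *\<^sub>v v | v. v \<in> free_mod n (aug_rk F 1)}"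
  proof (intro equalityI subsetI)
    fix u :: "'k mpoly vec" assume "u \<in> (\<lambda>p. vec 1 (\<lambda>_. p)) ` mono_ideal P"
    then obtain p where u: "u = vec 1 (\<lambda>_. p)" and p: "keys p \<subseteq> P" by (auto simp: mono_ideal_def)
    have "u \<in> free_mod n (aug_rk F 0)"
      by (rule free_modI) (use p P in \<open>auto simp: u expo_ideal_def\<close>)
    moreover have "?st 0 b u \<in> E.chain b 0" for b
      using p act0 by (auto simp: E.chain_def strand_def u in_keys_iff)
    ultimately show "u \<in> {aug_dmap F 0 *\<^sub>v v | v. v \<in> free_mod n (aug_rk F 1)}"
      using preimage[of u 0] by auto
  next
    fix u assume "u \<in> {aug_dmap F 0 *\<^sub>v v | v. v \<in> free_mod n (aug_rk F 1)}"
    then obtain v where u: "u = aug_dmap F 0 *\<^sub>v v" and v: "v \<in> free_mod n (aug_rk F (Suc 0))" by auto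
    have u1: "u \<in> free_mod n 1" using augmented_free_mod[OF hom v] u by simp
    have "keys (u $ 0) \<subseteq> P"
    proof
      fix m assume m: "m \<in> keys (u $ 0)"
      then have "m \<in> expos n" using free_mod_index[OF u1, of 0] by auto
      then have "m \<in> multiples n 0" by (auto simp: multiples_def)
      then have "?st 0 m u 0 \<noteq> 0" using m by (simp add: strand_def in_keys_iff)
      then obtain k where k: "k \<in> {..<aug_rk F (Suc 0)}" "?st (Suc 0) m v k \<noteq> 0" "c 0 k 0 \<noteq> 0"
        unfolding u st[OF v] by (rule lin_nonzero)
      have "m \<in> act (Suc 0) k" using ch[of 0 m v] k(2) unfolding E.chain_def by blast
      then show "m \<in> P" using E.c_supp[OF k(1,3)] act0 by blast
    qed
    moreover have "u = vec 1 (\<lambda>_. u $ 0)" using free_mod_dim[OF u1] by (intro eq_vecI) auto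
    ultimately show "u \<in> (\<lambda>p. vec 1 (\<lambda>_. p)) ` mono_ideal P" unfolding mono_ideal_def by blast
  qed
  have ker: "{v \<in> free_mod n (aug_rk F (Suc i)). aug_dmap F i *\<^sub>v v = 0\<^sub>v (aug_rk F i)} =
      {aug_dmap F (Suc i) *\<^sub>v w | w. w \<in> free_mod n (aug_rk F (Suc (Suc i)))}" for i
  proof (intro equalityI subsetI)
    fix v assume "v \<in> {v \<in> free_mod n (aug_rk F (Suc i)). aug_dmap F i *\<^sub>v v = 0\<^sub>v (aug_rk F i)}"
    then have v: "v \<in> free_mod n (aug_rk F (Suc i))" "aug_dmap F i *\<^sub>v v = 0\<^sub>v (aug_rk F i)" by blast+
    have "E.cycle (Suc i) (?st (Suc i) b v)" for b using st[OF v(1), of b] v(2) by simp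
    from preimage[OF v(1) ch this] show "v \<in> {aug_dmap F (Suc i) *\<^sub>v w | w. w \<in> free_mod n (aug_rk F (Suc (Suc i)))}"
      by blast
  next
    fix v assume "v \<in> {aug_dmap F (Suc i) *\<^sub>v w | w. w \<in> free_mod n (aug_rk F (Suc (Suc i)))}"
    then obtain w where w: "w \<in> free_mod n (aug_rk F (Suc (Suc i)))" and v: "v = aug_dmap F (Suc i) *\<^sub>v w" by blast
    have v1: "v \<in> free_mod n (aug_rk F (Suc i))" unfolding v by (rule augmented_free_mod[OF hom w])
    have "aug_dmap F i *\<^sub>v v = 0\<^sub>v (aug_rk F i)"
    proof (rule strand_eqI[where \<sigma> = "aug_shift F i", OF augmented_free_mod[OF hom v1]])
      show "?st i b (aug_dmap F i *\<^sub>v v) = ?st i b (0\<^sub>v (aug_rk F i))" for b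
        unfolding st[OF v1] unfolding v st[OF w] using E.d_d[OF ch] by simp
    qed simp
    then show "v \<in> {v \<in> free_mod n (aug_rk F (Suc i)). aug_dmap F i *\<^sub>v v = 0\<^sub>v (aug_rk F i)}" using v1 by blast
  qed
  show ?thesis unfolding graded_free_resolution_iff using hom im0 ker by blast
qed

lemma resolution_realizable:
  fixes c :: "nat \<Rightarrow> nat \<Rightarrow> nat \<Rightarrow> 'k::field"
  assumes P: "expo_ideal n P" and R: "resolution_of n P D (\<lambda>i. {..<r i}) act s c"
  obtains F :: "(expo, 'k mpoly) free_complex"
    where "graded_free_resolution n (\<lambda>m. m) F (mono_ideal P)" "\<And>i. shift F i ` {..<rk F i} = D i"
proof -
  interpret E: exact_strand_complex n "\<lambda>i. {..<r i}" act s c using R by (simp add: resolution_of_def)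
  obtain x0 where x0: "{..<r 0} = {x0}" "act 0 x0 = P" using R by (auto simp: resolution_of_def)
  have r0: "r 0 = 1" using arg_cong[OF x0(1), of card] by simp
  then have x00: "x0 = 0" using x0(1) by auto
  define F :: "(expo, 'k mpoly) free_complex" where
    "F = \<lparr> rk = (\<lambda>i. r (Suc i)), shift = s, aug = vec (r 1) (\<lambda>k. single (s 0 k) (c 0 k 0)),
      dmap = (\<lambda>i. mat (r (Suc i)) (r (Suc (Suc i))) (\<lambda>(j, k). single (s (Suc i) k - s i j) (c (Suc i) k j))) \<rparr>"
  have rk: "aug_rk F i = r i" for i by (cases i) (simp_all add: F_def r0)
  have sh: "shift F = s" by (simp add: F_def)
  have dm: "aug_dmap F i = mat (r i) (r (Suc i)) (\<lambda>(j, k). single (s i k - aug_shift F i j) (c i k j))" for i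
    by (cases i) (auto simp: F_def mat_of_row_def r0)
  have div: "s i k \<in> multiples n (aug_shift F i j)" if k: "k < r (Suc i)" and nz: "c i k j \<noteq> 0" for i j k
  proof -
    from k nz E.c_supp[of k i j] have j: "j < r i" "act (Suc i) k \<subseteq> act i j" by auto
    have "s i k \<in> act i j" using E.s_in_act[of k i] k j(2) by auto
    then show ?thesis
    proof (cases i)
      case 0
      then have "s i k \<in> expos n"
        using j x0 x00 r0 P \<open>s i k \<in> act i j\<close> by (auto simp: expo_ideal_def)
      then show ?thesis by (simp add: 0 multiples_def)
    next
      case (Suc i')
      then show ?thesis using E.act_Suc[of j i'] j(1) \<open>s i k \<in> act i j\<close> by (simp add: sh)
    qed
  qed
  have hom: "homogeneous_complex n F"
    unfolding homogeneous_complex_def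
  proof
    fix i
    have "s i k - aug_shift F i j \<in> expos n \<and> (s i k - aug_shift F i j) + aug_shift F i j = s i k"
      if "k < r (Suc i)" "c i k j \<noteq> 0" for j k
      using div[OF that] by (auto simp: multiples_def add.commute)
    then show "homogeneous_mat n (aug_rk F i) (aug_rk F (Suc i)) (aug_shift F i) (aug_shift F (Suc i)) (aug_dmap F i)"
      unfolding homogeneous_mat_def dm rk by (auto simp: sh split: if_splits)
  qed
  have coeffs: "c i x = aug_coeffs F i x" if x: "x < aug_rk F (Suc i)" for i x
  proof
    fix j
    have x': "x < r (Suc i)" using x unfolding rk .
    show "c i x j = aug_coeffs F i x j"
    proof (cases "j < r i")
      case True
      with x' show ?thesis unfolding aug_coeffs_def mat_coeffs_def dm rk by (simp add: sh)
    next
      case False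
      then show ?thesis using x' E.c_supp[of x i j] by (auto simp: aug_coeffs_def mat_coeffs_def rk)
    qed
  qed
  have "graded_free_resolution n (\<lambda>m. m) F (mono_ideal P)"
    by (rule strands_graded_resolution[OF P hom _ _ coeffs, where act = act])
      (use E.exact_strand_complex_axioms x0 x00 in \<open>simp_all add: rk sh\<close>)
  moreover have "shift F i ` {..<rk F i} = D i" for i
    using R by (simp add: resolution_of_def F_def)
  ultimately show ?thesis by (rule that)
qed


section \<open>Tor and linear resolutions\<close>

text \<open>
  Tensoring with \<open>K\<close> keeps the constant terms, and these are the scalars between
  generators of equal degree.
\<close>

lemma tensorK_mult_index:
  fixes F :: "(expo, 'k::field mpoly) free_complex"
  assumes hom: "homogeneous_complex n F" and j: "j < rk F i" and w: "w \<in> tensorK_part F (Suc i) a"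
  shows "(tensorK_dmap F i *\<^sub>v w) $ j =
    (if shift F i j = a
     then lin {..<rk F (Suc i)} (aug_coeffs F (Suc i)) (\<lambda>k. if k < rk F (Suc i) then w $ k else 0) j else 0)"
proof -
  have M: "homogeneous_mat n (rk F i) (rk F (Suc i)) (shift F i) (shift F (Suc i)) (dmap F i)"
    using hom unfolding homogeneous_complex_def by (metis aug_simps(2,4,6))
  then have Mc: "dmap F i \<in> carrier_mat (rk F i) (rk F (Suc i))" by (simp add: homogeneous_mat_def)
  then have Tc: "tensorK_dmap F i \<in> carrier_mat (rk F i) (rk F (Suc i))" by (simp add: tensorK_dmap_def)
  have wc: "w \<in> carrier_vec (rk F (Suc i))" using w by (simp add: tensorK_part_def)
  have entry: "tensorK_dmap F i $$ (j, k) * w $ k = (if shift F i j = a then w $ k * aug_coeffs F (Suc i) k j else 0)"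
    if k: "k < rk F (Suc i)" for k
  proof (cases "w $ k = 0")
    case False
    then have a: "shift F (Suc i) k = a" using w k by (simp add: tensorK_part_def)
    have T: "tensorK_dmap F i $$ (j, k) = lookup (dmap F i $$ (j, k)) 0"
      using Mc j k by (simp add: tensorK_dmap_def)
    show ?thesis
    proof (cases "shift F i j = a")
      case True
      then show ?thesis using j a by (simp add: T aug_coeffs_def mat_coeffs_def)
    next
      case ne: False
      have "0 \<notin> keys (dmap F i $$ (j, k))"
        using M j k ne a unfolding homogeneous_mat_def by (metis add_0)
      then show ?thesis using ne by (simp add: T in_keys_iff)
    qed
  qed simp
  show ?thesis
    unfolding mult_mat_vec_index[OF Tc wc j]
    by (cases "shift F i j = a") (auto simp: entry lin_def intro!: sum.cong sum.neutral)
qed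

lemma tensorK_mult_part:
  fixes F :: "(expo, 'k::field mpoly) free_complex"
  assumes hom: "homogeneous_complex n F" and w: "w \<in> tensorK_part F (Suc i) a"
  shows "tensorK_dmap F i *\<^sub>v w \<in> tensorK_part F i a"
proof -
  have "homogeneous_mat n (rk F i) (rk F (Suc i)) (shift F i) (shift F (Suc i)) (dmap F i)"
    using hom unfolding homogeneous_complex_def by (metis aug_simps(2,4,6))
  then have "dmap F i \<in> carrier_mat (rk F i) (rk F (Suc i))" unfolding homogeneous_mat_def by blast
  then have "dim_vec (tensorK_dmap F i *\<^sub>v w) = rk F i" by (simp add: tensorK_dmap_def)
  then show ?thesis
    unfolding tensorK_part_def
  proof (intro CollectI conjI allI impI)
    fix j assume "j < rk F i" "(tensorK_dmap F i *\<^sub>v w) $ j \<noteq> 0"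
    then show "shift F i j = a" unfolding tensorK_mult_index[OF hom \<open>j < rk F i\<close> w] by (simp split: if_splits)
  qed (rule carrier_vecI)
qed

text \<open>
  The vanishing of Tor, transferred to the complex \<open>K \<otimes> F\<close>. That boundaries
  are cycles holds because a composite between generators of degree \<open>a\<close> passes only
  through generators of degree \<open>a\<close>.
\<close>

lemma tensorK_cycles_eq_boundaries:
  fixes F :: "(expo, 'k::field mpoly) free_complex" and c' :: "nat \<Rightarrow> 'y \<Rightarrow> 'y \<Rightarrow> 'k"
  assumes P: "expo_ideal n P" and F: "graded_free_resolution n (\<lambda>m. m) F (mono_ideal P)"
    and G: "resolution_of n P D B' act' s' c'" and a: "a \<notin> D i"
  shows "tensorK_cycles F i a = tensorK_boundaries F i a"
proof -
  have X: "resolution_of n P (\<lambda>i. shift F i ` {..<rk F i}) (\<lambda>i. {..<aug_rk F i})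
    (augmented_act n P (shift F)) (shift F) (aug_coeffs F)"
    by (rule graded_resolution_strands[OF P F])
  interpret E: exact_strand_complex n "\<lambda>i. {..<aug_rk F i}" "augmented_act n P (shift F)" "shift F" "aug_coeffs F"
    using X by (simp add: resolution_of_def)
  have hom: "homogeneous_complex n F" using F unfolding graded_free_resolution_iff by blast
  define fn where "fn i v = (\<lambda>k. if k < rk F i then v $ k else 0)" for i and v :: "'k vec"
  have T: "(tensorK_dmap F i *\<^sub>v w) $ j =
      (if shift F i j = a then lin {..<rk F (Suc i)} (aug_coeffs F (Suc i)) (fn (Suc i) w) j else 0)"
    if "j < rk F i" "w \<in> tensorK_part F (Suc i) a" for i j w
    unfolding fn_def by (rule tensorK_mult_index[OF hom that])
  have dimT: "dim_vec (tensorK_dmap F i *\<^sub>v w) = rk F i" if "w \<in> tensorK_part F (Suc i) a" for i w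
    using tensorK_mult_part[OF hom that] unfolding tensorK_part_def by (blast intro: carrier_vecD)
  have fn_part: "fn i v x \<noteq> 0 \<Longrightarrow> x < rk F i \<and> shift F i x = a" if "v \<in> tensorK_part F i a" for i v x
    using that by (auto simp: fn_def tensorK_part_def split: if_splits)
  show ?thesis
  proof (intro equalityI subsetI)
    fix v assume v: "v \<in> tensorK_cycles F i a"
    then have vp: "v \<in> tensorK_part F i a" by (simp add: tensorK_cycles_def)
    have cyc: "lin {..<aug_rk F (Suc i)} (aug_coeffs F i) (fn i v) y = 0"
      if "i = Suc j" "y \<in> {..<aug_rk F i}" "shift F j y = a" for j y
      using v T[of y j v] vp that by (simp add: tensorK_cycles_def)
    have "\<exists>w. (\<forall>x. w x \<noteq> 0 \<longrightarrow> x \<in> {..<aug_rk F (Suc (Suc i))} \<and> shift F (Suc i) x = a) \<and>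
        (\<forall>y\<in>{..<aug_rk F (Suc i)}. shift F i y = a \<longrightarrow>
          lin {..<aug_rk F (Suc (Suc i))} (aug_coeffs F (Suc i)) w y = fn i v y)"
    proof (rule exact_degree_part_acyclic[OF X G a])
      show "x \<in> {..<aug_rk F (Suc i)} \<and> shift F i x = a" if "fn i v x \<noteq> 0" for x
        using fn_part[OF vp that] by simp
    qed (rule cyc)
    then obtain w where w: "\<And>x. w x \<noteq> 0 \<Longrightarrow> x \<in> {..<aug_rk F (Suc (Suc i))} \<and> shift F (Suc i) x = a"
      "\<And>y. y \<in> {..<aug_rk F (Suc i)} \<Longrightarrow> shift F i y = a \<Longrightarrow>
        lin {..<aug_rk F (Suc (Suc i))} (aug_coeffs F (Suc i)) w y = fn i v y" by blast
    define W where "W = vec (rk F (Suc i)) w"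
    have Wp: "W \<in> tensorK_part F (Suc i) a" using w(1) by (auto simp: W_def tensorK_part_def)
    have fnW: "fn (Suc i) W = w" using w(1) by (auto simp: fn_def W_def fun_eq_iff)
    have "v = tensorK_dmap F i *\<^sub>v W"
    proof (rule eq_vecI)
      show "dim_vec v = dim_vec (tensorK_dmap F i *\<^sub>v W)" using dimT[OF Wp] vp by (auto simp: tensorK_part_def)
      fix y assume "y < dim_vec (tensorK_dmap F i *\<^sub>v W)"
      then have y: "y < rk F i" using dimT[OF Wp] by simp
      show "v $ y = (tensorK_dmap F i *\<^sub>v W) $ y"
      proof (cases "shift F i y = a")
        case True
        moreover have "fn i v y = v $ y" using y by (simp add: fn_def)
        ultimately show ?thesis using w(2)[of y] y by (simp add: T[OF y Wp] fnW)
      next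
        case False
        then show ?thesis using y vp by (auto simp: T[OF y Wp] tensorK_part_def)
      qed
    qed
    then show "v \<in> tensorK_boundaries F i a" using Wp by (auto simp: tensorK_boundaries_def)
  next
    fix v assume "v \<in> tensorK_boundaries F i a"
    then obtain w where w: "w \<in> tensorK_part F (Suc i) a" and v: "v = tensorK_dmap F i *\<^sub>v w"
      by (auto simp: tensorK_boundaries_def)
    have vp: "v \<in> tensorK_part F i a" unfolding v by (rule tensorK_mult_part[OF hom w])
    have "tensorK_dmap F j *\<^sub>v v = 0\<^sub>v (rk F j)" if i: "i = Suc j" for j
    proof (rule eq_vecI)
      have vp': "v \<in> tensorK_part F (Suc j) a" using vp i by simp
      show "dim_vec (tensorK_dmap F j *\<^sub>v v) = dim_vec (0\<^sub>v (rk F j))" using dimT[OF vp'] by simp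
      fix l assume "l < dim_vec (0\<^sub>v (rk F j))"
      then have l: "l < rk F j" by simp
      have "lin {..<rk F i} (aug_coeffs F i) (fn i v) l = 0" if la: "shift F j l = a"
      proof -
        have ch: "fn (Suc i) w \<in> E.chain a (Suc (Suc i))"
          using fn_part[OF w] by (auto simp: E.chain_def)
        have "lin {..<rk F i} (aug_coeffs F i) (fn i v) l =
            lin {..<rk F i} (aug_coeffs F i) (lin {..<rk F (Suc i)} (aug_coeffs F (Suc i)) (fn (Suc i) w)) l"
          unfolding lin_def[of "{..<rk F i}"]
        proof (rule sum.cong[OF refl])
          fix y assume "y \<in> {..<rk F i}"
          then have y: "y < rk F i" by simp
          let ?d = "lin {..<rk F (Suc i)} (aug_coeffs F (Suc i)) (fn (Suc i) w)"
          have "shift F i y = a" if nz: "?d y \<noteq> 0" "aug_coeffs F i y l \<noteq> 0"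
          proof -
            have "?d \<in> E.chain a (Suc i)" using E.d_chain[OF ch] by simp
            then have "a \<in> multiples n (shift F i y)" using nz(1) by (auto simp: E.chain_def)
            moreover have "multiples n (shift F i y) \<subseteq> multiples n a"
              using E.c_supp[of y i l] y nz(2) i la by auto
            ultimately show ?thesis using multiples_antisym multiples_subset_iff by blast
          qed
          then show "fn i v y * aug_coeffs F i y l = ?d y * aug_coeffs F i y l"
            using y T[OF y w] by (auto simp: fn_def v)
        qed
        also have "\<dots> = 0" using E.d_d[OF ch] by (simp add: fun_eq_iff)
        finally show ?thesis .
      qed
      then show "(tensorK_dmap F j *\<^sub>v v) $ l = 0\<^sub>v (rk F j) $ l"
        using l T[OF l vp'] i by auto
    qed
    then show "v \<in> tensorK_cycles F i a" using vp by (auto simp: tensorK_cycles_def split: nat.split)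
  qed
qed

text \<open>
  If consecutive positions share no degree, all differentials of \<open>K \<otimes> F\<close>
  vanish, so each degree that occurs supports homology. No other degree does, whichever
  resolution is used.
\<close>

lemma Tor_nonzero_iff:
  fixes c :: "nat \<Rightarrow> nat \<Rightarrow> nat \<Rightarrow> 'k::field"
  assumes P: "expo_ideal n P" and R: "resolution_of n P D (\<lambda>i. {..<r i}) act s c"
    and minimal: "\<And>i. D i \<inter> D (Suc i) = {}"
  shows "Tor_nonzero n i (mono_ideal P :: 'k mpoly set) a \<longleftrightarrow> a \<in> D i"
proof
  assume "Tor_nonzero n i (mono_ideal P :: 'k mpoly set) a"
  then show "a \<in> D i"
    unfolding Tor_nonzero_def using tensorK_cycles_eq_boundaries[OF P _ R] by blast
next
  assume a: "a \<in> D i"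
  obtain F :: "(expo, 'k mpoly) free_complex" where F: "graded_free_resolution n (\<lambda>m. m) F (mono_ideal P)"
    and D: "\<And>i. shift F i ` {..<rk F i} = D i"
    using resolution_realizable[OF P R] by blast
  have hom: "homogeneous_complex n F" using F unfolding graded_free_resolution_iff by blast
  have "a \<in> shift F i ` {..<rk F i}" using a D by simp
  then obtain x where x: "x < rk F i" "shift F i x = a" by blast
  let ?e = "unit_vec (rk F i) x :: 'k vec"
  have e: "?e \<in> tensorK_part F i a"
    using x by (auto simp: tensorK_part_def unit_vec_def)
  have "tensorK_dmap F j *\<^sub>v ?e = 0\<^sub>v (rk F j)" if i: "i = Suc j" for j
  proof (rule eq_vecI)
    have e': "?e \<in> tensorK_part F (Suc j) a" using e i by simp
    show "dim_vec (tensorK_dmap F j *\<^sub>v ?e) = dim_vec (0\<^sub>v (rk F j))"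
      using tensorK_mult_part[OF hom e'] carrier_vecD unfolding tensorK_part_def by fastforce
    fix l assume "l < dim_vec (0\<^sub>v (rk F j))"
    then have l: "l < rk F j" by simp
    then have "shift F j l \<noteq> a" using minimal[of j] D[of j] a i by blast
    then show "(tensorK_dmap F j *\<^sub>v ?e) $ l = 0\<^sub>v (rk F j) $ l"
      using l tensorK_mult_index[OF hom l e'] by simp
  qed
  then have "?e \<in> tensorK_cycles F i a" using e by (auto simp: tensorK_cycles_def split: nat.split)
  moreover have "?e \<notin> tensorK_boundaries F i a"
  proof
    assume "?e \<in> tensorK_boundaries F i a"
    then obtain w where w: "w \<in> tensorK_part F (Suc i) a" "?e = tensorK_dmap F i *\<^sub>v w"
      by (auto simp: tensorK_boundaries_def)
    have "w $ k = 0" if "k < rk F (Suc i)" for k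
      using w(1) that minimal[of i] D[of "Suc i"] a unfolding tensorK_part_def by blast
    then have "(\<lambda>k. if k < rk F (Suc i) then w $ k else 0) = 0" by (auto simp: fun_eq_iff)
    then have "?e $ x = 0" unfolding w(2) tensorK_mult_index[OF hom x(1) w(1)] by simp
    then show False using x(1) by simp
  qed
  ultimately show "Tor_nonzero n i (mono_ideal P :: 'k mpoly set) a"
    unfolding Tor_nonzero_def using F by blast
qed

lemma total_degree_eq:
  assumes "finite S" "keys a \<subseteq> S"
  shows "total_degree a = (\<Sum>i\<in>S. lookup a i)"
  unfolding total_degree_def using assms by (intro sum.mono_neutral_left) (auto simp: in_keys_iff)

lemma total_degree_add: "total_degree (a + b) = total_degree a + total_degree b"
proof -
  have "keys (a + b) \<subseteq> keys a \<union> keys b" by (rule keys_add)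
  then show ?thesis
    by (simp add: total_degree_eq[of "keys a \<union> keys b"] lookup_add sum.distrib)
qed

lemma graded_free_resolution_total_degree:
  assumes F: "graded_free_resolution n (\<lambda>m. m) F I"
  shows "graded_free_resolution n total_degree
    \<lparr>rk = rk F, shift = (\<lambda>i j. total_degree (shift F i j)), aug = aug F, dmap = dmap F\<rparr> I"
proof -
  have 1: "\<forall>k<rk F 0. \<forall>m\<in>keys (aug F $ k). m = shift F 0 k"
    and 2: "\<forall>i. \<forall>j<rk F i. \<forall>k<rk F (Suc i). \<forall>m\<in>keys (dmap F i $$ (j, k)). m + shift F i j = shift F (Suc i) k"
    using F unfolding graded_free_resolution_def by argo+
  have 3: "\<forall>k<rk F 0. \<forall>m\<in>keys (aug F $ k). total_degree m = total_degree (shift F 0 k)"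
  proof (intro allI impI ballI)
    fix k m assume "k < rk F 0" "m \<in> keys (aug F $ k)"
    then have "m = shift F 0 k" using 1 by blast
    then show "total_degree m = total_degree (shift F 0 k)" by (rule arg_cong)
  qed
  have 4: "\<forall>i. \<forall>j<rk F i. \<forall>k<rk F (Suc i). \<forall>m\<in>keys (dmap F i $$ (j, k)).
      total_degree m + total_degree (shift F i j) = total_degree (shift F (Suc i) k)"
  proof (intro allI impI ballI)
    fix i j k m assume "j < rk F i" "k < rk F (Suc i)" "m \<in> keys (dmap F i $$ (j, k))"
    then have "m + shift F i j = shift F (Suc i) k" using 2 by blast
    then show "total_degree m + total_degree (shift F i j) = total_degree (shift F (Suc i) k)"
      unfolding total_degree_add[symmetric] by (rule arg_cong)
  qed
  show ?thesis
    using F 3 4 unfolding graded_free_resolution_def free_complex.simps by argo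
qed

text \<open>
  A multigraded resolution is also a resolution for the standard grading, with shifts replaced
  by their total degrees.
\<close>

lemma linear_resolutionI:
  fixes c :: "nat \<Rightarrow> nat \<Rightarrow> nat \<Rightarrow> 'k::field"
  assumes P: "expo_ideal n P" and R: "resolution_of n P D (\<lambda>i. {..<r i}) act s c"
    and deg: "\<And>i a. a \<in> D i \<Longrightarrow> total_degree a = d + i"
  shows "has_linear_resolution n (mono_ideal P :: 'k mpoly set)"
proof -
  obtain F :: "(expo, 'k mpoly) free_complex" where F: "graded_free_resolution n (\<lambda>m. m) F (mono_ideal P)"
    and D: "\<And>i. shift F i ` {..<rk F i} = D i"
    using resolution_realizable[OF P R] by blast
  have "total_degree (shift F i j) = d + i" if "j < rk F i" for i j
    by (rule deg) (use D[of i] that in blast)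
  then show ?thesis
    unfolding has_linear_resolution_def using graded_free_resolution_total_degree[OF F]
    by (intro exI[of _ d]
        exI[of _ "\<lparr>rk = rk F, shift = (\<lambda>i j. total_degree (shift F i j)), aug = aug F, dmap = dmap F\<rparr>"]) simp
qed

section \<open>Monomial ideals\<close>

definition generated_expos :: "nat \<Rightarrow> expo set \<Rightarrow> expo set" where
  "generated_expos n A = (\<Union>a\<in>A. multiples n a)"

lemma generated_expo_ideal:
  assumes "A \<subseteq> expos n"
  shows "expo_ideal n (generated_expos n A)"
  unfolding expo_ideal_def
proof (intro conjI ballI)
  show "generated_expos n A \<subseteq> expos n"
    using assms plus_in_expos unfolding generated_expos_def multiples_def by blast
  fix b assume "b \<in> generated_expos n A"
  then show "multiples n b \<subseteq> generated_expos n A"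
    using multiples_trans unfolding generated_expos_def by blast
qed

lemma poly_ring_ring: "ring (poly_ring n :: 'k::field mpoly ring)"
  using poly_ring_cring by (rule cring.axioms(1))

lemma mono_ideal_ideal:
  assumes P: "expo_ideal n P"
  shows "ideal (mono_ideal P :: 'k::field mpoly set) (poly_ring n)"
proof (rule idealI[OF poly_ring_ring])
  interpret R: ring "poly_ring n :: 'k mpoly ring" by (rule poly_ring_ring)
  have sub: "P \<subseteq> expos n" using P by (simp add: expo_ideal_def)
  show "subgroup (mono_ideal P :: 'k mpoly set) (add_monoid (poly_ring n))"
  proof (rule R.add.subgroupI)
    show "(mono_ideal P :: 'k mpoly set) \<subseteq> carrier (poly_ring n)"
      using sub by (auto simp: mono_ideal_def)
    have "(0 :: 'k mpoly) \<in> mono_ideal P" by (simp add: mono_ideal_def)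
    then show "(mono_ideal P :: 'k mpoly set) \<noteq> {}" by blast
  next
    fix p :: "'k mpoly" assume p: "p \<in> mono_ideal P"
    have "keys p \<subseteq> expos n" using p sub by (auto simp: mono_ideal_def)
    then have "\<ominus>\<^bsub>poly_ring n\<^esub> p = - p" by (intro R.minus_equality) (auto simp: in_keys_iff subset_iff)
    moreover have "- p \<in> mono_ideal P" using p by (auto simp: mono_ideal_def in_keys_iff subset_iff)
    ultimately show "\<ominus>\<^bsub>poly_ring n\<^esub> p \<in> mono_ideal P" by simp
  next
    fix p q :: "'k mpoly" assume "p \<in> mono_ideal P" "q \<in> mono_ideal P"
    then show "p \<oplus>\<^bsub>poly_ring n\<^esub> q \<in> mono_ideal P"
      using keys_add[of p q] by (auto simp: mono_ideal_def)
  qed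
next
  fix p x :: "'k mpoly" assume p: "p \<in> mono_ideal P" and x: "x \<in> carrier (poly_ring n)"
  have "keys (p * x) \<subseteq> P"
  proof
    fix m assume "m \<in> keys (p * x)"
    then obtain a b where "m = a + b" "a \<in> keys p" "b \<in> keys x" using keys_mult by blast
    then have "m \<in> multiples n a" "a \<in> P" using p x by (auto simp: multiples_def mono_ideal_def)
    then show "m \<in> P" using P unfolding expo_ideal_def by blast
  qed
  then show "p \<otimes>\<^bsub>poly_ring n\<^esub> x \<in> mono_ideal P" "x \<otimes>\<^bsub>poly_ring n\<^esub> p \<in> mono_ideal P"
    by (simp_all add: mono_ideal_def mult.commute)
qed

lemma sum_of_terms: "(\<Sum>m\<in>keys p. single m (lookup p m)) = p"
  by (rule poly_mapping_eqI) (auto simp: lookup_sum lookup_single when_def in_keys_iff)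

text \<open>
  Membership in an ideal may be tested on single terms; with this, equalities of monomial ideals
  become equalities of exponent sets.
\<close>

lemma ideal_of_terms:
  fixes p :: "'k::field mpoly"
  assumes J: "ideal J (poly_ring n)" and terms: "\<And>m. m \<in> keys p \<Longrightarrow> single m (lookup p m) \<in> J"
  shows "p \<in> J"
proof -
  interpret J: ideal J "poly_ring n" by fact
  have "(\<Sum>m\<in>S. single m (lookup p m)) \<in> J" if "S \<subseteq> keys p" for S
    using finite_subset[OF that finite_keys] that
  proof (induction S)
    case empty
    show ?case using additive_subgroup.zero_closed[OF ideal.axioms(1)[OF J]] by simp
  next
    case (insert m S)
    then have "single m (lookup p m) \<oplus>\<^bsub>poly_ring n\<^esub> (\<Sum>m\<in>S. single m (lookup p m)) \<in> J"
      using terms by (intro additive_subgroup.a_closed[OF ideal.axioms(1)[OF J]]) auto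
    then show ?case using insert.hyps by simp
  qed
  from this[OF subset_refl] show ?thesis by (simp only: sum_of_terms)
qed

lemma genideal_xpow:
  assumes A: "A \<subseteq> expos n"
  shows "genideal (poly_ring n) (xpow ` A) = (mono_ideal (generated_expos n A) :: 'k::field mpoly set)"
proof
  interpret R: ring "poly_ring n :: 'k mpoly ring" by (rule poly_ring_ring)
  have carr: "(xpow ` A :: 'k mpoly set) \<subseteq> carrier (poly_ring n)" using A by (auto simp: xpow_def)
  show "genideal (poly_ring n) (xpow ` A) \<subseteq> (mono_ideal (generated_expos n A) :: 'k mpoly set)"
  proof (rule R.genideal_minimal)
    show "ideal (mono_ideal (generated_expos n A) :: 'k mpoly set) (poly_ring n)"
      by (rule mono_ideal_ideal[OF generated_expo_ideal[OF A]])
    show "xpow ` A \<subseteq> (mono_ideal (generated_expos n A) :: 'k mpoly set)"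
      by (auto simp: xpow_def mono_ideal_def generated_expos_def)
  qed
  interpret J: ideal "genideal (poly_ring n) (xpow ` A :: 'k mpoly set)" "poly_ring n"
    by (rule R.genideal_ideal[OF carr])
  show "(mono_ideal (generated_expos n A) :: 'k mpoly set) \<subseteq> genideal (poly_ring n) (xpow ` A)"
  proof
    fix p :: "'k mpoly" assume p: "p \<in> mono_ideal (generated_expos n A)"
    show "p \<in> genideal (poly_ring n) (xpow ` A)"
    proof (rule ideal_of_terms[OF J.ideal_axioms])
      fix m assume "m \<in> keys p"
      then obtain a r where a: "a \<in> A" and r: "r \<in> expos n" and m: "m = a + r"
        using p unfolding mono_ideal_def generated_expos_def multiples_def by blast
      have "xpow a \<otimes>\<^bsub>poly_ring n\<^esub> single r (lookup p m) \<in> genideal (poly_ring n) (xpow ` A)"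
      proof (rule J.I_r_closed)
        show "xpow a \<in> genideal (poly_ring n) (xpow ` A :: 'k mpoly set)" using R.genideal_self[OF carr] a by blast
      qed (use r in auto)
      then show "single m (lookup p m) \<in> genideal (poly_ring n) (xpow ` A)"
        by (simp add: xpow_def mult_single m)
    qed
  qed
qed

lemma ideal_prod_mono_ideal:
  assumes P: "expo_ideal n P" and Q: "expo_ideal n Q"
  shows "ideal_prod (poly_ring n) (mono_ideal P) (mono_ideal Q) =
    (mono_ideal {a + b | a b. a \<in> P \<and> b \<in> Q} :: 'k::field mpoly set)"
proof
  interpret R: ring "poly_ring n :: 'k mpoly ring" by (rule poly_ring_ring)
  show "ideal_prod (poly_ring n) (mono_ideal P) (mono_ideal Q) \<subseteq>
    (mono_ideal {a + b | a b. a \<in> P \<and> b \<in> Q} :: 'k mpoly set)"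
  proof
    fix x :: "'k mpoly" assume "x \<in> ideal_prod (poly_ring n) (mono_ideal P) (mono_ideal Q)"
    then show "x \<in> mono_ideal {a + b | a b. a \<in> P \<and> b \<in> Q}"
    proof induction
      case (prod p q)
      have "keys (p * q) \<subseteq> {a + b | a b. a \<in> P \<and> b \<in> Q}"
        using keys_mult[of p q] prod unfolding mono_ideal_def by blast
      then show ?case by (simp add: mono_ideal_def)
    next
      case (sum p q)
      then show ?case using keys_add[of p q] unfolding mono_ideal_def by simp blast
    qed
  qed
  have id: "ideal (ideal_prod (poly_ring n) (mono_ideal P) (mono_ideal Q :: 'k mpoly set)) (poly_ring n)"
    by (rule R.ideal_prod_is_ideal[OF mono_ideal_ideal[OF P] mono_ideal_ideal[OF Q]])
  show "(mono_ideal {a + b | a b. a \<in> P \<and> b \<in> Q} :: 'k mpoly set) \<subseteq>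
    ideal_prod (poly_ring n) (mono_ideal P) (mono_ideal Q)"
  proof
    fix p :: "'k mpoly" assume p: "p \<in> mono_ideal {a + b | a b. a \<in> P \<and> b \<in> Q}"
    show "p \<in> ideal_prod (poly_ring n) (mono_ideal P) (mono_ideal Q)"
    proof (rule ideal_of_terms[OF id])
      fix m assume "m \<in> keys p"
      then obtain a b where m: "m = a + b" "a \<in> P" "b \<in> Q" using p unfolding mono_ideal_def by blast
      then have "single a (lookup p m) \<otimes>\<^bsub>poly_ring n\<^esub> single b 1 \<in> ideal_prod (poly_ring n) (mono_ideal P) (mono_ideal Q)"
        by (intro ideal_prod.prod) (auto simp: mono_ideal_def)
      then show "single m (lookup p m) \<in> ideal_prod (poly_ring n) (mono_ideal P) (mono_ideal Q)"
        by (simp add: mult_single m(1))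
    qed
  qed
qed

lemma generated_expos_add:
  assumes "A \<subseteq> expos n" "B \<subseteq> expos n"
  shows "{a + b | a b. a \<in> generated_expos n A \<and> b \<in> generated_expos n B} =
    generated_expos n {a + b | a b. a \<in> A \<and> b \<in> B}"
proof (intro equalityI subsetI)
  fix x assume "x \<in> {a + b | a b. a \<in> generated_expos n A \<and> b \<in> generated_expos n B}"
  then obtain a b q r where x: "x = (a + q) + (b + r)" and ab: "a \<in> A" "b \<in> B" and qr: "q \<in> expos n" "r \<in> expos n"
    unfolding generated_expos_def multiples_def by blast
  have "x = (a + b) + (q + r)" unfolding x by (simp add: add_ac)
  then have "x \<in> multiples n (a + b)" using plus_in_expos[OF qr] unfolding multiples_def by blast
  then show "x \<in> generated_expos n {a + b | a b. a \<in> A \<and> b \<in> B}"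
    using ab unfolding generated_expos_def by blast
next
  fix x assume "x \<in> generated_expos n {a + b | a b. a \<in> A \<and> b \<in> B}"
  then obtain a b r where x: "x = (a + b) + r" and ab: "a \<in> A" "b \<in> B" and r: "r \<in> expos n"
    unfolding generated_expos_def multiples_def by blast
  have "x = a + (b + r)" unfolding x by (simp add: add_ac)
  moreover have "a \<in> generated_expos n A" using ab multiples_self unfolding generated_expos_def by blast
  moreover have "b + r \<in> generated_expos n B" using ab r unfolding generated_expos_def multiples_def by blast
  ultimately show "x \<in> {a + b | a b. a \<in> generated_expos n A \<and> b \<in> generated_expos n B}" by blast
qed

lemma ideal_power_mono_ideal:
  assumes A: "\<And>k. A k \<subseteq> expos n" and A0: "A 0 = {0}"
    and step: "\<And>k. A (Suc k) = {a + b | a b. a \<in> A k \<and> b \<in> A 1}"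
  shows "ideal_power n (mono_ideal (generated_expos n (A 1)) :: 'k::field mpoly set) k =
    mono_ideal (generated_expos n (A k))"
proof (induction k)
  case 0
  have "ideal_power n (mono_ideal (generated_expos n (A 1)) :: 'k mpoly set) 0 = carrier (poly_ring n)"
    by (simp add: ideal_power_def nat_pow_def ideals_set_def)
  also have "\<dots> = mono_ideal (generated_expos n (A 0))"
    by (auto simp: mono_ideal_def generated_expos_def A0 multiples_def)
  finally show ?case .
next
  case (Suc k)
  have "ideal_power n (mono_ideal (generated_expos n (A 1)) :: 'k mpoly set) (Suc k) =
      ideal_prod (poly_ring n) (ideal_power n (mono_ideal (generated_expos n (A 1))) k) (mono_ideal (generated_expos n (A 1)))"
    by (simp add: ideal_power_def nat_pow_def ideals_set_def)
  also have "\<dots> = mono_ideal (generated_expos n (A (Suc k)))"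
    unfolding Suc ideal_prod_mono_ideal[OF generated_expo_ideal[OF A] generated_expo_ideal[OF A]]
      generated_expos_add[OF A A] step ..
  finally show ?case .
qed

section \<open>Sets of exponents with the exchange property\<close>

text \<open>
  The symmetric exchange condition for the bases of a discrete polymatroid, in the direction in
  which \<open>u\<close> gains the entry \<open>s\<close>.
\<close>

definition exchange_property :: "expo set \<Rightarrow> bool" where
  "exchange_property A \<longleftrightarrow> (\<forall>u\<in>A. \<forall>v\<in>A. \<forall>s. lookup u s < lookup v s \<longrightarrow>
    (\<exists>t. lookup v t < lookup u t \<and> u + single s 1 - single t 1 \<in> A))"

text \<open>
  The variables by which \<open>u\<close> can be moved to a lexicographically larger element of
  \<open>A\<close>.
\<close>

definition exchange_vars :: "nat \<Rightarrow> expo set \<Rightarrow> expo \<Rightarrow> nat set" where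
  "exchange_vars n A u = {s \<in> {1..n}. \<exists>t>s. 0 < lookup u t \<and> u + single s 1 - single t 1 \<in> A}"

lemma expo_less_iff: "u < v \<longleftrightarrow> (\<exists>s. lookup u s < lookup v s \<and> (\<forall>r<s. lookup u r = lookup v r))" for u v :: expo
  by (simp add: less_poly_mapping.rep_eq less_fun_def)

lemma lookup_exchange:
  fixes u :: expo
  shows "s \<noteq> t \<Longrightarrow> lookup (u + single s 1 - single t 1) r =
    (if r = s then lookup u r + 1 else if r = t then lookup u r - 1 else lookup u r)"
  by (simp add: lookup_add lookup_minus lookup_single when_def)

text \<open>
  If \<open>v\<close> is lexicographically larger than \<open>u\<close> and \<open>s\<close> is
  the first index where they differ, then \<open>u\<close> can be exchanged at \<open>s\<close>
  against some \<open>t\<close> with \<open>v\<close> smaller at \<open>t\<close>, and such a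
  \<open>t\<close> lies after \<open>s\<close>.
\<close>

lemma exchange_linear_quotients:
  assumes A: "A \<subseteq> expos n" and ex: "exchange_property A"
  shows "linear_quotients n A (exchange_vars n A)"
  unfolding linear_quotients_def
proof (intro ballI conjI impI)
  fix u assume u: "u \<in> A"
  show "exchange_vars n A u \<subseteq> {1..n}" by (auto simp: exchange_vars_def)
  show "\<exists>w\<in>A. u < w \<and> u + single s 1 \<in> multiples n w" if s: "s \<in> exchange_vars n A u" for s
  proof -
    from s obtain t where t: "s < t" "0 < lookup u t" and w: "u + single s 1 - single t 1 \<in> A"
      by (auto simp: exchange_vars_def)
    define w where "w = u + single s 1 - single t 1"
    have lw: "lookup w r = (if r = s then lookup u r + 1 else if r = t then lookup u r - 1 else lookup u r)" for r
      unfolding w_def using t by (intro lookup_exchange) simp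
    have "u < w" unfolding expo_less_iff using t by (intro exI[of _ s]) (auto simp: lw)
    moreover have "t \<in> {1..n}" using t u A by (metis expos_iff not_less0 subsetD)
    then have "u + single s 1 \<in> multiples n w"
      using t by (auto simp: multiples_iff lw lookup_add lookup_single when_def)
    ultimately show ?thesis using w unfolding w_def by blast
  qed
  fix v assume v: "v \<in> A" and "u < v"
  then obtain s where s: "lookup u s < lookup v s" "\<And>r. r < s \<Longrightarrow> lookup u r = lookup v r"
    unfolding expo_less_iff by blast
  obtain t where t: "lookup v t < lookup u t" "u + single s 1 - single t 1 \<in> A"
    using ex u v s(1) unfolding exchange_property_def by blast
  have "s < t" using t(1) s by (metis linorder_neqE_nat order_less_asym order_less_irrefl)
  moreover have "s \<in> {1..n}" using s v A by (metis expos_iff not_less0 subsetD)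
  ultimately have "s \<in> exchange_vars n A u"
    using t unfolding exchange_vars_def by (auto intro!: exI[of _ t])
  then show "\<exists>t\<in>exchange_vars n A u. lookup u t < lookup v t" using s by blast
qed

lemma finite_expos_of_degree: "finite {a \<in> expos n. total_degree a = d}"
proof (rule finite_imageD)
  show "inj_on lookup {a \<in> expos n. total_degree a = d}"
    by (rule inj_onI, rule poly_mapping_eqI) (rule fun_cong)
  show "finite (lookup ` {a \<in> expos n. total_degree a = d})"
  proof (rule finite_subset)
    show "lookup ` {a \<in> expos n. total_degree a = d} \<subseteq>
      {f. \<forall>x. (x \<in> {1..n} \<longrightarrow> f x \<in> {..d}) \<and> (x \<notin> {1..n} \<longrightarrow> f x = 0)}"
    proof (intro subsetI CollectI allI conjI impI)
      fix f x assume "f \<in> lookup ` {a \<in> expos n. total_degree a = d}"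
      then obtain a where a: "f = lookup a" "a \<in> expos n" "total_degree a = d" by blast
      show "f x = 0" if "x \<notin> {1..n}" using a that by (simp add: expos_iff)
      show "f x \<in> {..d}" if "x \<in> {1..n}"
        using a that total_degree_eq[of "{1..n}" a] member_le_sum[of x "{1..n}" "lookup a"]
        by (auto simp: expos_def)
    qed
  qed (rule finite_set_of_finite_funs, simp_all)
qed

section \<open>Exponents with bounded weight on each part\<close>

definition weight :: "expo \<Rightarrow> nat set \<Rightarrow> nat" where
  "weight a S = (\<Sum>r\<in>S. lookup a r)"

text \<open>
  The degree that remains when one unit is removed from each variable occurring in
  \<open>a\<close>; truncated subtraction makes the other entries contribute zero.
\<close>

definition excess :: "expo \<Rightarrow> nat set \<Rightarrow> nat" where
  "excess a S = (\<Sum>r\<in>S. lookup a r - 1)"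

lemma total_degree_weight: "a \<in> expos n \<Longrightarrow> total_degree a = weight a {1..n}"
  unfolding weight_def by (rule total_degree_eq) (auto simp: expos_def)

text \<open>
  Bounds on the excess are bounds on the number of variables that occur.
\<close>

lemma weight_excess: "finite S \<Longrightarrow> weight a S = excess a S + card (keys a \<inter> S)"
proof -
  assume S: "finite S"
  have "weight a S = (\<Sum>r\<in>S. (lookup a r - 1) + (if r \<in> keys a then 1 else 0))"
    unfolding weight_def by (rule sum.cong) (auto simp: in_keys_iff)
  also have "\<dots> = excess a S + card (keys a \<inter> S)"
    using S by (simp add: sum.distrib excess_def sum.If_cases Int_commute)
  finally show ?thesis .
qed

lemma weight_add: "weight (a + b) S = weight a S + weight b S"
  by (simp add: weight_def lookup_add sum.distrib)

lemma weight_single: "finite S \<Longrightarrow> weight (single t x) S = (if t \<in> S then x else 0)"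
  by (simp add: weight_def lookup_single when_def)

lemma weight_squarefree: "finite S \<Longrightarrow> finite T \<Longrightarrow> weight (squarefree_expo T) S = card (T \<inter> S)"
  by (simp add: weight_def lookup_squarefree_expo sum.If_cases Int_commute)

lemma excess_add_single:
  "finite S \<Longrightarrow> excess (a + single t 1) S = excess a S + (if t \<in> S \<and> 0 < lookup a t then 1 else 0)"
proof -
  assume S: "finite S"
  have "excess (a + single t 1) S = (\<Sum>r\<in>S. (lookup a r - 1) + (if r = t then (if 0 < lookup a t then 1 else 0) else 0))"
    unfolding excess_def by (rule sum.cong) (auto simp: lookup_add lookup_single when_def)
  also have "\<dots> = excess a S + (if t \<in> S \<and> 0 < lookup a t then 1 else 0)"
    using S by (simp add: sum.distrib excess_def)
  finally show ?thesis .
qed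

lemma exchange_eq:
  fixes u :: expo
  assumes "s \<noteq> t" "0 < lookup u t"
  shows "u = (u - single t 1) + single t 1" "u + single s 1 - single t 1 = (u - single t 1) + single s 1"
  using assms by (auto intro!: poly_mapping_eqI simp: lookup_add lookup_minus lookup_single when_def)

lemma weight_exchange:
  assumes "s \<noteq> t" "0 < lookup u t" "finite S"
  shows "weight (u + single s 1 - single t 1) S + (if t \<in> S then 1 else 0) = weight u S + (if s \<in> S then 1 else 0)"
proof -
  have "weight u S = weight (u - single t 1) S + (if t \<in> S then 1 else 0)"
    by (subst exchange_eq(1)[OF assms(1,2)]) (simp only: weight_add weight_single[OF assms(3)])
  moreover have "weight (u + single s 1 - single t 1) S = weight (u - single t 1) S + (if s \<in> S then 1 else 0)"
    unfolding exchange_eq(2)[OF assms(1,2)] by (simp only: weight_add weight_single[OF assms(3)])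
  ultimately show ?thesis by simp
qed

lemma excess_exchange:
  assumes "s \<noteq> t" "0 < lookup u t" "finite S"
  shows "excess (u + single s 1 - single t 1) S + (if t \<in> S \<and> 2 \<le> lookup u t then 1 else 0) =
    excess u S + (if s \<in> S \<and> 1 \<le> lookup u s then 1 else 0)"
proof -
  let ?w = "u - single t 1"
  have l: "lookup ?w s = lookup u s" "lookup ?w t = lookup u t - 1"
    using assms by (simp_all add: lookup_minus lookup_single when_def)
  have "excess u S = excess ?w S + (if t \<in> S \<and> 0 < lookup ?w t then 1 else 0)"
    by (subst exchange_eq(1)[OF assms(1,2)]) (rule excess_add_single[OF assms(3)])
  moreover have "excess (u + single s 1 - single t 1) S = excess ?w S + (if s \<in> S \<and> 0 < lookup ?w s then 1 else 0)"
    unfolding exchange_eq(2)[OF assms(1,2)] by (rule excess_add_single[OF assms(3)])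
  ultimately show ?thesis unfolding l by auto
qed

lemma exchange_in_expos:
  assumes "u \<in> expos n" "s \<in> {1..n}"
  shows "u + single s 1 - single t 1 \<in> expos n"
  using assms by (auto simp: expos_iff lookup_add lookup_minus lookup_single when_def)

section \<open>Powers of the edge ideal and their multigraded shifts\<close>

text \<open>
  A complete multipartite graph on \<open>{1..n}\<close> is a colouring of the vertices, with
  edges joining different colours.
\<close>

locale colouring =
  fixes n :: nat and col :: "nat \<Rightarrow> nat"
begin

definition part :: "nat \<Rightarrow> nat set" where
  "part p = {s \<in> {1..n}. col s = p}"

text \<open>
  The exponents of the minimal generators of the \<open>k\<close>-th power of the edge ideal.
\<close>

definition gens :: "nat \<Rightarrow> expo set" where
  "gens k = {a \<in> expos n. weight a {1..n} = 2 * k \<and> (\<forall>p. weight a (part p) \<le> k)}"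

text \<open>
  The multidegrees in which \<open>Tor\<^sub>i\<close> of the \<open>k\<close>-th power is
  nonzero, for \<open>k \<ge> 1\<close>. For such a degree \<open>c\<close> the condition on the
  total excess says that more than \<open>i\<close> variables occur in \<open>c\<close>. The
  bound on the excess of a part says that a part of weight \<open>k + e\<close>,
  \<open>e > 0\<close>, contains more than \<open>e\<close> of them, and the bound
  \<open>k + i\<close> on its weight leaves at least \<open>k\<close> for the other parts.
\<close>

definition shifts :: "nat \<Rightarrow> nat \<Rightarrow> expo set" where
  "shifts k i = {a \<in> expos n. weight a {1..n} = 2 * k + i \<and> excess a {1..n} < 2 * k \<and>
    (\<forall>p. weight a (part p) \<le> k + i \<and> excess a (part p) < k)}"

lemma finite_part [simp]: "finite (part p)" by (simp add: part_def)

lemma part_subset: "part p \<subseteq> {1..n}" by (auto simp: part_def)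

lemma sum_weights: "(\<Sum>p\<in>col ` {1..n}. weight a (part p)) = weight a {1..n}"
  unfolding weight_def part_def by (rule sum.image_gen[symmetric]) simp

lemma larger_entry:
  fixes f g :: "nat \<Rightarrow> nat"
  assumes "finite S" "s \<in> S" "f s < g s" "sum g S \<le> sum f S"
  shows "\<exists>t\<in>S. g t < f t"
proof (rule ccontr)
  assume "\<not> ?thesis"
  then have "sum f S < sum g S"
    using assms(1-3) by (intro sum_strict_mono_ex1) (auto simp: not_less)
  with assms(4) show False by simp
qed

text \<open>
  Raising the entry \<open>s\<close> of \<open>u\<close> can only violate the weight or excess
  bound of the part of \<open>s\<close>, or the bound on the total excess. If the excess bound
  of the part is tight, comparing excesses with \<open>v\<close> gives an index \<open>t\<close>
  in the same part with \<open>u\<close> at least \<open>2\<close> there, and the exchange then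
  preserves weight and excess of every part. If only the total excess is tight, the same
  comparison over all variables gives such a \<open>t\<close> anywhere. If the weight of the
  part is tight, \<open>t\<close> is found in the part by comparing weights. The one combination
  for which these choices conflict, total excess and weight of the part tight but not its
  excess, cannot occur: \<open>u\<close> would then involve exactly \<open>i + 1\<close>
  variables, but at least \<open>i + 2\<close> of them in that part.
\<close>

lemma exchange_property_shifts: "exchange_property (shifts k i)"
  unfolding exchange_property_def
proof (intro ballI allI impI)
  fix u v s assume u: "u \<in> shifts k i" and v: "v \<in> shifts k i" and s: "lookup u s < lookup v s"
  let ?p = "col s"
  have sn: "s \<in> {1..n}" using s v by (auto simp: shifts_def expos_iff)
  have sp: "s \<in> part ?p" using sn by (simp add: part_def)
  have wu: "weight u {1..n} = 2 * k + i" "excess u {1..n} < 2 * k" "\<And>p. weight u (part p) \<le> k + i" "\<And>p. excess u (part p) < k"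
    and wv: "weight v {1..n} = 2 * k + i" "excess v {1..n} < 2 * k" "\<And>p. weight v (part p) \<le> k + i" "\<And>p. excess v (part p) < k"
    and ue: "u \<in> expos n" using u v by (auto simp: shifts_def)
  have "\<exists>t\<in>{1..n}. lookup v t < lookup u t \<and> (col t = ?p \<or> weight u (part ?p) < k + i) \<and>
      (1 \<le> lookup u s \<and> Suc (excess u (part ?p)) = k \<longrightarrow> col t = ?p \<and> 2 \<le> lookup u t) \<and>
      (1 \<le> lookup u s \<and> Suc (excess u {1..n}) = 2 * k \<longrightarrow> 2 \<le> lookup u t)"
  proof (cases "1 \<le> lookup u s \<and> Suc (excess u (part ?p)) = k")
    case True
    have "excess v (part ?p) \<le> excess u (part ?p)" using True wv(4)[of ?p] by simp
    then have "\<exists>t\<in>part ?p. lookup v t - 1 < lookup u t - 1"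
      unfolding excess_def by (rule larger_entry[OF finite_part sp, rotated]) (use s True[THEN conjunct1] in arith)+
    then show ?thesis by (force simp: part_def)
  next
    case notQ: False
    show ?thesis
    proof (cases "1 \<le> lookup u s \<and> Suc (excess u {1..n}) = 2 * k")
      case True
      have "excess v {1..n} \<le> excess u {1..n}" using True wv(2) by simp
      then have "\<exists>t\<in>{1..n}. lookup v t - 1 < lookup u t - 1"
        unfolding excess_def by (rule larger_entry[OF finite_atLeastAtMost sn, rotated]) (use s True[THEN conjunct1] in arith)+
      then obtain t where t: "t \<in> {1..n}" "lookup v t - 1 < lookup u t - 1" by blast
      have "weight u (part ?p) < k + i"
      proof (rule ccontr)
        assume "\<not> ?thesis"
        then have "weight u (part ?p) = k + i" using wu(3)[of ?p] by simp
        moreover have "excess u (part ?p) + 1 < k" using notQ True wu(4)[of ?p] by simp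
        moreover have "card (keys u \<inter> part ?p) \<le> card (keys u \<inter> {1..n})"
          using part_subset[of ?p] by (intro card_mono) auto
        ultimately show False
          using weight_excess[of "part ?p" u] weight_excess[of "{1..n}" u] wu(1) True by simp
      qed
      then show ?thesis using t notQ by (intro bexI[of _ t]) auto
    next
      case notN: False
      show ?thesis
      proof (cases "weight u (part ?p) < k + i")
        case True
        have "weight v {1..n} \<le> weight u {1..n}" using wu(1) wv(1) by simp
        then have "\<exists>t\<in>{1..n}. lookup v t < lookup u t"
          unfolding weight_def by (rule larger_entry[where f = "lookup u" and g = "lookup v", OF finite_atLeastAtMost sn s])
        then show ?thesis using True notQ notN by blast
      next
        case False
        have "weight v (part ?p) \<le> weight u (part ?p)" using False wv(3)[of ?p] by simp
        then have "\<exists>t\<in>part ?p. lookup v t < lookup u t"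
          unfolding weight_def by (rule larger_entry[where f = "lookup u" and g = "lookup v", OF finite_part sp s])
        then show ?thesis using notQ notN by (force simp: part_def)
      qed
    qed
  qed
  then obtain t where tn: "t \<in> {1..n}" and tv: "lookup v t < lookup u t"
    and W: "col t = ?p \<or> weight u (part ?p) < k + i"
    and Q: "1 \<le> lookup u s \<Longrightarrow> Suc (excess u (part ?p)) = k \<Longrightarrow> col t = ?p \<and> 2 \<le> lookup u t"
    and N: "1 \<le> lookup u s \<Longrightarrow> Suc (excess u {1..n}) = 2 * k \<Longrightarrow> 2 \<le> lookup u t" by blast
  have st: "s \<noteq> t" and ut: "0 < lookup u t" using s tv by auto
  let ?w = "u + single s 1 - single t 1"
  have "weight ?w {1..n} = 2 * k + i"
    using weight_exchange[OF st ut, of "{1..n}"] sn tn wu(1) by simp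
  moreover have "excess ?w {1..n} < 2 * k"
  proof (cases "1 \<le> lookup u s \<and> Suc (excess u {1..n}) = 2 * k")
    case True
    then show ?thesis using excess_exchange[OF st ut, of "{1..n}"] sn tn wu(2) N by (simp split: if_splits)
  next
    case False
    then have "1 \<le> lookup u s \<Longrightarrow> Suc (excess u {1..n}) < 2 * k" using wu(2) by arith
    then show ?thesis using excess_exchange[OF st ut, of "{1..n}"] sn tn wu(2) by (simp split: if_splits)
  qed
  moreover have "weight ?w (part p) \<le> k + i" for p
    using weight_exchange[OF st ut finite_part, of p] wu(3)[of p] W sn tn
    by (auto simp: part_def split: if_splits)
  moreover have "excess ?w (part p) < k" for p
  proof (cases "p = ?p")
    case p: True
    have tp: "col t = ?p \<longleftrightarrow> t \<in> part p" using tn p by (auto simp: part_def)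
    show ?thesis
    proof (cases "1 \<le> lookup u s \<and> Suc (excess u (part p)) = k")
      case True
      then have "t \<in> part p \<and> 2 \<le> lookup u t" using Q tp unfolding p by blast
      then show ?thesis using excess_exchange[OF st ut finite_part, of p] wu(4)[of p] by (simp split: if_splits)
    next
      case False
      then have "1 \<le> lookup u s \<Longrightarrow> Suc (excess u (part p)) < k" using wu(4)[of p] by arith
      then show ?thesis using excess_exchange[OF st ut finite_part, of p] wu(4)[of p] by (simp split: if_splits)
    qed
  next
    case False
    then have "s \<notin> part p" by (simp add: part_def)
    then show ?thesis using excess_exchange[OF st ut finite_part, of p] wu(4)[of p] by simp
  qed
  moreover have "?w \<in> expos n" by (rule exchange_in_expos[OF ue sn])
  ultimately have "?w \<in> shifts k i" unfolding shifts_def by blast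
  then show "\<exists>t. lookup v t < lookup u t \<and> u + single s 1 - single t 1 \<in> shifts k i" using tv by blast
qed

text \<open>
  For \<open>i = 0\<close> and positive \<open>k\<close> the excess bounds follow from the
  weight bounds, as every nonempty support reduces the weight by at least one.
\<close>

lemma gens_eq_shifts:
  assumes "1 \<le> k"
  shows "gens k = shifts k 0"
proof -
  have less: "excess a S < K" if "finite S" "weight a S \<le> K" "0 < K" for a S K
  proof (cases "keys a \<inter> S = {}")
    case True
    have "lookup a x = 0" if "x \<in> S" for x using True that by (metis disjoint_iff in_keys_iff)
    then have "excess a S = 0" unfolding excess_def by (intro sum.neutral) simp
    then show ?thesis using that by simp
  next
    case False
    then have "0 < card (keys a \<inter> S)" by (simp add: card_gt_0_iff)
    then show ?thesis using that weight_excess[of S a] by simp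
  qed
  show ?thesis
    unfolding gens_def shifts_def using assms less[OF finite_part] less[of "{1..n}" _ "2 * k"] by auto
qed

lemma exchange_property_gens: "1 \<le> k \<Longrightarrow> exchange_property (gens k)"
  by (simp add: gens_eq_shifts exchange_property_shifts)


text \<open>
  Let \<open>M\<close> be the last variable of \<open>u\<close>. It is not in \<open>T\<close>,
  since elements of \<open>T\<close> are exchanged against later variables of \<open>u\<close>;
  this bounds the total excess. If a part is saturated, that is, of weight \<open>k\<close>,
  then only exchanges inside it are possible, so the same argument applies to the last variable
  of \<open>u\<close> in that part.
\<close>

lemma multidegree_in_shifts:
  assumes k: "1 \<le> k" and u: "u \<in> gens k" and T: "T \<subseteq> exchange_vars n (gens k) u"
  shows "u + squarefree_expo T \<in> shifts k (card T)"
proof -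
  let ?c = "u + squarefree_expo T"
  have wu: "u \<in> expos n" "weight u {1..n} = 2 * k" "\<And>p. weight u (part p) \<le> k" using u by (auto simp: gens_def)
  have Tn: "T \<subseteq> {1..n}" using T by (auto simp: exchange_vars_def)
  then have finT: "finite T" using finite_subset by blast
  have lc: "lookup ?c r = lookup u r + (if r \<in> T then 1 else 0)" for r
    by (simp add: lookup_add lookup_squarefree_expo[OF finT])
  have ku: "keys u \<subseteq> {1..n}" using wu(1) by (simp add: expos_def)
  \<comment> \<open>Adding \<open>T\<close> raises an entry by at most one and the excess subtracts it again; at \<open>M\<close> nothing
    was added, so one unit is lost there.\<close>
  have less: "excess ?c S < weight u S" if "finite S" "M \<in> keys u \<inter> S" "M \<notin> T" for S M
    unfolding excess_def weight_def
  proof (rule sum_strict_mono_ex1[OF that(1)])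
    show "\<forall>x\<in>S. lookup ?c x - 1 \<le> lookup u x" by (simp add: lc)
    show "\<exists>a\<in>S. lookup ?c a - 1 < lookup u a"
      using that(2,3) by (intro bexI[of _ M]) (auto simp: lc in_keys_iff)
  qed
  have le: "excess ?c S \<le> weight u S" for S
    unfolding excess_def weight_def by (rule sum_mono) (simp add: lc)
  have nonempty: "keys u \<inter> S \<noteq> {}" if "0 < weight u S" "finite S" for S
  proof
    assume "keys u \<inter> S = {}"
    then have "weight u S = 0" unfolding weight_def by (intro sum.neutral) (auto simp: disjoint_iff in_keys_iff)
    then show False using that by simp
  qed
  have "excess ?c {1..n} < 2 * k"
  proof -
    let ?M = "Max (keys u \<inter> {1..n})"
    have ne: "keys u \<inter> {1..n} \<noteq> {}" using nonempty[of "{1..n}"] wu(2) k by simp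
    then have M: "?M \<in> keys u \<inter> {1..n}" by (intro Max_in) auto
    have "?M \<notin> T"
    proof
      assume "?M \<in> T"
      then obtain t where t: "?M < t" "0 < lookup u t" using T by (auto simp: exchange_vars_def)
      then have "t \<in> keys u" by (simp add: in_keys_iff)
      then have "t \<in> keys u \<inter> {1..n}" using ku by blast
      then have "t \<le> ?M" by (intro Max_ge) auto
      then show False using t(1) by simp
    qed
    then show ?thesis using less[OF _ M] wu(2) by simp
  qed
  moreover have "weight ?c (part p) \<le> k + card T" for p
  proof -
    have "card (T \<inter> part p) \<le> card T" using finT by (intro card_mono) auto
    then show ?thesis using wu(3)[of p] by (simp add: weight_add weight_squarefree finT)
  qed
  moreover have "excess ?c (part p) < k" for p
  proof (cases "weight u (part p) = k")
    case False
    then show ?thesis using le[of "part p"] wu(3)[of p] by simp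
  next
    case True
    let ?M = "Max (keys u \<inter> part p)"
    have ne: "keys u \<inter> part p \<noteq> {}" using nonempty[of "part p"] True k by simp
    then have M: "?M \<in> keys u \<inter> part p" by (intro Max_in) auto
    have "?M \<notin> T"
    proof
      assume "?M \<in> T"
      then obtain t where t: "?M < t" "0 < lookup u t" "u + single ?M 1 - single t 1 \<in> gens k"
        using T unfolding exchange_vars_def by blast
      have "weight (u + single ?M 1 - single t 1) (part p) \<le> k" using t(3) by (simp add: gens_def)
      then have "t \<in> part p"
        using weight_exchange[of ?M t u "part p"] t(1,2) True M by (auto split: if_splits)
      then have "t \<le> ?M" using t(2) by (intro Max_ge) (auto simp: in_keys_iff)
      then show False using t(1) by simp
    qed
    then show ?thesis using less[OF finite_part M] True by simp
  qed
  moreover have "?c \<in> expos n"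
    using wu(1) Tn by (auto simp: expos_iff lc)
  moreover have "weight ?c {1..n} = 2 * k + card T"
    unfolding weight_add weight_squarefree[OF finite_atLeastAtMost finT] wu(2) using Tn by (simp add: Int_absorb2)
  ultimately show ?thesis by (simp add: shifts_def)
qed

text \<open>
  If two parts have weight above \<open>k\<close>, subtracting \<open>k\<close> from each of
  them already leaves \<open>i\<close>; if there is only one, the bound on its weight is used.
\<close>

lemma sum_overweight:
  assumes w: "weight c {1..n} = 2 * k + i" "\<And>p. weight c (part p) \<le> k + i"
  shows "(\<Sum>p\<in>col ` {1..n}. weight c (part p) - k) \<le> i"
proof -
  let ?C = "col ` {1..n}"
  let ?f = "\<lambda>p. weight c (part p)"
  have total: "(\<Sum>p\<in>?C. ?f p) = 2 * k + i" unfolding sum_weights by (rule w(1))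
  have le: "(\<Sum>p\<in>D. ?f p - k) \<le> (\<Sum>p\<in>D. ?f p)" for D by (rule sum_mono) simp
  show ?thesis
  proof (cases "\<exists>p\<in>?C. k < ?f p")
    case False
    then have zero: "(\<Sum>p\<in>?C. ?f p - k) = 0" by (intro sum.neutral) auto
    show ?thesis unfolding zero by simp
  next
    case True
    then obtain p where p: "p \<in> ?C" "k < ?f p" by blast
    have rp: "(\<Sum>p\<in>?C. g p) = g p + (\<Sum>p\<in>?C - {p}. g p)" for g :: "nat \<Rightarrow> nat"
      using p(1) by (intro sum.remove) auto
    show ?thesis
    proof (cases "\<exists>q\<in>?C - {p}. k < ?f q")
      case False
      have zero: "(\<Sum>q\<in>?C - {p}. ?f q - k) = 0"
      proof (intro sum.neutral ballI)
        fix q assume "q \<in> ?C - {p}"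
        then have "\<not> k < ?f q" using False by blast
        then show "?f q - k = 0" by simp
      qed
      show ?thesis using w(2)[of p] unfolding rp zero by simp
    next
      case True
      then obtain q where q: "q \<in> ?C - {p}" "k < ?f q" by blast
      have rq: "(\<Sum>p\<in>?C - {p}. g p) = g q + (\<Sum>p\<in>?C - {p} - {q}. g p)" for g :: "nat \<Rightarrow> nat"
        using q(1) by (intro sum.remove) auto
      show ?thesis
        using total le[of "?C - {p} - {q}"] p(2) q(2) unfolding rp rq by linarith
    qed
  qed
qed

text \<open>
  To recover \<open>u\<close> from \<open>c\<close>, one removes one unit from each of
  \<open>i\<close> variables. From a part of weight \<open>k + e\<close> at least
  \<open>e\<close> have to be removed; they are taken different from the last variable of
  \<open>c\<close> in that part, which is possible by the bound on its excess. The remaining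
  ones are taken arbitrarily, except for the last variable of \<open>c\<close>. A part that
  loses more than it must is not saturated in \<open>u\<close>. So each removed variable can be
  exchanged against the last variable of its part if the part is saturated in \<open>u\<close>,
  and against the last variable of \<open>c\<close> otherwise.
\<close>

lemma shifts_decompose:
  assumes k: "1 \<le> k" and c: "c \<in> shifts k i"
  obtains u T where "c = u + squarefree_expo T" "u \<in> gens k" "T \<subseteq> exchange_vars n (gens k) u" "card T = i"
proof -
  have wc: "c \<in> expos n" "weight c {1..n} = 2 * k + i" "excess c {1..n} < 2 * k"
    "\<And>p. weight c (part p) \<le> k + i" "\<And>p. excess c (part p) < k" using c by (auto simp: shifts_def)
  have kc: "keys c \<subseteq> {1..n}" using wc(1) by (simp add: expos_def)
  have cardk: "i < card (keys c)"
    using weight_excess[of "{1..n}" c] wc(2,3) kc by (simp add: Int_absorb2)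
  define M0 where "M0 = Max (keys c)"
  have M0: "M0 \<in> keys c" "\<And>s. s \<in> keys c \<Longrightarrow> s \<le> M0"
    using cardk by (auto simp: M0_def intro!: Max_in)
  define Mp where "Mp p = Max (keys c \<inter> part p)" for p
  have "\<exists>R. R \<subseteq> keys c \<inter> part p - {Mp p} \<and> card R = weight c (part p) - k" for p
  proof (cases "k < weight c (part p)")
    case True
    have card: "weight c (part p) - k < card (keys c \<inter> part p)"
      using weight_excess[of "part p" c] wc(5)[of p] True by simp
    then have "keys c \<inter> part p \<noteq> {}" by auto
    then have "Mp p \<in> keys c \<inter> part p" unfolding Mp_def by (intro Max_in) auto
    then have "card (keys c \<inter> part p - {Mp p}) = card (keys c \<inter> part p) - 1" by (simp add: card_Diff_singleton)
    then have "weight c (part p) - k \<le> card (keys c \<inter> part p - {Mp p})" using card by simp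
    then show ?thesis by (metis obtain_subset_with_card_n)
  next
    case False
    then show ?thesis by (intro exI[of _ "{}"]) simp
  qed
  then obtain R where R: "\<And>p. R p \<subseteq> keys c \<inter> part p - {Mp p}" "\<And>p. card (R p) = weight c (part p) - k" by metis
  \<comment> \<open>The variables that have to lose one unit.\<close>
  define T0 where "T0 = (\<Union>p\<in>col ` {1..n}. R p)"
  have "card T0 \<le> (\<Sum>p\<in>col ` {1..n}. card (R p))" unfolding T0_def by (rule card_UN_le) simp
  also have "\<dots> \<le> i" unfolding R(2) by (rule sum_overweight[OF wc(2,4)])
  finally have cardT0: "card T0 \<le> i" .
  have M0p: "Mp (col M0) = M0"
    unfolding Mp_def using M0 kc by (intro Max_eqI) (auto simp: part_def)
  have M0R: "M0 \<notin> R p" for p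
  proof
    assume "M0 \<in> R p"
    then have "M0 \<in> part p" "M0 \<noteq> Mp p" using R(1)[of p] by blast+
    then show False using M0p by (auto simp: part_def)
  qed
  have "T0 \<subseteq> keys c - {M0}" unfolding T0_def using R(1) M0R by blast
  moreover have "i \<le> card (keys c - {M0})" using cardk M0(1) by (simp add: card_Diff_singleton)
  ultimately obtain T where T: "T0 \<subseteq> T" "T \<subseteq> keys c - {M0}" "card T = i"
    using exists_subset_between[OF cardT0] by (metis finite_Diff finite_keys)
  have finT: "finite T" using T(2) by (rule finite_subset) simp
  define u where "u = c - squarefree_expo T"
  have lu: "lookup u r = lookup c r - (if r \<in> T then 1 else 0)" for r
    by (simp add: u_def lookup_minus lookup_squarefree_expo[OF finT])
  have cu: "c = u + squarefree_expo T"
    using T(2) by (intro poly_mapping_eqI) (auto simp: lookup_add lu lookup_squarefree_expo[OF finT] in_keys_iff)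
  have Tn: "T \<subseteq> {1..n}" using T(2) kc by blast
  have weight_cu: "weight c S = weight u S + card (T \<inter> S)" if "finite S" for S
    using that by (subst cu) (simp add: weight_add weight_squarefree finT)
  have wu: "weight u {1..n} = 2 * k"
    using weight_cu[of "{1..n}"] wc(2) T(3) Tn by (simp add: Int_absorb2)
  have RT: "R p \<subseteq> T \<inter> part p" for p
  proof
    fix x assume x: "x \<in> R p"
    then have "x \<in> part p" using R(1) by blast
    then have "p \<in> col ` {1..n}" by (auto simp: part_def)
    then show "x \<in> T \<inter> part p" using x T(1) \<open>x \<in> part p\<close> unfolding T0_def by blast
  qed
  have up: "weight u (part p) \<le> k" for p
  proof -
    have "card (R p) \<le> card (T \<inter> part p)" using RT finT by (intro card_mono) auto
    then show ?thesis using R(2)[of p] weight_cu[OF finite_part, of p] by simp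
  qed
  have ue: "u \<in> expos n" using wc(1) by (auto simp: expos_iff lu)
  have ug: "u \<in> gens k" using ue wu up by (simp add: gens_def)
  have "T \<subseteq> exchange_vars n (gens k) u"
  proof
    fix s assume s: "s \<in> T"
    let ?p = "col s"
    have sp: "s \<in> part ?p" and sn: "s \<in> {1..n}" using s Tn by (auto simp: part_def)
    have "\<exists>t>s. 0 < lookup u t \<and> (weight u (part ?p) = k \<longrightarrow> t \<in> part ?p)"
    proof (cases "weight u (part ?p) = k")
      case False
      have "s \<le> M0" "s \<noteq> M0" using s T(2) M0(2) by auto
      moreover have "0 < lookup u M0" using M0(1) T(2) by (auto simp: lu in_keys_iff)
      ultimately show ?thesis using False by (intro exI[of _ M0]) auto
    next
      case True
      have "card (R ?p) = card (T \<inter> part ?p)"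
        using True R(2)[of ?p] weight_cu[OF finite_part, of ?p] by simp
      then have "R ?p = T \<inter> part ?p" using RT finT by (intro card_subset_eq) auto
      then have sR: "s \<in> R ?p" and nM: "Mp ?p \<notin> T \<inter> part ?p" using s sp R(1)[of ?p] by blast+
      then have sk: "s \<in> keys c \<inter> part ?p" "s \<noteq> Mp ?p" using R(1) by blast+
      then have Mk: "Mp ?p \<in> keys c \<inter> part ?p" unfolding Mp_def by (intro Max_in) auto
      have "s \<le> Mp ?p" unfolding Mp_def using sk(1) by (intro Max_ge) auto
      moreover have "0 < lookup u (Mp ?p)" using Mk nM by (auto simp: lu in_keys_iff)
      ultimately show ?thesis using sk(2) Mk by (intro exI[of _ "Mp ?p"]) auto
    qed
    then obtain t where t: "s < t" "0 < lookup u t" "weight u (part ?p) = k \<Longrightarrow> t \<in> part ?p" by blast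
    have tn: "t \<in> {1..n}" using t(2) ue by (auto simp: expos_iff)
    have st: "s \<noteq> t" using t(1) by simp
    let ?w = "u + single s 1 - single t 1"
    have "weight ?w {1..n} = 2 * k" using weight_exchange[OF st t(2), of "{1..n}"] wu sn tn by simp
    moreover have "weight ?w (part p) \<le> k" for p
    proof (cases "p = ?p")
      case True
      then show ?thesis
        using weight_exchange[OF st t(2) finite_part, of p] up[of p] t(3) sp
        by (cases "weight u (part ?p) = k") (auto split: if_splits)
    next
      case False
      then have "s \<notin> part p" by (simp add: part_def)
      then show ?thesis using weight_exchange[OF st t(2) finite_part, of p] up[of p] by simp
    qed
    ultimately have "?w \<in> gens k" using exchange_in_expos[OF ue sn] by (simp add: gens_def)
    then show "s \<in> exchange_vars n (gens k) u" using sn t(1,2) unfolding exchange_vars_def by blast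
  qed
  from that[OF cu ug this T(3)] show ?thesis .
qed

lemma multidegrees_eq_shifts:
  assumes "1 \<le> k"
  shows "{u + squarefree_expo T | u T. u \<in> gens k \<and> T \<subseteq> exchange_vars n (gens k) u \<and> card T = i} = shifts k i"
proof (intro equalityI subsetI)
  fix c assume "c \<in> {u + squarefree_expo T | u T. u \<in> gens k \<and> T \<subseteq> exchange_vars n (gens k) u \<and> card T = i}"
  then show "c \<in> shifts k i" using multidegree_in_shifts[OF assms] by blast
next
  fix c assume "c \<in> shifts k i"
  then show "c \<in> {u + squarefree_expo T | u T. u \<in> gens k \<and> T \<subseteq> exchange_vars n (gens k) u \<and> card T = i}"
    by (rule shifts_decompose[OF assms]) blast
qed

lemma gens_0: "gens 0 = {0}"
proof -
  have "a = 0" if "a \<in> gens 0" for a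
  proof (rule poly_mapping_eqI)
    fix t
    show "lookup a t = lookup 0 t"
      using that by (cases "t \<in> {1..n}") (auto simp: gens_def weight_def expos_iff)
  qed
  then show ?thesis by (auto simp: gens_def weight_def)
qed

text \<open>
  An edge between the two heaviest parts is split off. After this their weights are at most
  \<open>k\<close>, and a third part cannot have weight \<open>k + 1\<close>, since the three
  parts together would then exceed the total weight \<open>2 * (k + 1)\<close>.
\<close>

lemma gens_split_edge:
  assumes a: "a \<in> gens (Suc k)"
  obtains i j b where "i \<in> {1..n}" "j \<in> {1..n}" "col i \<noteq> col j" "b \<in> gens k" "a = b + (single i 1 + single j 1)"
proof -
  let ?C = "col ` {1..n}"
  let ?f = "\<lambda>p. weight a (part p)"
  have wa: "a \<in> expos n" "weight a {1..n} = 2 * Suc k" "\<And>p. ?f p \<le> Suc k" using a by (auto simp: gens_def)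
  have total: "(\<Sum>p\<in>?C. ?f p) = 2 * Suc k" unfolding sum_weights by (rule wa(2))
  have maximum: "\<exists>p\<in>D. \<forall>l\<in>D. ?f l \<le> ?f p" if D: "finite D" "D \<noteq> {}" for D
  proof -
    have "Max (?f ` D) \<in> ?f ` D" using D by (intro Max_in) auto
    then obtain p where p: "p \<in> D" "Max (?f ` D) = ?f p" by blast
    have "?f l \<le> Max (?f ` D)" if "l \<in> D" for l using that D(1) by (intro Max_ge) auto
    with p show ?thesis by auto
  qed
  have "?C \<noteq> {}"
  proof
    assume "?C = {}"
    then have "(\<Sum>p\<in>?C. ?f p) = 0" by (simp only: sum.empty)
    from trans[OF total[symmetric] this] show False by simp
  qed
  then obtain p where p: "p \<in> ?C" "\<And>l. l \<in> ?C \<Longrightarrow> ?f l \<le> ?f p"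
    using maximum[of ?C] by auto
  have rp: "(\<Sum>p\<in>?C. ?f p) = ?f p + (\<Sum>p\<in>?C - {p}. ?f p)" using p(1) by (intro sum.remove) auto
  then have pos: "0 < (\<Sum>p\<in>?C - {p}. ?f p)" using total wa(3)[of p] by simp
  then have "?C - {p} \<noteq> {}" by (metis less_irrefl sum.empty)
  then obtain q where q: "q \<in> ?C - {p}" "\<And>l. l \<in> ?C - {p} \<Longrightarrow> ?f l \<le> ?f q"
    using maximum[of "?C - {p}"] by (metis finite_Diff finite_atLeastAtMost finite_imageI)
  have fq: "0 < ?f q"
  proof (rule ccontr)
    assume "\<not> ?thesis"
    then have "(\<Sum>p\<in>?C - {p}. ?f p) = 0" using q(2) by (intro sum.neutral) fastforce
    then show False using pos by simp
  qed
  then have fp: "0 < ?f p" using p(2)[of q] q(1) by auto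
  have pick: "\<exists>i\<in>part l. 0 < lookup a i" if "0 < ?f l" for l
  proof (rule ccontr)
    assume "\<not> ?thesis"
    then have "?f l = 0" unfolding weight_def by (intro sum.neutral) auto
    then show False using that by simp
  qed
  obtain i where i: "i \<in> part p" "0 < lookup a i" using pick[OF fp] by blast
  obtain j where j: "j \<in> part q" "0 < lookup a j" using pick[OF fq] by blast
  have ij: "i \<in> {1..n}" "j \<in> {1..n}" "col i = p" "col j = q" using i(1) j(1) by (auto simp: part_def)
  then have ne: "col i \<noteq> col j" "i \<noteq> j" using q(1) by auto
  define b where "b = a - (single i 1 + single j 1)"
  have ab: "a = b + (single i 1 + single j 1)"
    using i(2) j(2) ne(2) by (intro poly_mapping_eqI) (auto simp: b_def lookup_add lookup_minus lookup_single when_def)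
  have wab: "weight a S = weight b S + (if i \<in> S then 1 else 0) + (if j \<in> S then 1 else 0)" if "finite S" for S
    using that by (subst ab) (simp add: weight_add weight_single)
  have "b \<in> expos n" using wa(1) by (auto simp: expos_iff b_def lookup_minus)
  moreover have "weight b {1..n} = 2 * k" using wab[of "{1..n}"] wa(2) ij by simp
  moreover have "weight b (part l) \<le> k" for l
  proof (cases "l = p \<or> l = q")
    case True
    then show ?thesis using wab[OF finite_part, of l] wa(3)[of l] i(1) j(1) by auto
  next
    case False
    have "?f l \<le> k"
    proof (cases "l \<in> ?C")
      case True
      have rq: "(\<Sum>p\<in>?C - {p}. ?f p) = ?f q + (\<Sum>p\<in>?C - {p} - {q}. ?f p)" using q(1) by (intro sum.remove) auto
      have "?f l \<le> (\<Sum>p\<in>?C - {p} - {q}. ?f p)" using True False by (intro member_le_sum) auto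
      moreover have "?f l \<le> ?f q" using q(2) True False by simp
      moreover have "?f q \<le> ?f p" using p(2) q(1) by simp
      ultimately show ?thesis using total rp rq by simp
    next
      case False
      then have "part l = {}" by (auto simp: part_def)
      then show ?thesis by (simp add: weight_def)
    qed
    then show ?thesis using wab[OF finite_part, of l] by simp
  qed
  ultimately have "b \<in> gens k" by (simp add: gens_def)
  from that[OF ij(1,2) ne(1) this ab] show ?thesis .
qed

lemma edge_gens:
  assumes "i \<in> {1..n}" "j \<in> {1..n}" "col i \<noteq> col j"
  shows "single i 1 + single j 1 \<in> gens 1"
proof -
  have "single i 1 + single j 1 \<in> expos n" using assms by (auto simp: expos_iff lookup_add lookup_single when_def)
  then show ?thesis using assms by (auto simp: gens_def weight_add weight_single part_def)
qed

lemma gens_1: "gens 1 = {single i 1 + single j 1 | i j. i \<in> {1..n} \<and> j \<in> {1..n} \<and> col i \<noteq> col j}"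
proof (intro equalityI subsetI)
  fix a assume "a \<in> gens 1"
  then have "a \<in> gens (Suc 0)" by simp
  then show "a \<in> {single i 1 + single j 1 | i j. i \<in> {1..n} \<and> j \<in> {1..n} \<and> col i \<noteq> col j}"
    by (rule gens_split_edge) (auto simp: gens_0)
qed (use edge_gens in blast)

lemma gens_Suc: "gens (Suc k) = {a + b | a b. a \<in> gens k \<and> b \<in> gens 1}"
proof (intro equalityI subsetI)
  fix a assume "a \<in> gens (Suc k)"
  then show "a \<in> {a + b | a b. a \<in> gens k \<and> b \<in> gens 1}"
    by (rule gens_split_edge) (use edge_gens in blast)
next
  fix c assume "c \<in> {a + b | a b. a \<in> gens k \<and> b \<in> gens 1}"
  then obtain a b where c: "c = a + b" and a: "a \<in> gens k" and b: "b \<in> gens 1" by blast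
  have "weight c (part p) \<le> Suc k" for p
    using a b by (auto simp: c gens_def weight_add intro: add_mono[of _ k _ 1, simplified])
  then show "c \<in> gens (Suc k)" using a b plus_in_expos by (auto simp: c gens_def weight_add)
qed

end

section \<open>Linear resolutions of the homological shift ideals\<close>

lemma total_degree_squarefree:
  assumes "finite T"
  shows "total_degree (squarefree_expo T) = card T"
proof -
  have "keys (squarefree_expo T) \<subseteq> T"
    by (auto simp: in_keys_iff lookup_squarefree_expo[OF assms] split: if_splits)
  then show ?thesis by (simp add: total_degree_eq[OF assms] lookup_squarefree_expo[OF assms])
qed

text \<open>
  The common degree bounds all entries, so there are finitely many generators.
\<close>

lemma exchange_resolution:
  assumes A: "A \<subseteq> expos n" and ex: "exchange_property A" and deg: "\<And>a. a \<in> A \<Longrightarrow> total_degree a = d"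
  shows "\<exists>r act s (c :: nat \<Rightarrow> nat \<Rightarrow> nat \<Rightarrow> 'k::field). resolution_of n (generated_expos n A)
    (\<lambda>i. {u + squarefree_expo T | u T. u \<in> A \<and> T \<subseteq> exchange_vars n A u \<and> card T = i}) (\<lambda>i. {..<r i}) act s c"
  unfolding generated_expos_def
proof (rule linear_quotients_resolution[OF _ exchange_linear_quotients[OF A ex]])
  show "finite A" by (rule finite_subset[OF _ finite_expos_of_degree[of n d]]) (use A deg in blast)
qed

lemma total_degree_multidegree:
  assumes "total_degree u = d" "T \<subseteq> exchange_vars n A u"
  shows "total_degree (u + squarefree_expo T) = d + card T"
proof -
  have "T \<subseteq> {1..n}" using assms(2) by (auto simp: exchange_vars_def)
  then have "finite T" by (rule finite_subset) simp
  then show ?thesis by (simp add: total_degree_add total_degree_squarefree assms(1))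
qed

lemma exchange_linear_resolution:
  assumes A: "A \<subseteq> expos n" and ex: "exchange_property A" and deg: "\<And>a. a \<in> A \<Longrightarrow> total_degree a = d"
  shows "has_linear_resolution n (mono_ideal (generated_expos n A) :: 'k::field mpoly set)"
proof -
  obtain r act s and c :: "nat \<Rightarrow> nat \<Rightarrow> nat \<Rightarrow> 'k" where R: "resolution_of n (generated_expos n A)
    (\<lambda>i. {u + squarefree_expo T | u T. u \<in> A \<and> T \<subseteq> exchange_vars n A u \<and> card T = i}) (\<lambda>i. {..<r i}) act s c"
    using exchange_resolution[OF A ex deg] by blast
  show ?thesis
    by (rule linear_resolutionI[OF generated_expo_ideal[OF A] R, where d = d])
      (use deg total_degree_multidegree in blast)
qed

context colouring
begin

text \<open>
  All degrees in position \<open>i\<close> have total degree \<open>2 * k + i\<close>, so the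
  resolution by linear quotients is minimal and its degrees are those of Tor.
\<close>

lemma HS_gens:
  assumes k: "1 \<le> k"
  shows "HS n i (mono_ideal (generated_expos n (gens k)) :: 'k::field mpoly set) =
    mono_ideal (generated_expos n (shifts k i))"
proof -
  have A: "gens k \<subseteq> expos n" by (auto simp: gens_def)
  have deg: "total_degree a = 2 * k" if "a \<in> gens k" for a
    using that by (auto simp: gens_def total_degree_weight)
  obtain r act s and c :: "nat \<Rightarrow> nat \<Rightarrow> nat \<Rightarrow> 'k"
    where R: "resolution_of n (generated_expos n (gens k)) (shifts k) (\<lambda>i. {..<r i}) act s c"
    using exchange_resolution[OF A exchange_property_gens[OF k] deg] unfolding multidegrees_eq_shifts[OF k] by blast
  have "shifts k i \<inter> shifts k (Suc i) = {}" for i by (auto simp: shifts_def)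
  from Tor_nonzero_iff[OF generated_expo_ideal[OF A] R this]
  have "{a \<in> expos n. Tor_nonzero n i (mono_ideal (generated_expos n (gens k)) :: 'k mpoly set) a} = shifts k i"
    by (auto simp: shifts_def)
  then show ?thesis
    unfolding HS_def by (simp add: genideal_xpow shifts_def)
qed

lemma HS_linear_resolution:
  assumes k: "1 \<le> k"
  shows "has_linear_resolution n (HS n i (mono_ideal (generated_expos n (gens k)) :: 'k::field mpoly set))"
  unfolding HS_gens[OF k]
  by (rule exchange_linear_resolution[OF _ exchange_property_shifts, where d = "2 * k + i"])
    (auto simp: shifts_def total_degree_weight)

lemma edge_ideal_gens:
  assumes E: "E = {{i, j} | i j. i \<in> {1..n} \<and> j \<in> {1..n} \<and> col i \<noteq> col j}"
  shows "edge_ideal n E = (genideal (poly_ring n) (xpow ` gens 1) :: 'k::field mpoly set)"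
proof -
  have mem: "{i, j} \<in> E \<longleftrightarrow> i \<in> {1..n} \<and> j \<in> {1..n} \<and> col i \<noteq> col j" for i j
    unfolding E by (auto simp: doubleton_eq_iff)
  have "{var i * var j | i j. {i, j} \<in> E} = (xpow ` gens 1 :: 'k mpoly set)"
    unfolding gens_1 mem by (auto simp: var_def xpow_def mult_single image_iff)
  then show ?thesis by (simp add: edge_ideal_def)
qed

lemma homological_linear_powers_edge_ideal:
  assumes E: "E = {{i, j} | i j. i \<in> {1..n} \<and> j \<in> {1..n} \<and> col i \<noteq> col j}"
  shows "homological_linear_powers n (edge_ideal n E :: 'k::field mpoly set)"
proof -
  have A: "gens k \<subseteq> expos n" for k by (auto simp: gens_def)
  have I: "edge_ideal n E = (mono_ideal (generated_expos n (gens 1)) :: 'k mpoly set)"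
    by (simp only: edge_ideal_gens[OF E] genideal_xpow[OF A])
  have "monomial_ideal n (edge_ideal n E :: 'k mpoly set)"
    unfolding monomial_ideal_def edge_ideal_gens[OF E] using A by blast
  moreover have "has_linear_resolution n (HS n i (ideal_power n (edge_ideal n E :: 'k mpoly set) k))" if "1 \<le> k" for i k
    unfolding I ideal_power_mono_ideal[of gens, OF A gens_0 gens_Suc] by (rule HS_linear_resolution[OF that])
  ultimately show ?thesis by (simp add: homological_linear_powers_def)
qed

end

text \<open>
  The colour of a vertex is the index of its interval, the least \<open>k\<close> with the
  vertex at most \<open>t k\<close>.
\<close>

lemma complete_multipartite_colouring:
  assumes "complete_multipartite n E"
  obtains col :: "nat \<Rightarrow> nat" where "E = {{i, j} | i j. i \<in> {1..n} \<and> j \<in> {1..n} \<and> col i \<noteq> col j}"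
proof -
  obtain r :: nat and t :: "nat \<Rightarrow> nat" where t: "t 0 = 0" "t r = n" "\<And>k. k \<in> {1..r} \<Longrightarrow> t (k - 1) < t k"
    and E: "E = {{i, j} | i j k l. k \<in> {1..r} \<and> l \<in> {1..r} \<and> k \<noteq> l \<and>
             i \<in> {t (k - 1) + 1..t k} \<and> j \<in> {t (l - 1) + 1..t l}}"
    using assms unfolding complete_multipartite_def by blast
  have mono: "t k \<le> t l" if "k \<le> l" "l \<le> r" for k l
    using that
  proof (induction l rule: dec_induct)
    case (step l)
    then show ?case using t(3)[of "Suc l"] by simp
  qed simp
  define col where "col i = (LEAST k. i \<le> t k)" for i
  have part: "i \<in> {t (k - 1) + 1..t k} \<longleftrightarrow> i \<in> {1..n} \<and> col i = k" if k: "k \<in> {1..r}" for i k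
  proof
    assume i: "i \<in> {t (k - 1) + 1..t k}"
    have "k \<le> l" if "i \<le> t l" for l
    proof (rule ccontr)
      assume "\<not> k \<le> l"
      then have "t l \<le> t (k - 1)" using k by (intro mono) auto
      then show False using i that by simp
    qed
    then have "col i = k" unfolding col_def using i by (intro Least_equality) auto
    moreover have "i \<in> {1..n}" using i mono[of k r] t(2) k by simp
    ultimately show "i \<in> {1..n} \<and> col i = k" by simp
  next
    assume i: "i \<in> {1..n} \<and> col i = k"
    have "i \<le> t r" using i t(2) by simp
    then have "i \<le> t k" using i unfolding col_def by (metis LeastI)
    moreover have "\<not> i \<le> t (k - 1)"
      using i k not_less_Least[of "k - 1" "\<lambda>k. i \<le> t k"] unfolding col_def by simp
    ultimately show "i \<in> {t (k - 1) + 1..t k}" by simp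
  qed
  have range: "col i \<in> {1..r}" if "i \<in> {1..n}" for i
  proof -
    have i: "i \<le> t r" using that t(2) by simp
    then have "col i \<le> r" unfolding col_def by (rule Least_le)
    moreover have "i \<le> t (col i)" using i unfolding col_def by (rule LeastI)
    then have "col i \<noteq> 0" using that t(1) by (metis atLeastAtMost_iff le_zero_eq not_one_le_zero)
    ultimately show ?thesis by simp
  qed
  have "E = {{i, j} | i j. i \<in> {1..n} \<and> j \<in> {1..n} \<and> col i \<noteq> col j}"
  proof (intro equalityI subsetI)
    fix e assume "e \<in> E"
    then obtain i j k l where e: "e = {i, j}" "k \<in> {1..r}" "l \<in> {1..r}" "k \<noteq> l"
      "i \<in> {t (k - 1) + 1..t k}" "j \<in> {t (l - 1) + 1..t l}" unfolding E by blast
    have "i \<in> {1..n} \<and> col i = k" "j \<in> {1..n} \<and> col j = l"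
      using part[OF e(2), of i] part[OF e(3), of j] e(5,6) by simp_all
    then show "e \<in> {{i, j} | i j. i \<in> {1..n} \<and> j \<in> {1..n} \<and> col i \<noteq> col j}"
      using e(1,4) by blast
  next
    fix e assume "e \<in> {{i, j} | i j. i \<in> {1..n} \<and> j \<in> {1..n} \<and> col i \<noteq> col j}"
    then obtain i j where e: "e = {i, j}" "i \<in> {1..n}" "j \<in> {1..n}" "col i \<noteq> col j" by blast
    have "i \<in> {t (col i - 1) + 1..t (col i)}" "j \<in> {t (col j - 1) + 1..t (col j)}"
      using part[OF range[OF e(2)], of i] part[OF range[OF e(3)], of j] e(2,3) by simp_all
    then show "e \<in> E" unfolding E using e(1,4) range[OF e(2)] range[OF e(3)] by blast
  qed
  then show ?thesis by (rule that)
qed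

theorem theorem4p8:
  fixes n :: nat and E :: "nat set set"
  assumes "simple_graph n E"
    and "complete_multipartite n E"
  shows "homological_linear_powers n (edge_ideal n E :: 'k::field mpoly set)"
proof -
  obtain col :: "nat \<Rightarrow> nat" where "E = {{i, j} | i j. i \<in> {1..n} \<and> j \<in> {1..n} \<and> col i \<noteq> col j}"
    using complete_multipartite_colouring[OF assms(2)] .
  then show ?thesis by (rule colouring.homological_linear_powers_edge_ideal)
qed

end
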